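(* (i) There exist links $L$ and $L'$ whose fundamental multivariate Alexander quandles $Q_A(L)$ and $Q_A(L')$ are isomorphic but whose fundamental quandles $Q(L)$ and $Q(L')$ are not isomorphic. (ii) There exist links $L$ and $L'$ whose total multivariate Alexander quandles $U(L)$ and $U(L')$ are isomorphic, but such that the components of $L$ and $L'$ cannot be indexed so that the link module sequences of $L$ and $L'$ are equivalent.
   Context: A link $L=K_1\cup\dots\cup K_\mu$ is a union of finitely many pairwise disjoint, tame (piecewise smooth), oriented embedded circles in $\mathbb{S}^3$, with indexed components. A diagram $D$ of $L$ is obtained from a regular projection to the plane (finitely many singularities, all transverse double points called crossings) by removing short segments of the underpassing arc at each crossing. $C(D)$ is the set of crossings; $A(D)$ is the set of connected components of $D$, called arcs; $\kappa:A(D)\to\{1,\dots,\mu\}$ is such that the arc $a$ is part of the image of $K_{\kappa(a)}$. At a crossing $c$, let $a_1$ be the overpassing arc, $a_2$ the underpassing arc on the right side of $a_1$ and $a_3$ the underpassing arc on the left side of $a_1$ (with respect to the orientation of $a_1$); so $\kappa(a_2)=\kappa(a_3)$. A quandle is a set $Q$ with binary operations $\triangleright,\triangleright^{-1}$ such that for all $x,y,z$: (Q1) $x\triangleright x=x$; (Q2) $(x\triangleright y)\triangleright^{-1}y=x=(x\triangleright^{-1}y)\triangleright y$; (Q3) $(x\triangleright y)\triangleright z=(x\triangleright z)\triangleright(y\triangleright z)$. The fundamental quandle $Q(L)$ is the quandle generated by $A(D)$ subject to the relations $a_2\triangleright a_1=a_3$ and $a_3\triangleright^{-1}a_1=a_2$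 at every crossing of $D$; up to isomorphism it does not depend on $D$. Let $\Lambda_\mu=\mathbb{Z}[t_1^{\pm1},\dots,t_\mu^{\pm1}]$. Let $\rho_D:\Lambda_\mu^{C(D)}\to\Lambda_\mu^{A(D)}$ be the $\Lambda_\mu$-linear map between free modules with $\rho_D(c)=(1-t_{\kappa(a_2)})a_1+t_{\kappa(a_1)}a_2-a_3$ at each crossing $c$. The Alexander module $M_A(L)$ is the cokernel of $\rho_D$, with quotient map $\gamma_D:\Lambda_\mu^{A(D)}\to M_A(L)$. Let $I_\mu$ be the ideal of $\Lambda_\mu$ generated by $t_1-1,\dots,t_\mu-1$, and let $\phi_L:M_A(L)\to I_\mu$ be the $\Lambda_\mu$-linear epimorphism with $\phi_L(\gamma_D(a))=t_{\kappa(a)}-1$ for all $a\in A(D)$. The link module sequence of $L$ is $0\to\ker\phi_L\to M_A(L)\xrightarrow{\phi_L}I_\mu\to0$. For links $L,L'$ with the same number $\mu$ of components, their link module sequences are equivalent if there is a $\Lambda_\mu$-linear isomorphism $f:M_A(L)\to M_A(L')$ with $\phi_L=\phi_{L'}f$. The total multivariate Alexander quandle is $U(L)=\{x\in M_A(L)\mid \phi_L(x)+1\text{ is a unit of }\Lambda_\mu\}$ with $x\triangleright y=(\phi_L(y)+1)x-\phi_L(x)y$ and $x\triangleright^{-1}y=(\phi_L(y)+1)^{-1}(x+\phi_L(x)y)$. The fundamental multivariate Alexander quandle $Q_A(L)$ is the smallest subquandle of $U(L)$ containing $\gamma_D(a)$ for all $a\in A(D)$. Up to isomorphism these do not depend on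 $D$. *)

theory Defs
  imports
    "HOL-Analysis.Analysis"
    "HOL-Library.Poly_Mapping"
    "HOL-Library.Multiset"
begin

section \<open>Quandles\<close>

record 'a quandle_struct =
  elems :: "'a set"
  qop :: "'a \<Rightarrow> 'a \<Rightarrow> 'a"
  qinv :: "'a \<Rightarrow> 'a \<Rightarrow> 'a"

definition quandle :: "'a quandle_struct \<Rightarrow> bool" where
  "quandle Q \<longleftrightarrow>
     (\<forall>x\<in>elems Q. \<forall>y\<in>elems Q. qop Q x y \<in> elems Q \<and> qinv Q x y \<in> elems Q) \<and>
     (\<forall>x\<in>elems Q. qop Q x x = x) \<and>
     (\<forall>x\<in>elems Q. \<forall>y\<in>elems Q. qinv Q (qop Q x y) y = x \<and> qop Q (qinv Q x y) y = x) \<and>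
     (\<forall>x\<in>elems Q. \<forall>y\<in>elems Q. \<forall>z\<in>elems Q.
        qop Q (qop Q x y) z = qop Q (qop Q x z) (qop Q y z))"

definition quandle_isomorphic :: "'a quandle_struct \<Rightarrow> 'b quandle_struct \<Rightarrow> bool" where
  "quandle_isomorphic Q Q' \<longleftrightarrow>
     (\<exists>f. bij_betw f (elems Q) (elems Q') \<and>
          (\<forall>x\<in>elems Q. \<forall>y\<in>elems Q.
             f (qop Q x y) = qop Q' (f x) (f y) \<and> f (qinv Q x y) = qinv Q' (f x) (f y)))"

definition subquandle :: "'a set \<Rightarrow> 'a quandle_struct \<Rightarrow> bool" where
  "subquandle S Q \<longleftrightarrow> S \<subseteq> elems Q \<and> quandle (Q\<lparr>elems := S\<rparr>)"

definition generated_subquandle :: "'a quandle_struct \<Rightarrow> 'a set \<Rightarrow> 'a quandle_struct" where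
  "generated_subquandle Q X = Q\<lparr>elems := \<Inter>{S. subquandle S Q \<and> X \<subseteq> S}\<rparr>"

subsection \<open>Presentations\<close>

datatype 'a qterm = Gen 'a | Op "'a qterm" "'a qterm" | Inv "'a qterm" "'a qterm"

definition qterms :: "'a set \<Rightarrow> 'a qterm set" where
  "qterms A = {t. set_qterm t \<subseteq> A}"

text \<open>The least congruence on the terms over \<^term>\<open>A\<close> that contains the quandle
  axioms and the relators \<^term>\<open>R\<close>.\<close>

inductive qcong :: "'a set \<Rightarrow> ('a qterm \<times> 'a qterm) set \<Rightarrow> 'a qterm \<Rightarrow> 'a qterm \<Rightarrow> bool"
  for A :: "'a set" and R :: "('a qterm \<times> 'a qterm) set" where
  rel: "(s, t) \<in> R \<Longrightarrow> s \<in> qterms A \<Longrightarrow> t \<in> qterms A \<Longrightarrow> qcong A R s t"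
| refl: "s \<in> qterms A \<Longrightarrow> qcong A R s s"
| sym: "qcong A R s t \<Longrightarrow> qcong A R t s"
| trans: "qcong A R s t \<Longrightarrow> qcong A R t u \<Longrightarrow> qcong A R s u"
| op: "qcong A R s s' \<Longrightarrow> qcong A R t t' \<Longrightarrow> qcong A R (Op s t) (Op s' t')"
| inv: "qcong A R s s' \<Longrightarrow> qcong A R t t' \<Longrightarrow> qcong A R (Inv s t) (Inv s' t')"
| Q1: "x \<in> qterms A \<Longrightarrow> qcong A R (Op x x) x"
| Q2a: "x \<in> qterms A \<Longrightarrow> y \<in> qterms A \<Longrightarrow> qcong A R (Inv (Op x y) y) x"
| Q2b: "x \<in> qterms A \<Longrightarrow> y \<in> qterms A \<Longrightarrow> qcong A R (Op (Inv x y) y) x"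
| Q3: "x \<in> qterms A \<Longrightarrow> y \<in> qterms A \<Longrightarrow> z \<in> qterms A \<Longrightarrow>
         qcong A R (Op (Op x y) z) (Op (Op x z) (Op y z))"

definition presented_quandle ::
    "'a set \<Rightarrow> ('a qterm \<times> 'a qterm) set \<Rightarrow> 'a qterm set quandle_struct" where
  "presented_quandle A R = \<lparr>
     elems = qterms A // {(s, t). qcong A R s t},
     qop = (\<lambda>X Y. \<Union>s\<in>X. \<Union>t\<in>Y. {u. qcong A R (Op s t) u}),
     qinv = (\<lambda>X Y. \<Union>s\<in>X. \<Union>t\<in>Y. {u. qcong A R (Inv s t) u})\<rparr>"


section \<open>Links in the 3-sphere and their diagrams\<close>

text \<open>A smooth regular arc is \<open>C\<^sup>\<infinity>\<close> up to the end points (one-sidedly there), with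
  nowhere vanishing velocity; \<^term>\<open>G n\<close> is the \<^term>\<open>n\<close>-th derivative.\<close>

definition smooth_regular_on :: "real \<Rightarrow> real \<Rightarrow> (real \<Rightarrow> 'a::real_normed_vector) \<Rightarrow> bool" where
  "smooth_regular_on a b g \<longleftrightarrow>
     (\<exists>G :: nat \<Rightarrow> real \<Rightarrow> 'a.
        (\<forall>t\<in>{a..b}. G 0 t = g t) \<and>
        (\<forall>n. \<forall>t\<in>{a..b}. (G n has_vector_derivative G (Suc n) t) (at t within {a..b})) \<and>
        (\<forall>t\<in>{a..b}. G 1 t \<noteq> 0))"

definition piecewise_smooth :: "(real \<Rightarrow> 'a::real_normed_vector) \<Rightarrow> bool" where
  "piecewise_smooth g \<longleftrightarrow>
     (\<exists>S. finite S \<and>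
        (\<forall>a b. 0 \<le> a \<and> a < b \<and> b \<le> 1 \<and> {a<..<b} \<inter> S = {} \<longrightarrow> smooth_regular_on a b g))"

text \<open>A link is given by closed simple parametrizations of its components, in the order of their
  indices, which run from \<open>0\<close> to \<open>\<mu> - 1\<close>. A parametrization carries the orientation.\<close>

type_synonym link = "(real \<Rightarrow> real ^ 4) list"

definition is_link :: "link \<Rightarrow> bool" where
  "is_link L \<longleftrightarrow>
     L \<noteq> [] \<and>
     (\<forall>g\<in>set L. simple_path g \<and> pathfinish g = pathstart g \<and> piecewise_smooth g \<and>
                path_image g \<subseteq> sphere 0 1) \<and>
     (\<forall>i<length L. \<forall>j<length L. i \<noteq> j \<longrightarrow> path_image (L ! i) \<inter> path_image (L ! j) = {})"

definition link_support :: "link \<Rightarrow> (real ^ 4) set" where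
  "link_support L = (\<Union>g\<in>set L. path_image g)"

text \<open>Stereographic projection from \<open>(0, 0, 0, 1)\<close> sends \<open>p\<close> to
  \<open>(p\<^sub>1, p\<^sub>2, p\<^sub>3) / (1 - p\<^sub>4)\<close> in 3-space. The first two of these coordinates are the projection
  to the plane, the third is the height above it.\<close>

definition plane :: "real ^ 4 \<Rightarrow> complex" where
  "plane p = Complex (p $ 1 / (1 - p $ 4)) (p $ 2 / (1 - p $ 4))"

definition height :: "real ^ 4 \<Rightarrow> real" where
  "height p = p $ 3 / (1 - p $ 4)"

text \<open>A crossing is recorded as \<open>(i, s, j, t)\<close>: the overpassing point is component \<open>i\<close> at
  time \<open>s\<close>, the underpassing point is component \<open>j\<close> at time \<open>t\<close>. Times are taken in
  \<open>[0, 1)\<close> because \<open>0\<close> and \<open>1\<close> are the same point of a closed path.\<close>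

type_synonym crossing = "nat \<times> real \<times> nat \<times> real"

definition crossings :: "link \<Rightarrow> crossing set" where
  "crossings L = {(i, s, j, t).
     i < length L \<and> j < length L \<and> s \<in> {0..<1} \<and> t \<in> {0..<1} \<and>
     plane ((L ! i) s) = plane ((L ! j) t) \<and> height ((L ! j) t) < height ((L ! i) s)}"

fun over_point :: "link \<Rightarrow> crossing \<Rightarrow> real ^ 4" where
  "over_point L (i, s, j, t) = (L ! i) s"

fun under_point :: "link \<Rightarrow> crossing \<Rightarrow> real ^ 4" where
  "under_point L (i, s, j, t) = (L ! j) t"

fun over_tangent :: "link \<Rightarrow> crossing \<Rightarrow> complex" where
  "over_tangent L (i, s, j, t) = vector_derivative (plane \<circ> L ! i) (at s)"

fun under_tangent :: "link \<Rightarrow> crossing \<Rightarrow> complex" where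
  "under_tangent L (i, s, j, t) = vector_derivative (plane \<circ> L ! j) (at t)"

text \<open>Positive if \<open>w\<close> points to the left of the direction \<open>u\<close>, negative if it points to the right.\<close>

definition side :: "complex \<Rightarrow> complex \<Rightarrow> real" where
  "side u w = Re u * Im w - Im u * Re w"

text \<open>The projection of the link is regular: it is an immersion on the smooth pieces, has finitely
  many multiple points, and these are double points at which two smooth strands (hence no
  corners or base points of the parametrizations) meet transversely.\<close>

definition regular_projection :: "link \<Rightarrow> bool" where
  "regular_projection L \<longleftrightarrow>
     (\<forall>p\<in>link_support L. p $ 4 \<noteq> 1) \<and>
     (\<forall>g\<in>set L. piecewise_smooth (plane \<circ> g)) \<and>
     finite (crossings L) \<and>
     (\<forall>p\<in>link_support L. \<forall>q\<in>link_support L. \<forall>r\<in>link_support L.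
        plane p = plane q \<and> plane q = plane r \<longrightarrow> p = q \<or> q = r \<or> p = r) \<and>
     (\<forall>(i, s, j, t)\<in>crossings L.
        s \<noteq> 0 \<and> t \<noteq> 0 \<and>
        (plane \<circ> L ! i) differentiable (at s) \<and> (plane \<circ> L ! j) differentiable (at t) \<and>
        side (over_tangent L (i, s, j, t)) (under_tangent L (i, s, j, t)) \<noteq> 0)"

text \<open>Arcs are recorded upstairs, as subsets of the link rather than of the plane. Cutting the link
  at the underpassing points has the same effect as deleting short segments of the underpasses from
  the plane projection, without a choice of these segments.\<close>

definition arcs :: "link \<Rightarrow> (real ^ 4) set set" where
  "arcs L = components (link_support L - under_point L ` crossings L)"

definition arc_index :: "link \<Rightarrow> (real ^ 4) set \<Rightarrow> nat" where
  "arc_index L a = (THE i. i < length L \<and> a \<subseteq> path_image (L ! i))"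

definition over_arc :: "link \<Rightarrow> crossing \<Rightarrow> (real ^ 4) set" where
  "over_arc L c = (THE a. a \<in> arcs L \<and> over_point L c \<in> a)"

text \<open>Near its underpassing point, the underpass lies in the right arc as long as its projection is to
  the right of the tangent of the overpass, and likewise for the left arc.\<close>

fun right_arc :: "link \<Rightarrow> crossing \<Rightarrow> (real ^ 4) set" where
  "right_arc L (i, s, j, t) = (THE a. a \<in> arcs L \<and>
     (\<forall>\<^sub>F x in at t. side (over_tangent L (i, s, j, t))
                        (plane ((L ! j) x) - plane ((L ! j) t)) < 0 \<longrightarrow> (L ! j) x \<in> a))"

fun left_arc :: "link \<Rightarrow> crossing \<Rightarrow> (real ^ 4) set" where
  "left_arc L (i, s, j, t) = (THE a. a \<in> arcs L \<and>
     (\<forall>\<^sub>F x in at t. side (over_tangent L (i, s, j, t))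
                        (plane ((L ! j) x) - plane ((L ! j) t)) > 0 \<longrightarrow> (L ! j) x \<in> a))"

definition fundamental_quandle :: "link \<Rightarrow> (real ^ 4) set qterm set quandle_struct" where
  "fundamental_quandle L = presented_quandle (arcs L)
     (\<Union>c\<in>crossings L.
        {(Op (Gen (right_arc L c)) (Gen (over_arc L c)), Gen (left_arc L c)),
         (Inv (Gen (left_arc L c)) (Gen (over_arc L c)), Gen (right_arc L c))})"


section \<open>The Alexander module and the link module sequence\<close>

text \<open>Integer combinations of Laurent monomials, a monomial being its finitely supported family of
  exponents. The ring \<open>\<Lambda>\<^sub>\<mu>\<close> consists of those that only involve the variables with index
  below \<open>\<mu>\<close>.\<close>

type_synonym laurent = "(nat \<Rightarrow>\<^sub>0 int) \<Rightarrow>\<^sub>0 int"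

definition Lambda :: "nat \<Rightarrow> laurent set" where
  "Lambda \<mu> = {p. \<forall>m\<in>Poly_Mapping.keys p. Poly_Mapping.keys m \<subseteq> {..<\<mu>}}"

definition tvar :: "nat \<Rightarrow> laurent" where
  "tvar i = Poly_Mapping.single (Poly_Mapping.single i 1) 1"

definition Lambda_units :: "nat \<Rightarrow> laurent set" where
  "Lambda_units \<mu> = {p \<in> Lambda \<mu>. \<exists>q\<in>Lambda \<mu>. p * q = 1}"

definition Lambda_inverse :: "nat \<Rightarrow> laurent \<Rightarrow> laurent" where
  "Lambda_inverse \<mu> p = (THE q. q \<in> Lambda \<mu> \<and> p * q = 1)"

text \<open>The free module \<open>\<Lambda>\<^sub>\<mu>\<^sup>S\<close> on a finite set \<open>S\<close>.\<close>

definition free_module :: "nat \<Rightarrow> 's set \<Rightarrow> ('s \<Rightarrow> laurent) set" where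
  "free_module \<mu> S = {v. (\<forall>a\<in>S. v a \<in> Lambda \<mu>) \<and> (\<forall>a. a \<notin> S \<longrightarrow> v a = 0)}"

definition basis_vec :: "'s \<Rightarrow> 's \<Rightarrow> laurent" where
  "basis_vec a = (\<lambda>b. if b = a then 1 else 0)"

definition rho_crossing :: "link \<Rightarrow> crossing \<Rightarrow> (real ^ 4) set \<Rightarrow> laurent" where
  "rho_crossing L c = (\<lambda>b.
     (1 - tvar (arc_index L (right_arc L c))) * basis_vec (over_arc L c) b +
     tvar (arc_index L (over_arc L c)) * basis_vec (right_arc L c) b -
     basis_vec (left_arc L c) b)"

definition rho :: "link \<Rightarrow> (crossing \<Rightarrow> laurent) \<Rightarrow> (real ^ 4) set \<Rightarrow> laurent" where
  "rho L u = (\<lambda>b. \<Sum>c\<in>crossings L. u c * rho_crossing L c b)"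

text \<open>Elements of the Alexander module, the cokernel of \<^const>\<open>rho\<close>, are cosets of its image.\<close>

definition rho_image :: "link \<Rightarrow> ((real ^ 4) set \<Rightarrow> laurent) set" where
  "rho_image L = rho L ` free_module (length L) (crossings L)"

definition alex_class ::
    "link \<Rightarrow> ((real ^ 4) set \<Rightarrow> laurent) \<Rightarrow> ((real ^ 4) set \<Rightarrow> laurent) set" where
  "alex_class L v = {(\<lambda>a. v a + n a) | n. n \<in> rho_image L}"

definition alexander_module :: "link \<Rightarrow> ((real ^ 4) set \<Rightarrow> laurent) set set" where
  "alexander_module L = alex_class L ` free_module (length L) (arcs L)"

definition alex_add :: "link \<Rightarrow> ((real ^ 4) set \<Rightarrow> laurent) set \<Rightarrow>
    ((real ^ 4) set \<Rightarrow> laurent) set \<Rightarrow> ((real ^ 4) set \<Rightarrow> laurent) set" where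
  "alex_add L X Y = (\<Union>v\<in>X. \<Union>w\<in>Y. alex_class L (\<lambda>a. v a + w a))"

definition alex_smult :: "link \<Rightarrow> laurent \<Rightarrow>
    ((real ^ 4) set \<Rightarrow> laurent) set \<Rightarrow> ((real ^ 4) set \<Rightarrow> laurent) set" where
  "alex_smult L r X = (\<Union>v\<in>X. alex_class L (\<lambda>a. r * v a))"

definition gamma :: "link \<Rightarrow> (real ^ 4) set \<Rightarrow> ((real ^ 4) set \<Rightarrow> laurent) set" where
  "gamma L a = alex_class L (basis_vec a)"

text \<open>The linear map on the free module with \<open>a \<mapsto> t\<^bsub>\<kappa>(a)\<^esub> - 1\<close> is constant on the cosets.\<close>

definition phi :: "link \<Rightarrow> ((real ^ 4) set \<Rightarrow> laurent) set \<Rightarrow> laurent" where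
  "phi L X = the_elem ((\<lambda>v. \<Sum>a\<in>arcs L. v a * (tvar (arc_index L a) - 1)) ` X)"

text \<open>A link module sequence is determined by the module and \<^const>\<open>phi\<close>, whose image is the
  augmentation ideal.\<close>

definition link_sequences_equivalent :: "link \<Rightarrow> link \<Rightarrow> bool" where
  "link_sequences_equivalent L L' \<longleftrightarrow>
     length L = length L' \<and>
     (\<exists>f. bij_betw f (alexander_module L) (alexander_module L') \<and>
          (\<forall>x\<in>alexander_module L. \<forall>y\<in>alexander_module L.
             f (alex_add L x y) = alex_add L' (f x) (f y)) \<and>
          (\<forall>r\<in>Lambda (length L). \<forall>x\<in>alexander_module L.
             f (alex_smult L r x) = alex_smult L' r (f x)) \<and>
          (\<forall>x\<in>alexander_module L. phi L x = phi L' (f x)))"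

text \<open>The order of the components does not affect the underlying oriented link.\<close>

definition reindexing :: "link \<Rightarrow> link \<Rightarrow> bool" where
  "reindexing K L \<longleftrightarrow> mset K = mset L"


section \<open>Multivariate Alexander quandles\<close>

definition total_alexander_quandle ::
    "link \<Rightarrow> ((real ^ 4) set \<Rightarrow> laurent) set quandle_struct" where
  "total_alexander_quandle L = \<lparr>
     elems = {x \<in> alexander_module L. phi L x + 1 \<in> Lambda_units (length L)},
     qop = (\<lambda>x y. alex_add L (alex_smult L (phi L y + 1) x) (alex_smult L (- phi L x) y)),
     qinv = (\<lambda>x y. alex_smult L (Lambda_inverse (length L) (phi L y + 1))
                     (alex_add L x (alex_smult L (phi L x) y)))\<rparr>"

definition fundamental_alexander_quandle ::
    "link \<Rightarrow> ((real ^ 4) set \<Rightarrow> laurent) set quandle_struct" where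
  "fundamental_alexander_quandle L =
     generated_subquandle (total_alexander_quandle L) (gamma L ` arcs L)"

end

theory Submission
  imports Defs
begin

text \<open>Both parts compare a link with the link obtained by reversing one of its components.

  The total quandle only knows \<open>\<phi> + 1\<close> as a unit of \<open>\<Lambda>\<^sub>\<mu>\<close>, so it does not notice the substitution
  \<open>t\<^sub>j \<mapsto> t\<^sub>j\<^sup>-\<^sup>1\<close>: multiplying the generators \<open>a\<close> with \<open>\<kappa>(a) = j\<close> by \<open>- t\<^sub>j\<^sup>-\<^sup>1\<close>
  gives a semilinear isomorphism from the module of a link to that of the link with component \<open>j\<close>
  reversed, which is compatible with \<open>\<phi>\<close>. For the torus link \<open>T(2, 4)\<close> with its two orientations, the kernels of \<open>\<phi>\<close>
  are \<open>\<Lambda> / (1 + t\<^sub>1 t\<^sub>2)\<close> and \<open>\<Lambda> / (t\<^sub>1 + t\<^sub>2)\<close>. The substitution of the imaginary unit for both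
  variables kills \<open>1 + t\<^sub>1 t\<^sub>2\<close> but not \<open>t\<^sub>1 + t\<^sub>2\<close>, so the semilinear functionals on the two modules form
  spaces of dimensions 2 and 1.

  In a chain of three rings \<open>A\<close>, \<open>B\<close>, \<open>C\<close>, the middle ring has two arcs \<open>b\<close>, \<open>b'\<close> with \<open>b \<triangleright> a = b'\<close>, and
  either \<open>b' \<triangleright> c = b\<close> or, after reversal of \<open>C\<close>, \<open>b \<triangleright> c = b'\<close>. The Alexander module identifies \<open>b\<close> and
  \<open>b'\<close> anyway, so its relations are the same in both cases. In the fundamental quandles, \<open>b \<triangleright> a = b \<triangleright> c\<close>
  holds for the reversed chain, but in the other one no elements \<open>x, y, z\<close> of three different orbits satisfy
  \<open>x \<triangleright> y = x \<triangleright> z\<close>, as one sees in a quandle of integer translations.\<close>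

section \<open>Laurent polynomials\<close>

text \<open>The definitions ask for honest smooth curves on the sphere, so the obstacle is to get
  from parametrizations to a finite table of crossings and arcs. All components therefore come from
  one family of closed polygons in 3-space, lifted to the sphere: crossings are found by linear
  arithmetic on straight edges, and over or under is the sign of an explicit height. Arcs are point
  sets of the link, so reversing a component leaves them alone; only left and right at its
  overpasses are swapped. Hence the two links of each pair have the same free module, and their
  relations are compared inside one function space. Substituting one number for all variables makes
  the functionals independent of the indexing, which disposes of all reindexings at once. The common
  value t must satisfy t^2 = -1 to kill 1 + t_1 t_2, and then t_1 + t_2 = 2t is nonzero; this leaves
  the imaginary unit up to conjugation.\<close>

definition monomial_eval :: "((nat \<Rightarrow>\<^sub>0 int) \<Rightarrow> 'b::comm_ring_1) \<Rightarrow> laurent \<Rightarrow> 'b" where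
  "monomial_eval e p = (\<Sum>m\<in>Poly_Mapping.keys p. of_int (Poly_Mapping.lookup p m) * e m)"

lemma monomial_eval_add: "monomial_eval e (p + q) = monomial_eval e p + monomial_eval e q"
  unfolding monomial_eval_def
  by (rule setsum_keys_plus_distrib) (simp_all add: algebra_simps)

lemma monomial_eval_zero [simp]: "monomial_eval e 0 = 0"
  by (simp add: monomial_eval_def)

lemma monomial_eval_uminus: "monomial_eval e (- p) = - monomial_eval e p"
  using monomial_eval_add[of e p "- p"] by (simp add: eq_neg_iff_add_eq_0 add.commute)

lemma monomial_eval_diff: "monomial_eval e (p - q) = monomial_eval e p - monomial_eval e q"
  using monomial_eval_add[of e p "- q"] by (simp add: monomial_eval_uminus)

lemma monomial_eval_sum: "monomial_eval e (sum f S) = (\<Sum>x\<in>S. monomial_eval e (f x))"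
  by (induction S rule: infinite_finite_induct) (simp_all add: monomial_eval_add)

lemma monomial_eval_single: "monomial_eval e (Poly_Mapping.single m c) = of_int c * e m"
  by (cases "c = 0") (simp_all add: monomial_eval_def)

locale monomial_hom =
  fixes e :: "(nat \<Rightarrow>\<^sub>0 int) \<Rightarrow> 'b::comm_ring_1"
  assumes monomial_zero: "e 0 = 1"
    and monomial_add: "\<And>m n. e (m + n) = e m * e n"
begin

lemma eval_one: "monomial_eval e 1 = 1"
  using monomial_eval_single[of e 0 1] by (simp add: monomial_zero)

text \<open>Integer Laurent polynomials form the free abelian group on the monomials, and both sides
  are additive in \<open>p\<close> and in \<open>q\<close>. So \<open>frag_induction\<close> reduces
  first the right and then the left factor to a single monomial, where \<open>monomial_add\<close>
  applies.\<close>

lemma eval_mult: "monomial_eval e (p * q) = monomial_eval e p * monomial_eval e q"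
proof -
  have *: "monomial_eval e (Poly_Mapping.single m 1 * q) = e m * monomial_eval e q" for m q
  proof -
    have "Poly_Mapping.keys q \<subseteq> UNIV" by simp
    then show ?thesis
    proof (induction q rule: frag_induction)
      case zero
      then show ?case by simp
    next
      case (one n)
      then show ?case by (simp add: mult_single monomial_eval_single monomial_add)
    next
      case (diff a b)
      then show ?case by (simp add: monomial_eval_diff right_diff_distrib)
    qed
  qed
  have "Poly_Mapping.keys p \<subseteq> UNIV" by simp
  then show ?thesis
  proof (induction p rule: frag_induction)
    case zero
    then show ?case by simp
  next
    case (one n)
    then show ?case by (simp add: * monomial_eval_single)
  next
    case (diff a b)
    then show ?case by (simp add: monomial_eval_diff left_diff_distrib)
  qed
qed

end

lemma Lambda_zero [simp]: "0 \<in> Lambda \<mu>"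
  by (simp add: Lambda_def)

lemma Lambda_one [simp]: "1 \<in> Lambda \<mu>"
  by (simp add: Lambda_def)

lemma Lambda_uminus_iff [simp]: "- p \<in> Lambda \<mu> \<longleftrightarrow> p \<in> Lambda \<mu>"
  by (simp add: Lambda_def)

lemma Lambda_add [intro]: "p \<in> Lambda \<mu> \<Longrightarrow> q \<in> Lambda \<mu> \<Longrightarrow> p + q \<in> Lambda \<mu>"
  using keys_add[of p q] by (fastforce simp: Lambda_def)

lemma Lambda_diff [intro]: "p \<in> Lambda \<mu> \<Longrightarrow> q \<in> Lambda \<mu> \<Longrightarrow> p - q \<in> Lambda \<mu>"
  using Lambda_add[of p \<mu> "- q"] by simp

lemma Lambda_mult [intro]:
  assumes "p \<in> Lambda \<mu>" "q \<in> Lambda \<mu>"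
  shows "p * q \<in> Lambda \<mu>"
  unfolding Lambda_def
proof (standard, standard)
  fix m assume "m \<in> Poly_Mapping.keys (p * q)"
  then obtain a b where "a \<in> Poly_Mapping.keys p" "b \<in> Poly_Mapping.keys q" "m = a + b"
    using keys_mult[of p q] by auto
  then show "Poly_Mapping.keys m \<subseteq> {..<\<mu>}"
    using assms keys_add[of a b] by (fastforce simp: Lambda_def)
qed

lemma Lambda_sum [intro]: "(\<And>x. x \<in> S \<Longrightarrow> f x \<in> Lambda \<mu>) \<Longrightarrow> sum f S \<in> Lambda \<mu>"
  by (induction S rule: infinite_finite_induct) auto

definition tinv :: "nat \<Rightarrow> laurent" where
  "tinv i = Poly_Mapping.single (Poly_Mapping.single i (- 1)) 1"

lemma tvar_tinv [simp]: "tvar i * tinv i = 1" "tinv i * tvar i = 1"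
  by (simp_all add: tvar_def tinv_def mult_single flip: single_add)

lemma tvar_tinv_assoc [simp]: "tvar i * (tinv i * p) = p" "tinv i * (tvar i * p) = p"
  by (simp_all flip: mult.assoc)

lemma Lambda_tvar [simp]: "i < \<mu> \<Longrightarrow> tvar i \<in> Lambda \<mu>"
  by (simp add: tvar_def Lambda_def)

lemma Lambda_tinv [simp]: "i < \<mu> \<Longrightarrow> tinv i \<in> Lambda \<mu>"
  by (simp add: tinv_def Lambda_def)

lemma Lambda_inverse_eqI:
  assumes "q \<in> Lambda \<mu>" "p * q = 1"
  shows "Lambda_inverse \<mu> p = q"
  unfolding Lambda_inverse_def
proof (rule the_equality)
  fix r assume "r \<in> Lambda \<mu> \<and> p * r = 1"
  then have "r = (p * q) * r" "(p * r) * q = q" using assms(2) by simp_all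
  then show "r = q" by (metis mult.assoc mult.commute)
qed (use assms in simp)

lemma Lambda_inverse:
  assumes "p \<in> Lambda_units \<mu>"
  shows "Lambda_inverse \<mu> p \<in> Lambda \<mu>" "p * Lambda_inverse \<mu> p = 1"
  using assms Lambda_inverse_eqI by (auto simp: Lambda_units_def)

subsection \<open>The involution inverting one variable\<close>

lift_definition negate_at :: "nat \<Rightarrow> (nat \<Rightarrow>\<^sub>0 int) \<Rightarrow> (nat \<Rightarrow>\<^sub>0 int)" is
  "\<lambda>j m i. if i = j then - m i else m i"
  by (erule finite_subset[rotated]) auto

lemma negate_at_zero [simp]: "negate_at j 0 = 0"
  by transfer auto

lemma negate_at_add: "negate_at j (m + n) = negate_at j m + negate_at j n"
  by transfer auto

lemma negate_at_negate_at [simp]: "negate_at j (negate_at j m) = m"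
  by transfer auto

lemma keys_negate_at [simp]: "Poly_Mapping.keys (negate_at j m) = Poly_Mapping.keys m"
  by transfer auto

lemma negate_at_single:
  "negate_at j (Poly_Mapping.single i k) = Poly_Mapping.single i (if i = j then - k else k)"
  by transfer (auto simp: when_def)

definition invert_var :: "nat \<Rightarrow> laurent \<Rightarrow> laurent" where
  "invert_var j = monomial_eval (\<lambda>m. Poly_Mapping.single (negate_at j m) 1)"

interpretation invert_var: monomial_hom "\<lambda>m. Poly_Mapping.single (negate_at j m) 1 :: laurent"
  by unfold_locales (simp_all add: negate_at_add mult_single)

lemmas invert_var_hom = monomial_eval_add monomial_eval_diff monomial_eval_uminus monomial_eval_sum
  invert_var.eval_one invert_var.eval_mult

lemma invert_var_simps [simp]:
  "invert_var j 0 = 0" "invert_var j 1 = 1"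
  "invert_var j (p + q) = invert_var j p + invert_var j q"
  "invert_var j (p - q) = invert_var j p - invert_var j q"
  "invert_var j (- p) = - invert_var j p"
  "invert_var j (p * q) = invert_var j p * invert_var j q"
  "invert_var j (sum f S) = (\<Sum>x\<in>S. invert_var j (f x))"
  unfolding invert_var_def by (simp_all add: invert_var_hom)

lemma invert_var_single:
  "invert_var j (Poly_Mapping.single m c) = Poly_Mapping.single (negate_at j m) c"
  by (simp add: invert_var_def monomial_eval_single mult_single flip: single_of_int)

lemma invert_var_tvar [simp]: "invert_var j (tvar i) = (if i = j then tinv i else tvar i)"
  and invert_var_tinv [simp]: "invert_var j (tinv i) = (if i = j then tvar i else tinv i)"
  by (simp_all add: tvar_def tinv_def invert_var_single negate_at_single)

lemma invert_var_invert_var [simp]: "invert_var j (invert_var j p) = p"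
proof -
  have "Poly_Mapping.keys p \<subseteq> UNIV" by simp
  then show ?thesis
    by (induction p rule: frag_induction) (simp_all add: invert_var_single)
qed

text \<open>Negating an exponent keeps the support of every monomial, so no new variable can
  enter.\<close>

lemma invert_var_Lambda: 
  assumes "p \<in> Lambda \<mu>" shows "invert_var j p \<in> Lambda \<mu>"
proof -
  have "invert_var j p = (\<Sum>m\<in>Poly_Mapping.keys p.
     Poly_Mapping.single (negate_at j m) (Poly_Mapping.lookup p m))"
    by (simp add: invert_var_def monomial_eval_def mult_single flip: single_of_int)
  also have "\<dots> \<in> Lambda \<mu>"
    using assms by (intro Lambda_sum) (auto simp: Lambda_def)
  finally show ?thesis .
qed

lemma invert_var_Lambda_iff [simp]: "invert_var j p \<in> Lambda \<mu> \<longleftrightarrow> p \<in> Lambda \<mu>"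
  using invert_var_Lambda[of p \<mu> j] invert_var_Lambda[of "invert_var j p" \<mu> j] by auto

lemma invert_var_Lambda_units:
  assumes "p \<in> Lambda_units \<mu>" shows "invert_var j p \<in> Lambda_units \<mu>"
proof -
  obtain q where "q \<in> Lambda \<mu>" "p * q = 1" "p \<in> Lambda \<mu>"
    using assms by (auto simp: Lambda_units_def)
  then have "invert_var j p * invert_var j q = 1" "invert_var j q \<in> Lambda \<mu>"
    by (simp_all flip: invert_var_simps(6))
  then show ?thesis using \<open>p \<in> Lambda \<mu>\<close> by (auto simp: Lambda_units_def)
qed

lemma invert_var_Lambda_units_iff:
  "invert_var j p \<in> Lambda_units \<mu> \<longleftrightarrow> p \<in> Lambda_units \<mu>"
  using invert_var_Lambda_units[of p \<mu> j] invert_var_Lambda_units[of "invert_var j p" \<mu> j] by auto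

lemma invert_var_Lambda_inverse:
  assumes "p \<in> Lambda_units \<mu>"
  shows "Lambda_inverse \<mu> (invert_var j p) = invert_var j (Lambda_inverse \<mu> p)"
proof (rule Lambda_inverse_eqI)
  show "invert_var j p * invert_var j (Lambda_inverse \<mu> p) = 1"
    using Lambda_inverse(2)[OF assms] by (simp flip: invert_var_simps(6))
qed (use Lambda_inverse(1)[OF assms] in simp)

section \<open>Alexander modules of diagrams\<close>

lemma alex_class_image: "alex_class L v = (\<lambda>n a. v a + n a) ` rho_image L"
  by (auto simp: alex_class_def)

text \<open>What the algebra has to know of a diagram. Modules, functionals and reversal are treated
  from these facts alone; geometry enters only when concrete links are shown to satisfy
  them.\<close>

locale link_diagram =
  fixes L :: link
  assumes finite_crossings: "finite (crossings L)"
    and finite_arcs: "finite (arcs L)"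
    and over_arc_in: "c \<in> crossings L \<Longrightarrow> over_arc L c \<in> arcs L"
    and right_arc_in: "c \<in> crossings L \<Longrightarrow> right_arc L c \<in> arcs L"
    and left_arc_in: "c \<in> crossings L \<Longrightarrow> left_arc L c \<in> arcs L"
    and arc_index_less: "a \<in> arcs L \<Longrightarrow> arc_index L a < length L"
    and arc_index_right_left: "c \<in> crossings L \<Longrightarrow> arc_index L (right_arc L c) = arc_index L (left_arc L c)"
begin

lemma rho_image_zero: "(\<lambda>a. 0) \<in> rho_image L"
  by (auto simp: rho_image_def rho_def free_module_def intro!: image_eqI[of _ _ "\<lambda>c. 0"])

lemma rho_image_add:
  assumes "m \<in> rho_image L" "n \<in> rho_image L"
  shows "(\<lambda>a. m a + n a) \<in> rho_image L"
proof -
  obtain u w where "u \<in> free_module (length L) (crossings L)" "m = rho L u"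
    "w \<in> free_module (length L) (crossings L)" "n = rho L w"
    using assms by (auto simp: rho_image_def)
  then show ?thesis
    unfolding rho_image_def
    by (intro image_eqI[of _ _ "\<lambda>c. u c + w c"])
       (auto simp: rho_def free_module_def distrib_right sum.distrib)
qed

lemma rho_image_smult:
  assumes "n \<in> rho_image L" "r \<in> Lambda (length L)"
  shows "(\<lambda>a. r * n a) \<in> rho_image L"
proof -
  obtain u where "u \<in> free_module (length L) (crossings L)" "n = rho L u"
    using assms by (auto simp: rho_image_def)
  then show ?thesis
    unfolding rho_image_def using assms(2)
    by (intro image_eqI[of _ _ "\<lambda>c. r * u c"])
       (auto simp: rho_def free_module_def sum_distrib_left mult.assoc)
qed

lemma rho_image_uminus: "n \<in> rho_image L \<Longrightarrow> (\<lambda>a. - n a) \<in> rho_image L"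
  using rho_image_smult[of n "- 1"] by simp

lemma rho_image_diff:
  "m \<in> rho_image L \<Longrightarrow> n \<in> rho_image L \<Longrightarrow> (\<lambda>a. m a - n a) \<in> rho_image L"
  using rho_image_add[OF _ rho_image_uminus, of m n] by simp

lemma rho_crossing_in_rho_image:
  assumes "c \<in> crossings L" shows "rho_crossing L c \<in> rho_image L"
proof -
  have "rho_crossing L c = rho L (\<lambda>d. if d = c then 1 else 0)"
    using assms finite_crossings by (auto simp: rho_def if_distrib[of "\<lambda>x. x * _"] cong: if_cong)
  then show ?thesis
    unfolding rho_image_def using assms by (auto simp: free_module_def)
qed

text \<open>Spares later arguments the coefficient families: a closure property of the relations is
  checked on zero and on adding a multiple of a single crossing relation.\<close>

lemma rho_image_induct [consumes 1, case_names zero add]: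
  assumes "n \<in> rho_image L"
    and "P (\<lambda>a. 0)"
    and "\<And>c r m. c \<in> crossings L \<Longrightarrow> r \<in> Lambda (length L) \<Longrightarrow> P m \<Longrightarrow>
           P (\<lambda>a. r * rho_crossing L c a + m a)"
  shows "P n"
proof -
  obtain u where u: "u \<in> free_module (length L) (crossings L)" "n = rho L u"
    using assms(1) by (auto simp: rho_image_def)
  have "P (\<lambda>b. \<Sum>c\<in>S. u c * rho_crossing L c b)" if "finite S" "S \<subseteq> crossings L" for S
    using that
  proof (induction S rule: finite_induct)
    case empty
    then show ?case using assms(2) by simp
  next
    case (insert c S)
    then show ?case using assms(3)[of c "u c"] u(1) by (auto simp: free_module_def)
  qed
  then show ?thesis
    using finite_crossings u(2) by (simp add: rho_def)
qed

lemma rho_crossing_in_free_module: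
  assumes "c \<in> crossings L" shows "rho_crossing L c \<in> free_module (length L) (arcs L)"
proof -
  have "basis_vec a b \<in> Lambda (length L)" for a b :: "(real ^ 4) set"
    by (simp add: basis_vec_def)
  moreover have "basis_vec a b = 0" if "a \<in> arcs L" "b \<notin> arcs L" for a b
    using that by (auto simp: basis_vec_def)
  ultimately show ?thesis
    using over_arc_in[OF assms] right_arc_in[OF assms] left_arc_in[OF assms]
    unfolding free_module_def rho_crossing_def mem_Collect_eq
    by (auto intro!: Lambda_diff Lambda_add Lambda_mult simp: arc_index_less)
qed

lemma alex_class_self: "v \<in> alex_class L v"
  using rho_image_zero by (force simp: alex_class_def)

lemma alex_class_iff: "w \<in> alex_class L v \<longleftrightarrow> (\<lambda>a. w a - v a) \<in> rho_image L"
proof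
  assume "(\<lambda>a. w a - v a) \<in> rho_image L"
  then show "w \<in> alex_class L v"
    unfolding alex_class_image by (rule rev_image_eqI) simp
qed (auto simp: alex_class_def)

lemma alex_class_eqI:
  assumes "(\<lambda>a. v a - w a) \<in> rho_image L" shows "alex_class L v = alex_class L w"
proof (intro set_eqI)
  fix x
  show "x \<in> alex_class L v \<longleftrightarrow> x \<in> alex_class L w"
    unfolding alex_class_iff
    using rho_image_add[OF assms, of "\<lambda>a. x a - v a"] rho_image_diff[OF _ assms, of "\<lambda>a. x a - w a"]
    by auto
qed

text \<open>Changing the representatives changes their sum by a sum of two relations, so all classes
  in the union that defines \<open>alex_add\<close> coincide.\<close>

lemma alex_add_class: "alex_add L (alex_class L v) (alex_class L w) = alex_class L (\<lambda>a. v a + w a)"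
proof -
  have "alex_class L (\<lambda>a. v' a + w' a) = alex_class L (\<lambda>a. v a + w a)"
    if "v' \<in> alex_class L v" "w' \<in> alex_class L w" for v' w'
    using rho_image_add[OF that[unfolded alex_class_iff]]
    by (intro alex_class_eqI) (simp add: algebra_simps)
  then show ?thesis
    unfolding alex_add_def using alex_class_self[of v] alex_class_self[of w] by blast
qed

lemma alex_smult_class:
  assumes "r \<in> Lambda (length L)"
  shows "alex_smult L r (alex_class L v) = alex_class L (\<lambda>a. r * v a)"
proof -
  have "alex_class L (\<lambda>a. r * v' a) = alex_class L (\<lambda>a. r * v a)"
    if "v' \<in> alex_class L v" for v'
    using rho_image_smult[OF that[unfolded alex_class_iff] assms]
    by (intro alex_class_eqI) (simp add: algebra_simps)
  then show ?thesis
    unfolding alex_smult_def using alex_class_self[of v] by blast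
qed

lemma alex_class_in_module:
  "v \<in> free_module (length L) (arcs L) \<Longrightarrow> alex_class L v \<in> alexander_module L"
  by (simp add: alexander_module_def)

lemma sum_basis_vec: "a \<in> arcs L \<Longrightarrow> (\<Sum>b\<in>arcs L. basis_vec a b * f b) = f a"
  by (simp add: basis_vec_def if_distrib[of "\<lambda>x. x * _"] finite_arcs cong: if_cong)

lemma sum_rho_crossing:
  assumes "c \<in> crossings L"
  shows "(\<Sum>a\<in>arcs L. rho_crossing L c a * w a) =
     (1 - tvar (arc_index L (right_arc L c))) * w (over_arc L c) +
     tvar (arc_index L (over_arc L c)) * w (right_arc L c) - w (left_arc L c)"
proof -
  have "(\<Sum>a\<in>arcs L. rho_crossing L c a * w a) =
     (1 - tvar (arc_index L (right_arc L c))) * (\<Sum>a\<in>arcs L. basis_vec (over_arc L c) a * w a) +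
     tvar (arc_index L (over_arc L c)) * (\<Sum>a\<in>arcs L. basis_vec (right_arc L c) a * w a) -
     (\<Sum>a\<in>arcs L. basis_vec (left_arc L c) a * w a)"
    unfolding rho_crossing_def
    by (simp only: left_diff_distrib distrib_right sum.distrib sum_subtractf sum_distrib_left mult.assoc)
  then show ?thesis
    using assms by (simp only: sum_basis_vec over_arc_in right_arc_in left_arc_in)
qed

text \<open>With t_o for the overpass and t_u for the common variable of the two underpassing arcs,
  a crossing relation has the value (1 - t_u)(t_o - 1) + t_o (t_u - 1) - (t_u - 1) = 0.\<close>

lemma phi_rho_image:
  assumes "n \<in> rho_image L"
  shows "(\<Sum>a\<in>arcs L. n a * (tvar (arc_index L a) - 1)) = 0"
  using assms
proof (induction rule: rho_image_induct)
  case (add c r m)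
  have "(\<Sum>a\<in>arcs L. rho_crossing L c a * (tvar (arc_index L a) - 1)) = 0"
    by (subst sum_rho_crossing[OF add(1)]) (simp add: arc_index_right_left[OF add(1)] algebra_simps)
  then show ?case
    using add(3) by (simp add: distrib_right sum.distrib mult.assoc flip: sum_distrib_left)
qed simp

lemma phi_class: "phi L (alex_class L v) = (\<Sum>a\<in>arcs L. v a * (tvar (arc_index L a) - 1))"
proof -
  have "(\<lambda>v. \<Sum>a\<in>arcs L. v a * (tvar (arc_index L a) - 1)) ` alex_class L v =
     {\<Sum>a\<in>arcs L. v a * (tvar (arc_index L a) - 1)}" (is "?f ` _ = {?r}")
  proof
    show "?f ` alex_class L v \<subseteq> {?r}"
      by (auto simp: alex_class_def distrib_right sum.distrib phi_rho_image)
  qed (use alex_class_self in auto)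
  then show ?thesis by (simp add: phi_def)
qed

end

text \<open>Arcs, indices and the submodule of relations determine the quandle literally. For the
  chains this turns the isomorphism of part (i) into an equality.\<close>

lemma fundamental_alexander_quandle_cong:
  assumes "length L = length L'" "arcs L = arcs L'" "arc_index L = arc_index L'"
    "rho_image L = rho_image L'"
  shows "fundamental_alexander_quandle L = fundamental_alexander_quandle L'"
proof -
  have "alex_class L = alex_class L'"
    by (auto simp: alex_class_def fun_eq_iff assms)
  then have "alexander_module L = alexander_module L'" "phi L = phi L'" "gamma L = gamma L'"
    "alex_add L = alex_add L'" "alex_smult L = alex_smult L'"
    by (auto simp: alexander_module_def phi_def gamma_def alex_add_def alex_smult_def fun_eq_iff assms)
  then show ?thesis
    by (simp add: fundamental_alexander_quandle_def total_alexander_quandle_def assms)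
qed

lemma rho_image_subset:
  assumes "link_diagram L" "link_diagram L'" "length L = length L'"
    and "\<And>c. c \<in> crossings L \<Longrightarrow> rho_crossing L c \<in> rho_image L'"
  shows "rho_image L \<subseteq> rho_image L'"
proof
  interpret L: link_diagram L by fact
  interpret L': link_diagram L' by fact
  fix n assume "n \<in> rho_image L"
  then show "n \<in> rho_image L'"
  proof (induction rule: L.rho_image_induct)
    case (add c r m)
    then show ?case
      using assms by (intro L'.rho_image_add L'.rho_image_smult) simp_all
  qed (rule L'.rho_image_zero)
qed

subsection \<open>Reversing the orientation of one component\<close>

text \<open>The factor u = - t_j^-1 satisfies t_j^-1 - 1 = u (t_j - 1), as compatibility with
  \<open>phi\<close> demands. Substituting t_j^-1 for t_j in u gives its inverse, which makes the
  map an involution.\<close>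

definition reversal_map :: "link \<Rightarrow> nat \<Rightarrow> ((real ^ 4) set \<Rightarrow> laurent) \<Rightarrow> (real ^ 4) set \<Rightarrow> laurent" where
  "reversal_map L j v = (\<lambda>a. invert_var j (v a) * (if arc_index L a = j then - tinv j else 1))"

lemma reversal_map_reversal_map [simp]: "reversal_map L j (reversal_map L j v) = v"
  by (auto simp: reversal_map_def fun_eq_iff mult.assoc)

lemma reversal_map_image_eqI:
  assumes "\<And>v. v \<in> A \<Longrightarrow> reversal_map L j v \<in> B" "\<And>v. v \<in> B \<Longrightarrow> reversal_map L j v \<in> A"
  shows "reversal_map L j ` A = B"
proof
  show "B \<subseteq> reversal_map L j ` A"
  proof
    fix v assume "v \<in> B"
    with assms(2) show "v \<in> reversal_map L j ` A"
      by (intro image_eqI[of _ _ "reversal_map L j v"]) simp_all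
  qed
qed (use assms(1) in blast)

text \<open>Since \<open>reversal_map L j\<close> acts on the common function space as its own
  inverse, it is enough that it carries the crossing relations of either link into the relations of
  the other; no inverse has to be constructed.\<close>

locale reversed_pair = L: link_diagram L + L': link_diagram L' for L L' +
  fixes j :: nat
  assumes same_length: "length L = length L'"
    and same_arcs: "arcs L = arcs L'"
    and same_index: "arc_index L = arc_index L'"
    and index_less: "j < length L"
    and crossing_image: "c \<in> crossings L \<Longrightarrow> reversal_map L j (rho_crossing L c) \<in> rho_image L'"
    and crossing_image': "c \<in> crossings L' \<Longrightarrow> reversal_map L j (rho_crossing L' c) \<in> rho_image L"
begin

abbreviation F where "F \<equiv> reversal_map L j"

lemma F_add: "F (\<lambda>a. v a + w a) = (\<lambda>a. F v a + F w a)"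
  by (auto simp: reversal_map_def distrib_right)

lemma F_smult: "F (\<lambda>a. r * v a) = (\<lambda>a. invert_var j r * F v a)"
  by (auto simp: reversal_map_def mult.assoc)

lemma F_zero: "F (\<lambda>a. 0) = (\<lambda>a. 0)"
  by (simp add: reversal_map_def)

lemma F_rho_image: "F ` rho_image L = rho_image L'"
proof (rule reversal_map_image_eqI)
  show "F n \<in> rho_image L'" if "n \<in> rho_image L" for n
    using that
  proof (induction rule: L.rho_image_induct)
    case (add c r m)
    then show ?case
      unfolding F_add F_smult using same_length
      by (intro L'.rho_image_add L'.rho_image_smult crossing_image) simp_all
  qed (simp add: F_zero L'.rho_image_zero)
  show "F n \<in> rho_image L" if "n \<in> rho_image L'" for n
    using that
  proof (induction rule: L'.rho_image_induct)
    case (add c r m)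
    then show ?case
      unfolding F_add F_smult using same_length
      by (intro L.rho_image_add L.rho_image_smult crossing_image') simp_all
  qed (simp add: F_zero L.rho_image_zero)
qed

lemma F_class: "F ` alex_class L v = alex_class L' (F v)"
  unfolding alex_class_image F_rho_image[symmetric] image_image F_add ..

lemma F_free_module: "F ` free_module (length L) (arcs L) = free_module (length L') (arcs L')"
proof -
  have "F v \<in> free_module (length L) (arcs L)" if "v \<in> free_module (length L) (arcs L)" for v
    using that index_less by (auto simp: free_module_def reversal_map_def intro!: Lambda_mult)
  then show ?thesis
    by (intro reversal_map_image_eqI) (simp_all flip: same_length same_arcs)
qed

lemma F_module: "(`) F ` alexander_module L = alexander_module L'"
proof -
  have "(`) F ` alexander_module L = alex_class L' ` F ` free_module (length L) (arcs L)"
    unfolding alexander_module_def image_image F_class ..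
  then show ?thesis
    unfolding alexander_module_def F_free_module .
qed

lemma F_alex_add: "F ` alex_add L X Y = alex_add L' (F ` X) (F ` Y)"
  by (simp add: alex_add_def image_UN F_class F_add)

lemma F_alex_smult: "F ` alex_smult L r X = alex_smult L' (invert_var j r) (F ` X)"
  by (simp add: alex_smult_def image_UN F_class F_smult)

lemma F_phi:
  assumes "X \<in> alexander_module L"
  shows "phi L' (F ` X) = invert_var j (phi L X)"
proof -
  obtain v where "X = alex_class L v" using assms by (auto simp: alexander_module_def)
  moreover have "reversal_map L j v a * (tvar (arc_index L a) - 1) =
      invert_var j (v a * (tvar (arc_index L a) - 1))" for a
    by (auto simp: reversal_map_def algebra_simps)
  ultimately show ?thesis
    by (simp add: L.phi_class L'.phi_class F_class flip: same_arcs same_index)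
qed

text \<open>The map changes \<open>phi + 1\<close> by a ring automorphism, which preserves units and
  commutes with taking their inverses. Both quandle operations are built from the module operations,
  values of \<open>phi\<close> and such inverses.\<close>

lemma total_alexander_quandle_isomorphic:
  "quandle_isomorphic (total_alexander_quandle L) (total_alexander_quandle L')"
proof -
  let ?U = "{x \<in> alexander_module L. phi L x + 1 \<in> Lambda_units (length L)}"
  let ?U' = "{x \<in> alexander_module L'. phi L' x + 1 \<in> Lambda_units (length L')}"
  have shift: "phi L' (F ` x) + 1 = invert_var j (phi L x + 1)" if "x \<in> alexander_module L" for x
    using F_phi[OF that] by simp
  have "(`) F ` ?U = {x \<in> (`) F ` alexander_module L. phi L' x + 1 \<in> Lambda_units (length L)}"
    using shift invert_var_Lambda_units_iff by (auto simp del: invert_var_simps)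
  then have "(`) F ` ?U = ?U'"
    unfolding F_module same_length .
  moreover have "inj ((`) F)"
    by (rule inj_on_inverseI[of _ "(`) F"]) (simp add: image_image)
  ultimately have bij: "bij_betw ((`) F) ?U ?U'"
    unfolding bij_betw_def by (blast intro: inj_on_subset)
  have op: "F ` alex_add L (alex_smult L (phi L y + 1) x) (alex_smult L (- phi L x) y) =
      alex_add L' (alex_smult L' (phi L' (F ` y) + 1) (F ` x)) (alex_smult L' (- phi L' (F ` x)) (F ` y))"
    if "x \<in> ?U" "y \<in> ?U" for x y
    using that by (simp add: F_alex_add F_alex_smult F_phi)
  have inv: "F ` alex_smult L (Lambda_inverse (length L) (phi L y + 1)) (alex_add L x (alex_smult L (phi L x) y)) =
      alex_smult L' (Lambda_inverse (length L') (phi L' (F ` y) + 1))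
        (alex_add L' (F ` x) (alex_smult L' (phi L' (F ` x)) (F ` y)))"
    if x: "x \<in> ?U" and y: "y \<in> ?U" for x y
  proof -
    have "Lambda_inverse (length L') (phi L' (F ` y) + 1) = invert_var j (Lambda_inverse (length L) (phi L y + 1))"
      using y by (subst shift) (simp_all add: invert_var_Lambda_inverse flip: same_length del: invert_var_simps)
    then show ?thesis
      using x by (simp only: F_alex_add F_alex_smult F_phi mem_Collect_eq)
  qed
  show ?thesis
    unfolding quandle_isomorphic_def total_alexander_quandle_def quandle_struct.select_convs
    by (intro exI[of _ "(`) F"] conjI ballI bij) (simp_all only: op inv)
qed

end

subsection \<open>Specializing every variable to the imaginary unit\<close>

text \<open>The exponent that a monomial acquires when all variables are set equal.\<close>

definition degree_sum :: "(nat \<Rightarrow>\<^sub>0 int) \<Rightarrow> int" where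
  "degree_sum m = (\<Sum>k\<in>Poly_Mapping.keys m. Poly_Mapping.lookup m k)"

lemma degree_sum_add: "degree_sum (m + n) = degree_sum m + degree_sum n"
  unfolding degree_sum_def by (rule setsum_keys_plus_distrib) simp_all

interpretation at_ii: monomial_hom "\<lambda>m. \<i> powi degree_sum m"
  by unfold_locales (simp_all add: degree_sum_add power_int_add, simp add: degree_sum_def)

definition eval_ii :: "laurent \<Rightarrow> complex" where
  "eval_ii = monomial_eval (\<lambda>m. \<i> powi degree_sum m)"

lemma eval_ii_simps [simp]:
  "eval_ii 0 = 0" "eval_ii 1 = 1"
  "eval_ii (p + q) = eval_ii p + eval_ii q"
  "eval_ii (p - q) = eval_ii p - eval_ii q"
  "eval_ii (- p) = - eval_ii p"
  "eval_ii (p * q) = eval_ii p * eval_ii q"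
  unfolding eval_ii_def
  by (simp_all add: monomial_eval_add monomial_eval_diff monomial_eval_uminus at_ii.eval_one at_ii.eval_mult)

lemma eval_ii_tvar [simp]: "eval_ii (tvar j) = \<i>"
  by (simp add: eval_ii_def tvar_def monomial_eval_single degree_sum_def)

text \<open>The crossing relations with every variable set to the imaginary unit. Such weights are
  the complex functionals on the Alexander module that are semilinear along \<open>eval_ii\<close>;
  the component indices have dropped out.\<close>

definition arc_weights :: "link \<Rightarrow> ((real ^ 4) set \<Rightarrow> complex) \<Rightarrow> bool" where
  "arc_weights L w \<longleftrightarrow> (\<forall>c\<in>crossings L.
     w (left_arc L c) = (1 - \<i>) * w (over_arc L c) + \<i> * w (right_arc L c))"

definition weigh :: "link \<Rightarrow> ((real ^ 4) set \<Rightarrow> complex) \<Rightarrow> ((real ^ 4) set \<Rightarrow> laurent) \<Rightarrow> complex" where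
  "weigh L w v = (\<Sum>a\<in>arcs L. eval_ii (v a) * w a)"

lemma weigh_add: "weigh L w (\<lambda>a. u a + v a) = weigh L w u + weigh L w v"
  by (simp add: weigh_def distrib_right sum.distrib)

lemma weigh_smult: "weigh L w (\<lambda>a. r * v a) = eval_ii r * weigh L w v"
  by (simp add: weigh_def sum_distrib_left mult.assoc)

text \<open>The choice of the representative is immaterial once the weights satisfy the crossing
  relations.\<close>

definition weigh_class :: "link \<Rightarrow> ((real ^ 4) set \<Rightarrow> complex) \<Rightarrow> ((real ^ 4) set \<Rightarrow> laurent) set \<Rightarrow> complex" where
  "weigh_class L w X = weigh L w (SOME v. v \<in> X)"

context link_diagram
begin

lemma weigh_basis_vec: "a \<in> arcs L \<Longrightarrow> weigh L w (basis_vec a) = w a"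
  by (simp add: weigh_def basis_vec_def if_distrib[of eval_ii] if_distrib[of "\<lambda>x. x * _"]
      finite_arcs cong: if_cong)

lemma weigh_rho_crossing:
  assumes "c \<in> crossings L"
  shows "weigh L w (rho_crossing L c) =
    (1 - \<i>) * w (over_arc L c) + \<i> * w (right_arc L c) - w (left_arc L c)"
proof -
  have eq: "rho_crossing L c = (\<lambda>b. (1 - tvar (arc_index L (right_arc L c))) * basis_vec (over_arc L c) b +
     (tvar (arc_index L (over_arc L c)) * basis_vec (right_arc L c) b + (- 1) * basis_vec (left_arc L c) b))"
    by (simp add: rho_crossing_def fun_eq_iff)
  show ?thesis
    unfolding eq weigh_add weigh_smult
    using over_arc_in[OF assms] right_arc_in[OF assms] left_arc_in[OF assms]
    by (simp add: weigh_basis_vec)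
qed

lemma weigh_class_class:
  assumes "arc_weights L w"
  shows "weigh_class L w (alex_class L v) = weigh L w v"
proof -
  have vanish: "weigh L w n = 0" if "n \<in> rho_image L" for n
    using that
  proof (induction rule: rho_image_induct)
    case (add c r m)
    then show ?case
      using assms by (simp add: weigh_add weigh_smult weigh_rho_crossing arc_weights_def)
  qed (simp add: weigh_def)
  define u where "u = (SOME u. u \<in> alex_class L v)"
  have "u \<in> alex_class L v"
    unfolding u_def by (rule someI[of _ v]) (rule alex_class_self)
  then have "weigh L w (\<lambda>a. u a + (- 1) * v a) = 0"
    by (simp add: alex_class_iff vanish)
  then show ?thesis
    unfolding weigh_add weigh_smult weigh_class_def u_def by simp
qed

lemma basis_vec_in_free_module:
  "a \<in> arcs L \<Longrightarrow> basis_vec a \<in> free_module (length L) (arcs L)"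
  by (auto simp: free_module_def basis_vec_def)

text \<open>Additivity and semilinearity are available on the free module only, so \<open>v\<close>
  is built up from its truncations to growing sets of arcs, which stay in that module.\<close>

lemma functional_eq_weigh:
  assumes add: "\<And>u v. u \<in> free_module (length L) (arcs L) \<Longrightarrow> v \<in> free_module (length L) (arcs L) \<Longrightarrow>
      g (\<lambda>a. u a + v a) = g u + g v"
    and smult: "\<And>r v. r \<in> Lambda (length L) \<Longrightarrow> v \<in> free_module (length L) (arcs L) \<Longrightarrow>
      g (\<lambda>a. r * v a) = eval_ii r * g v"
    and v: "v \<in> free_module (length L) (arcs L)"
  shows "g v = weigh L (\<lambda>a. g (basis_vec a)) v"
proof -
  have "g (\<lambda>a. if a \<in> S then v a else 0) = (\<Sum>a\<in>S. eval_ii (v a) * g (basis_vec a))"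
    if "finite S" "S \<subseteq> arcs L" for S
    using that
  proof (induction S rule: finite_induct)
    case empty
    have "g (\<lambda>a. 0 * v a) = 0"
      using smult[of 0 v] v by simp
    then show ?case by simp
  next
    case (insert x S)
    let ?vS = "\<lambda>a. if a \<in> S then v a else 0"
    have vS: "?vS \<in> free_module (length L) (arcs L)"
      using v by (auto simp: free_module_def)
    have vx: "v x \<in> Lambda (length L)"
      using v insert(4) by (auto simp: free_module_def)
    have x: "basis_vec x \<in> free_module (length L) (arcs L)"
      using insert(4) by (simp add: basis_vec_in_free_module)
    then have vxx: "(\<lambda>a. v x * basis_vec x a) \<in> free_module (length L) (arcs L)"
      using vx by (auto simp: free_module_def)
    have "(\<lambda>a. if a \<in> insert x S then v a else 0) = (\<lambda>a. v x * basis_vec x a + ?vS a)"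
      using insert(2) by (auto simp: basis_vec_def)
    then show ?case
      using add[OF vxx vS] smult[OF vx x] insert by simp
  qed
  from this[of "arcs L"] have "g (\<lambda>a. if a \<in> arcs L then v a else 0) = weigh L (\<lambda>a. g (basis_vec a)) v"
    by (simp add: finite_arcs weigh_def)
  moreover have "(\<lambda>a. if a \<in> arcs L then v a else 0) = v"
    using v by (auto simp: free_module_def)
  ultimately show ?thesis by simp
qed

lemma alex_class_rho_crossing:
  "c \<in> crossings L \<Longrightarrow> alex_class L (rho_crossing L c) = alex_class L (\<lambda>a. 0)"
  by (intro alex_class_eqI) (simp add: rho_crossing_in_rho_image)

end

text \<open>Under an equivalence the functionals of \<open>w1\<close> and \<open>w2\<close> would
  pull back to multiples A and B of the sum of all coefficients, the only kind that constant weights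
  allow. At the preimage of the class of \<open>p\<close> these take the values 1 and 0, so the sum
  is nonzero there and B = 0, against the value 1 of the second at \<open>s\<close>.\<close>

lemma not_link_sequences_equivalent:
  assumes "link_diagram L" "link_diagram L'"
    and const: "\<And>w. arc_weights L w \<Longrightarrow> \<exists>A. \<forall>a\<in>arcs L. w a = A"
    and weights: "arc_weights L' w1" "arc_weights L' w2" "p \<in> arcs L'" "s \<in> arcs L'"
      "w1 p = 1" "w1 s = 0" "w2 p = 0" "w2 s = 1"
  shows "\<not> link_sequences_equivalent L L'"
proof
  interpret L: link_diagram L by fact
  interpret L': link_diagram L' by fact
  let ?M = "free_module (length L) (arcs L)"
  assume "link_sequences_equivalent L L'"
  then have len: "length L = length L'"
    by (simp add: link_sequences_equivalent_def)
  obtain f where bij: "bij_betw f (alexander_module L) (alexander_module L')"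
    and f_add: "\<forall>x\<in>alexander_module L. \<forall>y\<in>alexander_module L. f (alex_add L x y) = alex_add L' (f x) (f y)"
    and f_smult: "\<forall>r\<in>Lambda (length L). \<forall>x\<in>alexander_module L. f (alex_smult L r x) = alex_smult L' r (f x)"
    using \<open>link_sequences_equivalent L L'\<close>
    by (auto simp only: link_sequences_equivalent_def)
  have f_class: "\<exists>u\<in>free_module (length L') (arcs L'). f (alex_class L v) = alex_class L' u"
    if "v \<in> ?M" for v
    using bij_betw_apply[OF bij L.alex_class_in_module[OF that]] by (auto simp: alexander_module_def)
  \<comment> \<open>The pullback along \<open>f\<close>, regarded on the free module, kills the
    crossing relations of \<open>L\<close>. Its values on the basis vectors are therefore arc
    weights of \<open>L\<close>, which are constant.\<close>
  have pull: "\<exists>A. \<forall>v\<in>?M. weigh_class L' w (f (alex_class L v)) = A * (\<Sum>a\<in>arcs L. eval_ii (v a))"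
    if w: "arc_weights L' w" for w
  proof -
    define g where "g v = weigh_class L' w (f (alex_class L v))" for v
    have g_add: "g (\<lambda>a. u a + v a) = g u + g v" if u: "u \<in> ?M" and v: "v \<in> ?M" for u v
    proof -
      obtain u' v' where "f (alex_class L u) = alex_class L' u'" "f (alex_class L v) = alex_class L' v'"
        using f_class[OF u] f_class[OF v] by blast
      then show ?thesis
        using f_add[THEN bspec, OF L.alex_class_in_module[OF u], THEN bspec, OF L.alex_class_in_module[OF v]]
        by (simp add: g_def L.alex_add_class L'.alex_add_class L'.weigh_class_class[OF w] weigh_add)
    qed
    have g_smult: "g (\<lambda>a. r * v a) = eval_ii r * g v" if r: "r \<in> Lambda (length L)" and v: "v \<in> ?M" for r v
    proof -
      obtain v' where "f (alex_class L v) = alex_class L' v'"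
        using f_class[OF v] by blast
      then show ?thesis
        using f_smult[THEN bspec, OF r, THEN bspec, OF L.alex_class_in_module[OF v]] r len
        by (simp add: g_def L.alex_smult_class L'.alex_smult_class L'.weigh_class_class[OF w] weigh_smult)
    qed
    have g_eq: "g v = weigh L (\<lambda>a. g (basis_vec a)) v" if "v \<in> ?M" for v
      by (rule L.functional_eq_weigh[OF _ _ that]) (fact g_add g_smult)+
    have zero: "(\<lambda>a. 0) \<in> ?M" by (simp add: free_module_def)
    have "g (\<lambda>a. 0) = 0"
      using g_eq[OF zero] by (simp add: weigh_def)
    have "arc_weights L (\<lambda>a. g (basis_vec a))"
      unfolding arc_weights_def
    proof
      fix c assume c: "c \<in> crossings L"
      have "weigh L (\<lambda>a. g (basis_vec a)) (rho_crossing L c) = g (rho_crossing L c)"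
        using g_eq[OF L.rho_crossing_in_free_module[OF c]] by simp
      also have "\<dots> = 0"
        using \<open>g (\<lambda>a. 0) = 0\<close> by (simp add: g_def L.alex_class_rho_crossing[OF c])
      finally show "g (basis_vec (left_arc L c)) =
          (1 - \<i>) * g (basis_vec (over_arc L c)) + \<i> * g (basis_vec (right_arc L c))"
        by (simp add: L.weigh_rho_crossing[OF c])
    qed
    then obtain A where A: "\<forall>a\<in>arcs L. g (basis_vec a) = A"
      using const by blast
    have "g v = A * (\<Sum>a\<in>arcs L. eval_ii (v a))" if "v \<in> ?M" for v
      using g_eq[OF that] A by (simp add: weigh_def sum_distrib_left mult.commute)
    then show ?thesis unfolding g_def by (intro exI ballI)
  qed
  obtain A where A: "\<forall>v\<in>?M. weigh_class L' w1 (f (alex_class L v)) = A * (\<Sum>a\<in>arcs L. eval_ii (v a))"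
    using pull[OF weights(1)] by (elim exE)
  obtain B where B: "\<forall>v\<in>?M. weigh_class L' w2 (f (alex_class L v)) = B * (\<Sum>a\<in>arcs L. eval_ii (v a))"
    using pull[OF weights(2)] by (elim exE)
  have lift: "\<exists>v\<in>?M. f (alex_class L v) = alex_class L' (basis_vec a)" if a: "a \<in> arcs L'" for a
  proof -
    have "alex_class L' (basis_vec a) \<in> f ` alexander_module L"
      using L'.alex_class_in_module[OF L'.basis_vec_in_free_module[OF a]] bij
      by (simp add: bij_betw_def)
    then show ?thesis by (auto simp: alexander_module_def)
  qed
  obtain u v where u: "u \<in> ?M" "f (alex_class L u) = alex_class L' (basis_vec p)"
    and v: "v \<in> ?M" "f (alex_class L v) = alex_class L' (basis_vec s)"
    using lift[OF weights(3)] lift[OF weights(4)] by blast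
  have "A * (\<Sum>a\<in>arcs L. eval_ii (u a)) = 1" "B * (\<Sum>a\<in>arcs L. eval_ii (u a)) = 0"
    "B * (\<Sum>a\<in>arcs L. eval_ii (v a)) = 1"
    using bspec[OF A u(1)] bspec[OF B u(1)] bspec[OF B v(1)] weights u(2) v(2)
    by (simp_all add: L'.weigh_class_class L'.weigh_basis_vec)
  then show False by auto
qed

section \<open>Presented quandles\<close>

lemma Op_in_qterms [simp]: "Op s t \<in> qterms A \<longleftrightarrow> s \<in> qterms A \<and> t \<in> qterms A"
  and Inv_in_qterms [simp]: "Inv s t \<in> qterms A \<longleftrightarrow> s \<in> qterms A \<and> t \<in> qterms A"
  and Gen_in_qterms [simp]: "Gen a \<in> qterms A \<longleftrightarrow> a \<in> A"
  by (auto simp: qterms_def)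

definition qclass :: "'a set \<Rightarrow> ('a qterm \<times> 'a qterm) set \<Rightarrow> 'a qterm \<Rightarrow> 'a qterm set" where
  "qclass A R s = {u. qcong A R s u}"

lemma qclass_eqI:
  assumes "qcong A R s t" shows "qclass A R s = qclass A R t"
  unfolding qclass_def
  using qcong.trans[OF assms] qcong.trans[OF qcong.sym[OF assms]] by (intro Collect_cong iffI)

lemma qclass_self: "s \<in> qterms A \<Longrightarrow> s \<in> qclass A R s"
  by (simp add: qclass_def qcong.refl)

lemma elems_presented_quandle:
  "elems (presented_quandle A R) = qclass A R ` qterms A"
  by (auto simp: presented_quandle_def quotient_def qclass_def)

lemma qop_presented_quandle:
  assumes "s \<in> qterms A" "t \<in> qterms A"
  shows "qop (presented_quandle A R) (qclass A R s) (qclass A R t) = qclass A R (Op s t)"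
proof -
  have "qclass A R (Op s' t') = qclass A R (Op s t)" if "s' \<in> qclass A R s" "t' \<in> qclass A R t" for s' t'
    using that by (intro qclass_eqI[OF qcong.sym] qcong.op) (simp_all add: qclass_def)
  then have "(\<Union>s'\<in>qclass A R s. \<Union>t'\<in>qclass A R t. qclass A R (Op s' t')) =
      (\<Union>s'\<in>qclass A R s. \<Union>t'\<in>qclass A R t. qclass A R (Op s t))"
    by (intro SUP_cong HOL.refl)
  moreover have "qclass A R s \<noteq> {}" "qclass A R t \<noteq> {}"
    using assms qclass_self by blast+
  ultimately show ?thesis
    by (simp add: presented_quandle_def flip: qclass_def)
qed

lemma qinv_presented_quandle:
  assumes "s \<in> qterms A" "t \<in> qterms A"
  shows "qinv (presented_quandle A R) (qclass A R s) (qclass A R t) = qclass A R (Inv s t)"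
proof -
  have "qclass A R (Inv s' t') = qclass A R (Inv s t)" if "s' \<in> qclass A R s" "t' \<in> qclass A R t" for s' t'
    using that by (intro qclass_eqI[OF qcong.sym] qcong.inv) (simp_all add: qclass_def)
  then have "(\<Union>s'\<in>qclass A R s. \<Union>t'\<in>qclass A R t. qclass A R (Inv s' t')) =
      (\<Union>s'\<in>qclass A R s. \<Union>t'\<in>qclass A R t. qclass A R (Inv s t))"
    by (intro SUP_cong HOL.refl)
  moreover have "qclass A R s \<noteq> {}" "qclass A R t \<noteq> {}"
    using assms qclass_self by blast+
  ultimately show ?thesis
    by (simp add: presented_quandle_def flip: qclass_def)
qed

section \<open>Smooth curves on the sphere\<close>

lemma has_vector_derivative_vec_lambda:
  fixes f :: "'n::finite \<Rightarrow> real \<Rightarrow> real"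
  assumes "\<And>i. (f i has_real_derivative f' i) (at t within T)"
  shows "((\<lambda>t. \<chi> i. f i t) has_vector_derivative (\<chi> i. f' i)) (at t within T)"
proof -
  have expand: "(\<chi> i. g i) = (\<Sum>i\<in>UNIV. g i *\<^sub>R axis i (1::real))" for g :: "'n \<Rightarrow> real"
    by (simp add: vec_eq_iff axis_def if_distrib cong: if_cong)
  show ?thesis
    unfolding expand
    by (intro has_vector_derivative_sum bounded_linear.has_vector_derivative[OF bounded_linear_scaleR_left]
        assms[unfolded has_real_derivative_iff_has_vector_derivative])
qed

text \<open>Numerators of the iterated derivatives of \<open>p / q\<close>: the \<open>n\<close>-th one has denominator
  \<open>q ^ (n + 1)\<close>.\<close>

primrec deriv_numerator :: "real poly \<Rightarrow> real poly \<Rightarrow> nat \<Rightarrow> real poly" where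
  "deriv_numerator q p 0 = p"
| "deriv_numerator q p (Suc n) =
     pderiv (deriv_numerator q p n) * q - smult (of_nat (Suc n)) (deriv_numerator q p n * pderiv q)"

text \<open>The quotient rule with the common factor \<open>q ^ n\<close> cancelled.\<close>

lemma has_real_derivative_deriv_numerator:
  assumes "poly q t \<noteq> 0"
  shows "((\<lambda>t. poly (deriv_numerator q p n) t / poly q t ^ Suc n) has_real_derivative
    poly (deriv_numerator q p (Suc n)) t / poly q t ^ Suc (Suc n)) (at t within T)"
proof -
  let ?p = "deriv_numerator q p n"
  have "((\<lambda>t. poly ?p t / poly q t ^ Suc n) has_real_derivative
      (poly (pderiv ?p) t * poly q t ^ Suc n - poly ?p t * (real (Suc n) * (poly (pderiv q) t * poly q t ^ n))) /
      (poly q t ^ Suc n * poly q t ^ Suc n)) (at t)"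
    using assms DERIV_power[OF poly_DERIV, where n = "Suc n"]
    by (intro DERIV_divide poly_DERIV) simp_all
  also have "(poly (pderiv ?p) t * poly q t ^ Suc n - poly ?p t * (real (Suc n) * (poly (pderiv q) t * poly q t ^ n))) /
      (poly q t ^ Suc n * poly q t ^ Suc n) = poly (deriv_numerator q p (Suc n)) t / poly q t ^ Suc (Suc n)"
    using assms by (simp add: divide_simps del: of_nat_Suc) (simp add: algebra_simps del: of_nat_Suc)
  finally show ?thesis by (rule has_field_derivative_at_within)
qed

text \<open>The inverse of the stereographic projection: in these coordinates \<open>plane\<close>
  and \<open>height\<close> are the coordinate functions, so links can be drawn in 3-space.\<close>

definition inverse_stereo :: "real \<Rightarrow> real \<Rightarrow> real \<Rightarrow> real ^ 4" where
  "inverse_stereo x y z = (\<chi> i. (if i = 1 then 2 * x else if i = 2 then 2 * y else if i = 3 then 2 * z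
     else x\<^sup>2 + y\<^sup>2 + z\<^sup>2 - 1) / (x\<^sup>2 + y\<^sup>2 + z\<^sup>2 + 1))"

lemma stereo_denominator_pos: "x\<^sup>2 + y\<^sup>2 + z\<^sup>2 + 1 > (0::real)"
  by (simp add: add_nonneg_pos)

lemma inverse_stereo_components:
  "inverse_stereo x y z $ 1 = 2 * x / (x\<^sup>2 + y\<^sup>2 + z\<^sup>2 + 1)"
  "inverse_stereo x y z $ 2 = 2 * y / (x\<^sup>2 + y\<^sup>2 + z\<^sup>2 + 1)"
  "inverse_stereo x y z $ 3 = 2 * z / (x\<^sup>2 + y\<^sup>2 + z\<^sup>2 + 1)"
  "inverse_stereo x y z $ 4 = (x\<^sup>2 + y\<^sup>2 + z\<^sup>2 - 1) / (x\<^sup>2 + y\<^sup>2 + z\<^sup>2 + 1)"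
  by (simp_all add: inverse_stereo_def)

lemma one_minus_inverse_stereo: "1 - inverse_stereo x y z $ 4 = 2 / (x\<^sup>2 + y\<^sup>2 + z\<^sup>2 + 1)"
  using stereo_denominator_pos[of x y z] by (simp add: inverse_stereo_components field_simps)

lemma inverse_stereo_neq_pole: "inverse_stereo x y z $ 4 \<noteq> 1"
  using one_minus_inverse_stereo[of x y z] stereo_denominator_pos[of x y z] by auto

lemma plane_inverse_stereo: "plane (inverse_stereo x y z) = Complex x y"
  and height_inverse_stereo: "height (inverse_stereo x y z) = z"
  unfolding plane_def height_def one_minus_inverse_stereo
  using stereo_denominator_pos[of x y z] by (simp_all add: inverse_stereo_components)

lemma inverse_stereo_in_sphere: "inverse_stereo x y z \<in> sphere 0 1"
proof -
  define D where "D = x\<^sup>2 + y\<^sup>2 + z\<^sup>2 + 1"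
  have "D > 0" unfolding D_def by (rule stereo_denominator_pos)
  have components: "inverse_stereo x y z $ 1 = 2 * x / D" "inverse_stereo x y z $ 2 = 2 * y / D"
    "inverse_stereo x y z $ 3 = 2 * z / D" "inverse_stereo x y z $ 4 = (D - 2) / D"
    unfolding inverse_stereo_components D_def by simp_all
  have "inverse_stereo x y z \<bullet> inverse_stereo x y z = ((2 * x)\<^sup>2 + (2 * y)\<^sup>2 + (2 * z)\<^sup>2 + (D - 2)\<^sup>2) / D\<^sup>2"
    unfolding inner_vec_def sum_4 components
    by (simp add: power2_eq_square add_divide_distrib)
  also have "(2 * x)\<^sup>2 + (2 * y)\<^sup>2 + (2 * z)\<^sup>2 + (D - 2)\<^sup>2 = D\<^sup>2"
    by (simp add: D_def power2_eq_square algebra_simps)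
  finally show ?thesis using \<open>D > 0\<close> by (simp add: norm_eq_1)
qed

lemma continuous_on_inverse_stereo:
  assumes "continuous_on S f" "continuous_on S g" "continuous_on S h"
  shows "continuous_on S (\<lambda>t. inverse_stereo (f t) (g t) (h t))"
  unfolding inverse_stereo_def
proof (rule continuous_on_vec_lambda)
  fix i :: 4
  have nonzero: "(f t)\<^sup>2 + (g t)\<^sup>2 + (h t)\<^sup>2 + 1 \<noteq> 0" for t
    using stereo_denominator_pos[of "f t" "g t" "h t"] by simp
  have "continuous_on S (\<lambda>t. if i = 1 then 2 * f t else if i = 2 then 2 * g t else if i = 3 then 2 * h t
     else (f t)\<^sup>2 + (g t)\<^sup>2 + (h t)\<^sup>2 - 1)"
    by (cases "i = 1"; cases "i = 2"; cases "i = 3")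
       (simp_all add: continuous_on_mult_left continuous_on_add continuous_on_diff continuous_on_power assms)
  then show "continuous_on S (\<lambda>t. (if i = 1 then 2 * f t else if i = 2 then 2 * g t else if i = 3 then 2 * h t
     else (f t)\<^sup>2 + (g t)\<^sup>2 + (h t)\<^sup>2 - 1) / ((f t)\<^sup>2 + (g t)\<^sup>2 + (h t)\<^sup>2 + 1))"
    by (intro continuous_on_divide continuous_intros assms ballI nonzero)
qed

lemma smooth_regular_on_cong:
  assumes "smooth_regular_on a b g" "\<And>t. t \<in> {a..b} \<Longrightarrow> f t = g t"
  shows "smooth_regular_on a b f"
  using assms unfolding smooth_regular_on_def by simp

text \<open>Along a straight line each coordinate is a rational function with the positive
  denominator \<open>q\<close>, so \<open>deriv_numerator\<close> supplies all derivatives at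
  once.\<close>

lemma smooth_regular_on_inverse_stereo_affine:
  assumes "x1 \<noteq> 0 \<or> y1 \<noteq> 0"
  shows "smooth_regular_on a b (\<lambda>t. inverse_stereo (x0 + x1 * t) (y0 + y1 * t) (z0 + z1 * t))"
proof -
  define q where "q = [:x0, x1:]\<^sup>2 + [:y0, y1:]\<^sup>2 + [:z0, z1:]\<^sup>2 + 1"
  \<comment> \<open>The last numerator, the squared norm minus 1, is \<open>q - 2\<close>.\<close>
  define p :: "4 \<Rightarrow> real poly" where "p i = (if i = 1 then smult 2 [:x0, x1:] else if i = 2 then smult 2 [:y0, y1:]
    else if i = 3 then smult 2 [:z0, z1:] else q - 2)" for i
  define G where "G n t = (\<chi> i. poly (deriv_numerator q (p i) n) t / poly q t ^ Suc n)" for n t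
  have poly_q: "poly q t = (x0 + x1 * t)\<^sup>2 + (y0 + y1 * t)\<^sup>2 + (z0 + z1 * t)\<^sup>2 + 1" for t
    by (simp add: q_def poly_power mult.commute)
  have q_pos: "poly q t > 0" for t
    unfolding poly_q by (rule stereo_denominator_pos)
  have "G 0 t = inverse_stereo (x0 + x1 * t) (y0 + y1 * t) (z0 + z1 * t)" for t
    unfolding G_def inverse_stereo_def
    by (simp add: p_def poly_q fun_eq_iff mult.commute poly_diff)
  moreover have "(G n has_vector_derivative G (Suc n) t) (at t within {a..b})" for n t
    unfolding G_def using q_pos[of t]
    by (intro has_vector_derivative_vec_lambda has_real_derivative_deriv_numerator) simp
  \<comment> \<open>If the velocity vanishes, its last coordinate gives q' = 0, because q' q - (q -
    2) q' = 2 q'. Then p' q - p q' = 0 gives p' = 0 for the first two coordinates, so x1 = y1 =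
    0.\<close>
  moreover have "G 1 t \<noteq> 0" for t
  proof
    assume "G 1 t = 0"
    then have "G 1 t $ i = 0" for i by simp
    then have *: "poly (pderiv (p i) * q - p i * pderiv q) t = 0" for i
      using q_pos[of t] by (simp add: G_def)
    have "pderiv (q - 2) = pderiv q"
      by (simp add: pderiv_diff)
    then have "poly (pderiv q) t = 0"
      using *[of 4] by (simp add: p_def algebra_simps)
    then have "poly (pderiv (p i)) t = 0" for i
      using *[of i] q_pos[of t] by simp
    from this[of 1] this[of 2] show False
      using assms by (simp add: p_def pderiv_pCons pderiv_smult)
  qed
  ultimately show ?thesis
    unfolding smooth_regular_on_def by (intro exI[of _ G]) simp
qed

lemma smooth_regular_on_affine:
  fixes u v :: "'a::real_normed_vector"
  assumes "v \<noteq> 0"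
  shows "smooth_regular_on a b (\<lambda>t. u + t *\<^sub>R v)"
proof -
  define G where "G n t = (if n = 0 then u + t *\<^sub>R v else if n = 1 then v else 0)" for n :: nat and t
  have "(G n has_vector_derivative G (Suc n) t) (at t within {a..b})" for n t
    unfolding G_def by (cases "n = 0"; cases "n = 1") (auto intro!: derivative_eq_intros)
  then show ?thesis
    unfolding smooth_regular_on_def using assms by (intro exI[of _ G]) (simp add: G_def)
qed

section \<open>Bent rectangles\<close>

text \<open>\<open>(square_x, square_y)\<close> runs counterclockwise around the boundary of \<open>[-1, 1]\<^sup>2\<close>,
  starting at \<open>(-1, -1)\<close>, one edge for each quarter of \<open>[0, 1]\<close>.\<close>

definition square_x :: "real \<Rightarrow> real" where
  "square_x t = (if t \<le> 1/4 then 8 * t - 1 else if t \<le> 1/2 then 1 else if t \<le> 3/4 then 5 - 8 * t else - 1)"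

definition square_y :: "real \<Rightarrow> real" where
  "square_y t = (if t \<le> 1/4 then - 1 else if t \<le> 1/2 then 8 * t - 3 else if t \<le> 3/4 then 1 else 7 - 8 * t)"

text \<open>For \<open>k \<noteq> 0\<close> the corners of the rectangle are alternately above and below the plane.\<close>

definition rect :: "real \<Rightarrow> real \<Rightarrow> real \<Rightarrow> real \<Rightarrow> real \<Rightarrow> real ^ 4" where
  "rect cx rx ry k t =
     inverse_stereo (cx + rx * square_x t) (ry * square_y t) (k * (square_x t * square_y t))"

lemma plane_rect: "plane (rect cx rx ry k t) = Complex (cx + rx * square_x t) (ry * square_y t)"
  and height_rect: "height (rect cx rx ry k t) = k * (square_x t * square_y t)"
  by (simp_all add: rect_def plane_inverse_stereo height_inverse_stereo)

text \<open>Clipping minima of affine functions describes the same periodic shape without case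
  distinctions.\<close>

lemma continuous_square: "continuous_on {0..1} square_x" "continuous_on {0..1} square_y"
proof -
  have "continuous_on {0..1} (\<lambda>t. max (- 1) (min (8 * t - 1) (min 1 (5 - 8 * t))) :: real)"
    "continuous_on {0..1} (\<lambda>t. max (- 1) (min (8 * t - 3) (min 1 (7 - 8 * t))) :: real)"
    by (intro continuous_intros)+
  note * = this
  show "continuous_on {0..1} square_x"
    by (rule continuous_on_eq[OF *(1)]) (simp add: square_x_def min_def max_def)
  show "continuous_on {0..1} square_y"
    by (rule continuous_on_eq[OF *(2)]) (simp add: square_y_def min_def max_def)
qed

lemma square_loop: "square_x 0 = square_x 1" "square_y 0 = square_y 1"
  by (simp_all add: square_x_def square_y_def)

lemma square_inj:
  assumes "square_x s = square_x t" "square_y s = square_y t" "s \<in> {0..1}" "t \<in> {0..1}"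
  shows "s = t \<or> s = 0 \<and> t = 1 \<or> s = 1 \<and> t = 0"
  using assms unfolding square_x_def square_y_def by (auto split: if_splits)

lemma plane_rect_inj:
  assumes "plane (rect cx rx ry k s) = plane (rect cx rx ry k t)" "rx \<noteq> 0" "ry \<noteq> 0"
    "s \<in> {0..1}" "t \<in> {0..1}"
  shows "s = t \<or> s = 0 \<and> t = 1 \<or> s = 1 \<and> t = 0"
  using assms by (intro square_inj) (simp_all add: plane_rect)

lemma pathstart_rect: "pathfinish (rect cx rx ry k) = pathstart (rect cx rx ry k)"
  by (simp add: pathfinish_def pathstart_def rect_def square_loop)

lemma path_rect: "path (rect cx rx ry k)"
  unfolding path_def rect_def
  by (intro continuous_on_inverse_stereo continuous_intros continuous_square)

lemma simple_path_rect:
  assumes "rx \<noteq> 0" "ry \<noteq> 0" shows "simple_path (rect cx rx ry k)"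
  unfolding simple_path_def loop_free_def using path_rect plane_rect_inj[OF _ assms] by metis

lemma path_image_rect_sphere: "path_image (rect cx rx ry k) \<subseteq> sphere 0 1"
  unfolding path_image_def rect_def using inverse_stereo_in_sphere by blast

lemma rect_neq_pole: "rect cx rx ry k t $ 4 \<noteq> 1"
  by (simp add: rect_def inverse_stereo_neq_pole)

lemma quarter_cases:
  assumes "0 \<le> a" "a < b" "b \<le> (1::real)" "{a<..<b} \<inter> {1/4, 1/2, 3/4} = {}"
  obtains "b \<le> 1/4" | "1/4 \<le> a" "b \<le> 1/2" | "1/2 \<le> a" "b \<le> 3/4" | "3/4 \<le> a"
  using assms by fastforce

text \<open>The third equation is the reason for taking heights proportional to the product: on each
  edge one factor is constantly 1 or -1, so the height is affine in time and the edge stays straight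
  in 3-space.\<close>

lemma square_affine:
  assumes "0 \<le> a" "a < b" "b \<le> (1::real)" "{a<..<b} \<inter> {1/4, 1/2, 3/4} = {}"
  obtains u0 u1 v0 v1 w0 w1 where
    "\<And>t. t \<in> {a..b} \<Longrightarrow> square_x t = u0 + u1 * t"
    "\<And>t. t \<in> {a..b} \<Longrightarrow> square_y t = v0 + v1 * t"
    "\<And>t. t \<in> {a..b} \<Longrightarrow> square_x t * square_y t = w0 + w1 * t"
    "u1 \<noteq> 0 \<or> v1 \<noteq> 0"
  using assms
proof (cases rule: quarter_cases)
  case 1
  then show ?thesis
    by (intro that[of "- 1" 8 "- 1" 0 1 "- 8"]) (auto simp: square_x_def square_y_def)
next
  case 2
  then show ?thesis
    by (intro that[of 1 0 "- 3" 8 "- 3" 8]) (auto simp: square_x_def square_y_def)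
next
  case 3
  then show ?thesis
    by (intro that[of 5 "- 8" 1 0 5 "- 8"]) (auto simp: square_x_def square_y_def)
next
  case 4
  then show ?thesis
    by (intro that[of "- 1" 0 7 "- 8" "- 7" 8]) (auto simp: square_x_def square_y_def)
qed

lemma piecewise_smooth_rect:
  assumes "rx \<noteq> 0" "ry \<noteq> 0" shows "piecewise_smooth (rect cx rx ry k)"
  unfolding piecewise_smooth_def
proof (intro exI[of _ "{1/4, 1/2, 3/4}"] conjI allI impI; (elim conjE)?)
  fix a b :: real assume ab: "0 \<le> a" "a < b" "b \<le> 1" "{a<..<b} \<inter> {1/4, 1/2, 3/4} = {}"
  obtain u0 u1 v0 v1 w0 w1 where *:
    "\<And>t. t \<in> {a..b} \<Longrightarrow> square_x t = u0 + u1 * t"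
    "\<And>t. t \<in> {a..b} \<Longrightarrow> square_y t = v0 + v1 * t"
    "\<And>t. t \<in> {a..b} \<Longrightarrow> square_x t * square_y t = w0 + w1 * t"
    "u1 \<noteq> 0 \<or> v1 \<noteq> 0"
    using ab by (rule square_affine) blast
  have "smooth_regular_on a b (\<lambda>t. inverse_stereo (cx + rx * u0 + rx * u1 * t) (ry * v0 + ry * v1 * t) (k * w0 + k * w1 * t))"
    using *(4) assms by (intro smooth_regular_on_inverse_stereo_affine) simp
  then show "smooth_regular_on a b (rect cx rx ry k)"
    by (rule smooth_regular_on_cong)
       (simp only: rect_def *(3), simp add: *(1,2) algebra_simps)
qed simp

lemma piecewise_smooth_plane_rect:
  assumes "rx \<noteq> 0" "ry \<noteq> 0" shows "piecewise_smooth (plane \<circ> rect cx rx ry k)"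
  unfolding piecewise_smooth_def
proof (intro exI[of _ "{1/4, 1/2, 3/4}"] conjI allI impI; (elim conjE)?)
  fix a b :: real assume ab: "0 \<le> a" "a < b" "b \<le> 1" "{a<..<b} \<inter> {1/4, 1/2, 3/4} = {}"
  obtain u0 u1 v0 v1 w0 w1 where *:
    "\<And>t. t \<in> {a..b} \<Longrightarrow> square_x t = u0 + u1 * t"
    "\<And>t. t \<in> {a..b} \<Longrightarrow> square_y t = v0 + v1 * t"
    "\<And>t. t \<in> {a..b} \<Longrightarrow> square_x t * square_y t = w0 + w1 * t"
    "u1 \<noteq> 0 \<or> v1 \<noteq> 0"
    using ab by (rule square_affine) blast
  have "smooth_regular_on a b (\<lambda>t. Complex (cx + rx * u0) (ry * v0) + t *\<^sub>R Complex (rx * u1) (ry * v1))"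
    using *(4) assms by (intro smooth_regular_on_affine) (auto simp: complex_eq_iff)
  then show "smooth_regular_on a b (plane \<circ> rect cx rx ry k)"
    by (rule smooth_regular_on_cong)
       (simp add: plane_rect * complex_eq_iff algebra_simps)
qed simp

text \<open>Each edge of \<open>[-1, 1]\<^sup>2\<close> has length 2 and takes time 1/4, hence the
  factor 8.\<close>

definition edge_velocity :: "real \<Rightarrow> real \<Rightarrow> real \<Rightarrow> complex" where
  "edge_velocity rx ry t = (if t < 1/4 then Complex (8 * rx) 0 else if t < 1/2 then Complex 0 (8 * ry)
     else if t < 3/4 then Complex (- 8 * rx) 0 else Complex 0 (- 8 * ry))"

lemma plane_rect_edge:
  assumes "t \<in> {0<..<1} - {1/4, 1/2, 3/4}"
  obtains a b where "t \<in> {a<..<b}" "{a<..<b} \<subseteq> {0<..<1}"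
    "\<forall>x\<in>{a<..<b}.
       plane (rect cx rx ry k x) = plane (rect cx rx ry k t) + (x - t) *\<^sub>R edge_velocity rx ry t"
proof -
  consider "t \<in> {0<..<1/4}" | "t \<in> {1/4<..<1/2}" | "t \<in> {1/2<..<3/4}" | "t \<in> {3/4<..<1}"
    using assms by (simp, linarith)
  then show ?thesis
  proof cases
    case 1
    then show ?thesis
      by (intro that[of 0 "1/4"])
        (auto simp: plane_rect edge_velocity_def square_x_def square_y_def complex_eq_iff algebra_simps)
  next
    case 2
    then show ?thesis
      by (intro that[of "1/4" "1/2"])
        (auto simp: plane_rect edge_velocity_def square_x_def square_y_def complex_eq_iff algebra_simps)
  next
    case 3
    then show ?thesis
      by (intro that[of "1/2" "3/4"])
        (auto simp: plane_rect edge_velocity_def square_x_def square_y_def complex_eq_iff algebra_simps)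
  next
    case 4
    then show ?thesis
      by (intro that[of "3/4" 1])
        (auto simp: plane_rect edge_velocity_def square_x_def square_y_def complex_eq_iff algebra_simps)
  qed
qed

lemma eventually_plane_rect:
  assumes "t \<in> {0<..<1} - {1/4, 1/2, 3/4}"
  shows "\<forall>\<^sub>F x in at t. x \<in> {0<..<1} \<and>
    plane (rect cx rx ry k x) = plane (rect cx rx ry k t) + (x - t) *\<^sub>R edge_velocity rx ry t"
proof -
  obtain a b where *: "t \<in> {a<..<b}" "{a<..<b} \<subseteq> {0<..<1}"
    "\<forall>x\<in>{a<..<b}.
       plane (rect cx rx ry k x) = plane (rect cx rx ry k t) + (x - t) *\<^sub>R edge_velocity rx ry t"
    by (rule plane_rect_edge[OF assms, of cx rx ry k])
  have "\<forall>\<^sub>F x in at t. x \<in> {a<..<b}"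
    using *(1) by (intro eventually_at_in_open') auto
  then show ?thesis
    by (rule eventually_mono) (use *(2) bspec[OF *(3)] in blast)
qed

lemma has_vector_derivative_plane_rect:
  assumes "t \<in> {0<..<1} - {1/4, 1/2, 3/4}"
  shows "(plane \<circ> rect cx rx ry k has_vector_derivative edge_velocity rx ry t) (at t)"
proof -
  obtain a b where *: "t \<in> {a<..<b}" "{a<..<b} \<subseteq> {0<..<1}"
    "\<forall>x\<in>{a<..<b}.
       plane (rect cx rx ry k x) = plane (rect cx rx ry k t) + (x - t) *\<^sub>R edge_velocity rx ry t"
    by (rule plane_rect_edge[OF assms, of cx rx ry k])
  have "((\<lambda>x. plane (rect cx rx ry k t) + (x - t) *\<^sub>R edge_velocity rx ry t)
      has_vector_derivative edge_velocity rx ry t) (at t)"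
    by (auto intro!: derivative_eq_intros)
  then show ?thesis
  proof (rule has_vector_derivative_transform_within_open)
    show "plane (rect cx rx ry k t) + (x - t) *\<^sub>R edge_velocity rx ry t = (plane \<circ> rect cx rx ry k) x"
      if "x \<in> {a<..<b}" for x
      unfolding o_apply by (rule bspec[OF *(3) that, symmetric])
  qed (use *(1) in simp_all)
qed

lemma vector_derivative_plane_rect:
  "t \<in> {0<..<1} - {1/4, 1/2, 3/4} \<Longrightarrow>
     vector_derivative (plane \<circ> rect cx rx ry k) (at t) = edge_velocity rx ry t"
  using has_vector_derivative_plane_rect by (rule vector_derivative_at)

lemma differentiable_plane_rect:
  "t \<in> {0<..<1} - {1/4, 1/2, 3/4} \<Longrightarrow> (plane \<circ> rect cx rx ry k) differentiable (at t)"
  using has_vector_derivative_plane_rect by (rule differentiableI_vector)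

subsection \<open>Reversal\<close>

text \<open>The reflection of t to 1/4 - t modulo 1. It runs the horizontal edges backwards and
  exchanges the vertical ones, so it mirrors the square in the vertical axis.\<close>

definition reflect_time :: "real \<Rightarrow> real" where
  "reflect_time t = (if t \<le> 1/4 then 1/4 - t else 5/4 - t)"

text \<open>The sign changes of \<open>rx\<close> and \<open>k\<close> compensate those of
  \<open>square_x\<close> and of the product under the time reflection. A reversed rectangle thus
  belongs to the same family, and every lemma on rectangles covers it.\<close>

lemma rect_reversed:
  assumes "t \<in> {0..1}"
  shows "rect cx (- rx) ry (- k) t = rect cx rx ry k (reflect_time t)"
proof -
  have "square_x (reflect_time t) = - square_x t" "square_y (reflect_time t) = square_y t"
    using assms by (auto simp: reflect_time_def square_x_def square_y_def)
  then show ?thesis by (simp add: rect_def)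
qed

lemma path_image_rect_reversed: "path_image (rect cx (- rx) ry (- k)) = path_image (rect cx rx ry k)"
proof -
  have "path_image (rect cx (- rx) ry (- k)) \<subseteq> path_image (rect cx rx ry k)" for rx k
  proof
    fix p assume "p \<in> path_image (rect cx (- rx) ry (- k))"
    then obtain t where t: "t \<in> {0..1}" "p = rect cx (- rx) ry (- k) t"
      by (auto simp: path_image_def)
    moreover have "reflect_time t \<in> {0..1}"
      using t(1) by (auto simp: reflect_time_def)
    ultimately show "p \<in> path_image (rect cx rx ry k)"
      unfolding path_image_def by (simp add: rect_reversed)
  qed
  from this[of rx k] this[of "- rx" "- k"] show ?thesis by simp
qed

subsection \<open>Pieces of rectangles\<close>

text \<open>A rectangle with two underpasses falls into two arcs, separated by the line through the
  two underpassing points; in the examples this line contains the origin. Described by points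
  instead of times, the pieces do not depend on the orientation.\<close>

definition half_part :: "real \<Rightarrow> real \<Rightarrow> (real \<Rightarrow> real ^ 4) \<Rightarrow> (real ^ 4) set" where
  "half_part \<alpha> \<beta> g = {p \<in> path_image g. 0 < \<alpha> * Re (plane p) + \<beta> * Im (plane p)}"

lemma half_part_reversed: "half_part \<alpha> \<beta> (rect cx (- rx) ry (- k)) = half_part \<alpha> \<beta> (rect cx rx ry k)"
  by (simp add: half_part_def path_image_rect_reversed)

lemma image_restrict: "{p \<in> f ` A. P p} = f ` {t \<in> A. P (f t)}"
  by blast

lemma half_part_rect:
  "half_part \<alpha> \<beta> (rect cx rx ry k) =
     rect cx rx ry k ` {t \<in> {0..1}. 0 < \<alpha> * (cx + rx * square_x t) + \<beta> * (ry * square_y t)}"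
  unfolding half_part_def path_image_def image_restrict plane_rect complex.sel ..

lemma compact_closed_half:
  "compact {p \<in> path_image (rect cx rx ry k). 0 \<le> \<alpha> * Re (plane p) + \<beta> * Im (plane p)}"
proof -
  have "{p \<in> path_image (rect cx rx ry k). 0 \<le> \<alpha> * Re (plane p) + \<beta> * Im (plane p)} =
     rect cx rx ry k ` {t \<in> {0..1}. 0 \<le> \<alpha> * (cx + rx * square_x t) + \<beta> * (ry * square_y t)}"
    unfolding path_image_def image_restrict plane_rect complex.sel ..
  moreover have "compact {t \<in> {0..1}. 0 \<le> \<alpha> * (cx + rx * square_x t) + \<beta> * (ry * square_y t)}"
  proof -
    have "continuous_on {0..1} (\<lambda>t. \<alpha> * (cx + rx * square_x t) + \<beta> * (ry * square_y t))"
      by (intro continuous_intros continuous_square)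
    note continuous_on_closed_Collect_le[OF continuous_on_const[of _ 0] this closed_real_atLeastAtMost]
    moreover have "bounded {t \<in> {0..1}. 0 \<le> \<alpha> * (cx + rx * square_x t) + \<beta> * (ry * square_y t)}"
      by (rule bounded_subset[OF bounded_closed_interval[of 0 1]]) (rule Collect_restrict)
    ultimately show ?thesis
      by (simp only: compact_eq_bounded_closed)
  qed
  moreover have "continuous_on {t \<in> {0..1}. 0 \<le> \<alpha> * (cx + rx * square_x t) + \<beta> * (ry * square_y t)} (rect cx rx ry k)"
    using path_rect[of cx rx ry k] unfolding path_def
    by (rule continuous_on_subset) (rule Collect_restrict)
  ultimately show ?thesis
    by (simp only: compact_continuous_image)
qed

text \<open>The piece around the base point is the image of two intervals, joined by
  \<open>g 0 = g 1\<close>.\<close>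

lemma connected_loop_complement:
  assumes "path g" "pathfinish g = pathstart g" "0 < t1" "t1 \<le> t2" "t2 < 1"
  shows "connected (g ` ({0..<t1} \<union> {t2<..1}))"
proof -
  have "continuous_on {0..<t1} g" "continuous_on {t2<..1} g"
    using assms(1) unfolding path_def by (rule continuous_on_subset; use assms in auto)+
  then have "connected (g ` {0..<t1})" "connected (g ` {t2<..1})"
    by (intro connected_continuous_image; simp)+
  moreover have "g 0 \<in> g ` {0..<t1}" "g 1 \<in> g ` {t2<..1}"
    using assms by (intro imageI; simp)+
  then have "g ` {0..<t1} \<inter> g ` {t2<..1} \<noteq> {}"
    using assms(2) by (auto simp: pathfinish_def pathstart_def)
  ultimately show ?thesis
    unfolding image_Un by (intro connected_Un)
qed

lemma connected_path_segment:
  assumes "path g" "0 < t1" "t2 < 1" shows "connected (g ` {t1<..<t2})"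
proof (rule connected_continuous_image)
  show "continuous_on {t1<..<t2} g"
    using assms(1) unfolding path_def by (rule continuous_on_subset) (use assms in auto)
qed simp

text \<open>A linear form that vanishes at time \<open>t\<close> has, along the edge, the sign of (x
  - t) times its value on the velocity.\<close>

lemma eventually_half_part:
  assumes "t \<in> {0<..<1} - {1/4, 1/2, 3/4}"
    and "\<alpha> * Re (plane (rect cx rx ry k t)) + \<beta> * Im (plane (rect cx rx ry k t)) = 0"
  shows eventually_half_part_left:
      "\<alpha> * Re (edge_velocity rx ry t) + \<beta> * Im (edge_velocity rx ry t) < 0 \<Longrightarrow>
        \<forall>\<^sub>F x in at_left t. rect cx rx ry k x \<in> half_part \<alpha> \<beta> (rect cx rx ry k)"
    and eventually_half_part_right:
      "\<alpha> * Re (edge_velocity rx ry t) + \<beta> * Im (edge_velocity rx ry t) > 0 \<Longrightarrow>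
        \<forall>\<^sub>F x in at_right t. rect cx rx ry k x \<in> half_part \<alpha> \<beta> (rect cx rx ry k)"
proof -
  let ?g = "rect cx rx ry k" and ?v = "edge_velocity rx ry t"
  have *: "\<alpha> * Re (plane (?g x)) + \<beta> * Im (plane (?g x)) = (x - t) * (\<alpha> * Re ?v + \<beta> * Im ?v)"
    if "plane (?g x) = plane (?g t) + (x - t) *\<^sub>R ?v" for x
    unfolding that using assms(2) by (simp add: algebra_simps)
  have ev: "\<forall>\<^sub>F x in at t. ?g x \<in> path_image ?g \<and>
      \<alpha> * Re (plane (?g x)) + \<beta> * Im (plane (?g x)) = (x - t) * (\<alpha> * Re ?v + \<beta> * Im ?v)"
    using eventually_plane_rect[OF assms(1), of cx rx ry k]
  proof (rule eventually_mono, intro conjI)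
    fix x assume x: "x \<in> {0<..<1} \<and> plane (?g x) = plane (?g t) + (x - t) *\<^sub>R ?v"
    then show "?g x \<in> path_image ?g" by (auto simp: path_image_def)
    show "\<alpha> * Re (plane (?g x)) + \<beta> * Im (plane (?g x)) = (x - t) * (\<alpha> * Re ?v + \<beta> * Im ?v)"
      using x by (intro *) simp
  qed
  note ev_left = ev[unfolded eventually_at_split, THEN conjunct1]
    and ev_right = ev[unfolded eventually_at_split, THEN conjunct2]
  { assume neg: "\<alpha> * Re ?v + \<beta> * Im ?v < 0"
    have "\<forall>\<^sub>F x in at_left t. x < t"
      by (simp add: eventually_at_filter)
    with ev_left show "\<forall>\<^sub>F x in at_left t. ?g x \<in> half_part \<alpha> \<beta> ?g"
    proof eventually_elim
      case (elim x)
      then have "0 < (x - t) * (\<alpha> * Re ?v + \<beta> * Im ?v)"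
        using neg by (simp add: mult_neg_neg)
      then show ?case using elim by (simp add: half_part_def)
    qed }
  { assume pos: "\<alpha> * Re ?v + \<beta> * Im ?v > 0"
    have "\<forall>\<^sub>F x in at_right t. t < x"
      by (simp add: eventually_at_filter)
    with ev_right show "\<forall>\<^sub>F x in at_right t. ?g x \<in> half_part \<alpha> \<beta> ?g"
    proof eventually_elim
      case (elim x)
      then have "0 < (x - t) * (\<alpha> * Re ?v + \<beta> * Im ?v)"
        using pos by simp
      then show ?case using elim by (simp add: half_part_def)
    qed }
qed

lemma eventually_punctured:
  assumes "t \<in> {0<..<1} - {1/4, 1/2, 3/4}" "rx \<noteq> 0" "ry \<noteq> 0"
  shows "\<forall>\<^sub>F x in at t. rect cx rx ry k x \<in> path_image (rect cx rx ry k) - {rect cx rx ry k t}"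
proof -
  have "\<forall>\<^sub>F x in at t. x \<noteq> t"
    by (simp add: eventually_at_filter)
  with eventually_plane_rect[OF assms(1), of cx rx ry k] show ?thesis
  proof eventually_elim
    case (elim x)
    have "rect cx rx ry k x \<noteq> rect cx rx ry k t"
    proof
      assume "rect cx rx ry k x = rect cx rx ry k t"
      then have "x = t \<or> x = 0 \<and> t = 1 \<or> x = 1 \<and> t = 0"
        using elim(1) assms by (intro plane_rect_inj[of cx rx ry k]) simp_all
      then show False using elim assms(1) by simp
    qed
    moreover have "rect cx rx ry k x \<in> path_image (rect cx rx ry k)"
      unfolding path_image_def using elim(1) by (intro imageI) simp
    ultimately show ?case by simp
  qed
qed

section \<open>Arcs\<close>

text \<open>Each block is relatively closed, and so is the union of the finitely many others. A
  connected subset of \<open>S\<close> that meets a block therefore cannot leave it.\<close>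

lemma components_eqI:
  assumes "finite P" "\<Union>P = S"
    and conn: "\<And>C. C \<in> P \<Longrightarrow> connected C \<and> C \<noteq> {}"
    and closed: "\<And>C. C \<in> P \<Longrightarrow> \<exists>K. closed K \<and> C = S \<inter> K"
    and disj: "\<And>C D. C \<in> P \<Longrightarrow> D \<in> P \<Longrightarrow> C \<noteq> D \<Longrightarrow> C \<inter> D = {}"
  shows "components S = P"
proof -
  have maximal: "T \<subseteq> C" if C: "C \<in> P" and T: "connected T" "T \<subseteq> S" "T \<inter> C \<noteq> {}" for C T
  proof (rule ccontr)
    assume outside: "\<not> T \<subseteq> C"
    have "closedin (top_of_set S) D" if "D \<in> P" for D
      using closed[OF that] by (auto simp: closedin_closed)
    then have "closedin (top_of_set S) C" "closedin (top_of_set S) (\<Union>(P - {C}))"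
      using C assms(1) by (auto intro: closedin_Union)
    then obtain K M where KM: "closed K" "C = S \<inter> K" "closed M" "\<Union>(P - {C}) = S \<inter> M"
      unfolding closedin_closed by auto
    have "C \<inter> \<Union>(P - {C}) = {}" using disj[OF C] by auto
    then have "K \<inter> M \<inter> T = {}" using KM T(2) by auto
    moreover have "S = C \<union> \<Union>(P - {C})" using assms(2) C by auto
    then have "T \<subseteq> K \<union> M" using KM T(2) by auto
    moreover have "K \<inter> T \<noteq> {}" using KM T(3) by auto
    moreover have "M \<inter> T \<noteq> {}" using \<open>T \<subseteq> K \<union> M\<close> outside KM T(2) by auto
    ultimately show False
      using connected_closedD[OF T(1), of K M] KM by simp
  qed
  have component: "connected_component_set S x = C" if C: "C \<in> P" and x: "x \<in> C" for C x
  proof (rule connected_component_unique)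
    show "C \<subseteq> S" using C assms(2) by auto
    show "D \<subseteq> C" if "x \<in> D" "D \<subseteq> S" "connected D" for D
      using that x by (intro maximal[OF C]) auto
  qed (use conn[OF C] x in auto)
  show ?thesis
  proof (intro equalityI subsetI)
    fix D assume "D \<in> components S"
    then obtain x where "x \<in> S" "D = connected_component_set S x"
      by (auto simp: components_def)
    moreover then obtain C where "C \<in> P" "x \<in> C" using assms(2) by auto
    ultimately show "D \<in> P" using component by simp
  next
    fix D assume D: "D \<in> P"
    then obtain x where "x \<in> D" using conn by auto
    moreover then have "x \<in> S" using assms(2) D by auto
    ultimately show "D \<in> components S"
      using component[OF D] by (auto simp: components_def)
  qed
qed

lemma arcs_eqI:
  assumes "a \<in> arcs L" "b \<in> arcs L" "p \<in> a" "p \<in> b" shows "a = b"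
  using assms components_nonoverlap[of a _ b] unfolding arcs_def by auto

lemma over_arc_eqI:
  assumes "a \<in> arcs L" "over_point L c \<in> a" shows "over_arc L c = a"
  unfolding over_arc_def
proof (rule the_equality)
  show "b = a" if "b \<in> arcs L \<and> over_point L c \<in> b" for b
    using that assms arcs_eqI[of b L a "over_point L c"] by simp
qed (use assms in simp)

lemma arc_index_eqI:
  assumes "is_link L" "i < length L" "a \<subseteq> path_image (L ! i)" "a \<noteq> {}"
  shows "arc_index L a = i"
  unfolding arc_index_def
proof (rule the_equality)
  fix j assume j: "j < length L \<and> a \<subseteq> path_image (L ! j)"
  show "j = i"
  proof (rule ccontr)
    assume "j \<noteq> i"
    then have "path_image (L ! j) \<inter> path_image (L ! i) = {}"
      using assms(1,2) j by (simp add: is_link_def)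
    then show False using assms(3,4) j by auto
  qed
qed (use assms in simp)

text \<open>\<open>P\<close> stands for lying on a given side of the overpass. Any qualifying arc
  contains the curve shortly before \<open>t\<close>, so it shares a point with \<open>a\<close>,
  and distinct arcs are disjoint.\<close>

lemma the_arc_at_left:
  assumes "\<forall>\<^sub>F x in at (t::real). P x \<longleftrightarrow> x < t" "a \<in> arcs L" "\<forall>\<^sub>F x in at_left t. g x \<in> a"
  shows "(THE a. a \<in> arcs L \<and> (\<forall>\<^sub>F x in at t. P x \<longrightarrow> g x \<in> a)) = a"
proof (rule the_equality)
  have "\<forall>\<^sub>F x in at t. x < t \<longrightarrow> g x \<in> a"
    using assms(3) by (simp add: eventually_at_filter)
  with assms(1) have "\<forall>\<^sub>F x in at t. P x \<longrightarrow> g x \<in> a"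
    by eventually_elim simp
  then show "a \<in> arcs L \<and> (\<forall>\<^sub>F x in at t. P x \<longrightarrow> g x \<in> a)"
    using assms(2) by simp
next
  fix b assume b: "b \<in> arcs L \<and> (\<forall>\<^sub>F x in at t. P x \<longrightarrow> g x \<in> b)"
  then have "\<forall>\<^sub>F x in at_left t. P x \<longrightarrow> g x \<in> b" "\<forall>\<^sub>F x in at_left t. P x \<longleftrightarrow> x < t"
    using assms(1) by (auto simp: eventually_at_split)
  moreover have "\<forall>\<^sub>F x in at_left t. x < t"
    by (simp add: eventually_at_filter)
  ultimately have "\<forall>\<^sub>F x in at_left t. g x \<in> a \<and> g x \<in> b"
    using assms(3) by eventually_elim simp
  then obtain x where "g x \<in> a" "g x \<in> b"
    using eventually_happens'[OF trivial_limit_at_left_real] by blast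
  then show "b = a" using assms(2) b arcs_eqI by blast
qed

lemma the_arc_at_right:
  assumes "\<forall>\<^sub>F x in at (t::real). P x \<longleftrightarrow> t < x" "a \<in> arcs L" "\<forall>\<^sub>F x in at_right t. g x \<in> a"
  shows "(THE a. a \<in> arcs L \<and> (\<forall>\<^sub>F x in at t. P x \<longrightarrow> g x \<in> a)) = a"
proof (rule the_equality)
  have "\<forall>\<^sub>F x in at t. t < x \<longrightarrow> g x \<in> a"
    using assms(3) by (simp add: eventually_at_filter)
  with assms(1) have "\<forall>\<^sub>F x in at t. P x \<longrightarrow> g x \<in> a"
    by eventually_elim simp
  then show "a \<in> arcs L \<and> (\<forall>\<^sub>F x in at t. P x \<longrightarrow> g x \<in> a)"
    using assms(2) by simp
next
  fix b assume b: "b \<in> arcs L \<and> (\<forall>\<^sub>F x in at t. P x \<longrightarrow> g x \<in> b)"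
  then have "\<forall>\<^sub>F x in at_right t. P x \<longrightarrow> g x \<in> b" "\<forall>\<^sub>F x in at_right t. P x \<longleftrightarrow> t < x"
    using assms(1) by (auto simp: eventually_at_split)
  moreover have "\<forall>\<^sub>F x in at_right t. t < x"
    by (simp add: eventually_at_filter)
  ultimately have "\<forall>\<^sub>F x in at_right t. g x \<in> a \<and> g x \<in> b"
    using assms(3) by eventually_elim simp
  then obtain x where "g x \<in> a" "g x \<in> b"
    using eventually_happens'[OF trivial_limit_at_right_real] by blast
  then show "b = a" using assms(2) b arcs_eqI by blast
qed

lemma eventually_side:
  assumes "g = rect cx rx ry k" "t \<in> {0<..<1} - {1/4, 1/2, 3/4}"
  shows "\<forall>\<^sub>F x in at t. side u (plane (g x) - plane (g t)) = (x - t) * side u (edge_velocity rx ry t)"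
  unfolding assms(1) using eventually_plane_rect[OF assms(2), of cx rx ry k]
proof (rule eventually_mono, elim conjE)
  fix x assume *: "plane (rect cx rx ry k x) = plane (rect cx rx ry k t) + (x - t) *\<^sub>R edge_velocity rx ry t"
  show "side u (plane (rect cx rx ry k x) - plane (rect cx rx ry k t)) = (x - t) * side u (edge_velocity rx ry t)"
    unfolding * by (simp add: side_def algebra_simps)
qed

text \<open>The underpass comes from the right if its velocity points to the left of the overpass.\<close>

lemma
  assumes "L ! j = rect cx rx ry k" "t \<in> {0<..<1} - {1/4, 1/2, 3/4}"
    and "a \<in> arcs L" "\<forall>\<^sub>F x in at_left t. (L ! j) x \<in> a"
    and "b \<in> arcs L" "\<forall>\<^sub>F x in at_right t. (L ! j) x \<in> b"
  shows under_arcs_leftwards: "side (over_tangent L (i, s, j, t)) (edge_velocity rx ry t) > 0 \<Longrightarrow>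
      right_arc L (i, s, j, t) = a \<and> left_arc L (i, s, j, t) = b"
    and under_arcs_rightwards: "side (over_tangent L (i, s, j, t)) (edge_velocity rx ry t) < 0 \<Longrightarrow>
      right_arc L (i, s, j, t) = b \<and> left_arc L (i, s, j, t) = a"
proof -
  let ?u = "over_tangent L (i, s, j, t)"
  let ?\<sigma> = "side ?u (edge_velocity rx ry t)" and ?d = "\<lambda>x. side ?u (plane ((L ! j) x) - plane ((L ! j) t))"
  note * = eventually_side[OF assms(1,2), of ?u]
  { assume \<sigma>: "?\<sigma> > 0"
    have "\<forall>\<^sub>F x in at t. ?d x < 0 \<longleftrightarrow> x < t"
      using * by (rule eventually_mono) (use \<sigma> in \<open>simp add: mult_less_0_iff\<close>)
    moreover have "\<forall>\<^sub>F x in at t. ?d x > 0 \<longleftrightarrow> t < x"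
      using * by (rule eventually_mono) (use \<sigma> in \<open>simp add: zero_less_mult_iff\<close>)
    ultimately show "right_arc L (i, s, j, t) = a \<and> left_arc L (i, s, j, t) = b"
      unfolding right_arc.simps left_arc.simps
      using the_arc_at_left[OF _ assms(3,4)] the_arc_at_right[OF _ assms(5,6)] by simp }
  { assume \<sigma>: "?\<sigma> < 0"
    have "\<forall>\<^sub>F x in at t. ?d x < 0 \<longleftrightarrow> t < x"
      using * by (rule eventually_mono) (use \<sigma> in \<open>simp add: mult_less_0_iff\<close>)
    moreover have "\<forall>\<^sub>F x in at t. ?d x > 0 \<longleftrightarrow> x < t"
      using * by (rule eventually_mono) (use \<sigma> in \<open>simp add: zero_less_mult_iff\<close>)
    ultimately show "right_arc L (i, s, j, t) = b \<and> left_arc L (i, s, j, t) = a"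
      unfolding right_arc.simps left_arc.simps
      using the_arc_at_left[OF _ assms(3,4)] the_arc_at_right[OF _ assms(5,6)] by simp }
qed

section \<open>Links of bent rectangles\<close>

text \<open>The conditions to be computed for a concrete link. Heights and triple points are
  compared on different components only, because each rectangle projects injectively up to its base
  point.\<close>

locale rect_link =
  fixes L :: link
  assumes nonempty: "L \<noteq> []"
    and rects: "i < length L \<Longrightarrow> \<exists>cx rx ry k. rx \<noteq> 0 \<and> ry \<noteq> 0 \<and> L ! i = rect cx rx ry k"
    and heights: "i < length L \<Longrightarrow> j < length L \<Longrightarrow> i \<noteq> j \<Longrightarrow> s \<in> {0..1} \<Longrightarrow> t \<in> {0..1} \<Longrightarrow>
      plane ((L ! i) s) = plane ((L ! j) t) \<Longrightarrow> height ((L ! i) s) \<noteq> height ((L ! j) t)"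
    and no_triple: "i < length L \<Longrightarrow> j < length L \<Longrightarrow> l < length L \<Longrightarrow> distinct [i, j, l] \<Longrightarrow>
      s \<in> {0..1} \<Longrightarrow> t \<in> {0..1} \<Longrightarrow> u \<in> {0..1} \<Longrightarrow>
      plane ((L ! i) s) = plane ((L ! j) t) \<Longrightarrow> plane ((L ! j) t) \<noteq> plane ((L ! l) u)"
    and finite: "finite (crossings L)"
    and regular_times: "(i, s, j, t) \<in> crossings L \<Longrightarrow>
      s \<in> {0<..<1} - {1/4, 1/2, 3/4} \<and> t \<in> {0<..<1} - {1/4, 1/2, 3/4}"
    and transverse: "c \<in> crossings L \<Longrightarrow> side (over_tangent L c) (under_tangent L c) \<noteq> 0"
begin

lemma rect_cases:
  assumes "g \<in> set L"
  obtains cx rx ry k where "rx \<noteq> 0" "ry \<noteq> 0" "g = rect cx rx ry k"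
proof -
  obtain i where "i < length L" "g = L ! i"
    using assms by (auto simp: in_set_conv_nth)
  then show ?thesis
    using rects[of i] that by auto
qed

lemma is_link: "is_link L"
proof -
  have "simple_path g \<and> pathfinish g = pathstart g \<and> piecewise_smooth g \<and> path_image g \<subseteq> sphere 0 1"
    if g: "g \<in> set L" for g
    using simple_path_rect pathstart_rect piecewise_smooth_rect path_image_rect_sphere
    by (rule_tac rect_cases[OF g]) simp
  moreover have "path_image (L ! i) \<inter> path_image (L ! j) = {}"
    if ij: "i < length L" "j < length L" "i \<noteq> j" for i j
  proof (rule ccontr)
    assume "path_image (L ! i) \<inter> path_image (L ! j) \<noteq> {}"
    then obtain p where "p \<in> path_image (L ! i)" "p \<in> path_image (L ! j)" by auto
    then obtain s t where "s \<in> {0..1}" "t \<in> {0..1}" "(L ! i) s = (L ! j) t"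
      unfolding path_image_def by auto
    then show False using heights[OF ij, of s t] by simp
  qed
  ultimately show ?thesis
    unfolding is_link_def using nonempty by simp
qed

lemma link_support_cases:
  assumes "p \<in> link_support L"
  obtains i t where "i < length L" "t \<in> {0..1}" "p = (L ! i) t"
  using assms unfolding link_support_def path_image_def by (auto simp: in_set_conv_nth)

lemma plane_inj:
  assumes "i < length L" "s \<in> {0..1}" "t \<in> {0..1}" "plane ((L ! i) s) = plane ((L ! i) t)"
  shows "(L ! i) s = (L ! i) t"
proof -
  obtain cx rx ry k where *: "rx \<noteq> 0" "ry \<noteq> 0" "L ! i = rect cx rx ry k"
    using rects[OF assms(1)] by auto
  have "rect cx rx ry k 0 = rect cx rx ry k 1"
    using pathstart_rect[of cx rx ry k] by (simp add: pathstart_def pathfinish_def)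
  then show ?thesis
    using plane_rect_inj[of cx rx ry k s t] assms * by auto
qed

text \<open>By \<open>no_triple\<close>, two of the three points lie on one component, and there
  equal projections mean equal points.\<close>

lemma double_points:
  assumes "p \<in> link_support L" "q \<in> link_support L" "r \<in> link_support L"
    and "plane p = plane q" "plane q = plane r"
  shows "p = q \<or> q = r \<or> p = r"
proof -
  obtain i s where p: "i < length L" "s \<in> {0..1}" "p = (L ! i) s"
    using assms(1) by (rule link_support_cases)
  obtain j t where q: "j < length L" "t \<in> {0..1}" "q = (L ! j) t"
    using assms(2) by (rule link_support_cases)
  obtain l u where r: "l < length L" "u \<in> {0..1}" "r = (L ! l) u"
    using assms(3) by (rule link_support_cases)
  have "i = j \<or> j = l \<or> i = l"
  proof (rule ccontr)
    assume "\<not> (i = j \<or> j = l \<or> i = l)"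
    then have "distinct [i, j, l]" by simp
    then show False using no_triple[of i j l s t u] p q r assms(4,5) by simp
  qed
  then consider "i = j" | "j = l" | "i = l" by auto
  then show ?thesis
  proof cases
    case 1
    then show ?thesis using plane_inj[of i s t] p q assms(4) by simp
  next
    case 2
    then show ?thesis using plane_inj[of j t u] q r assms(5) by simp
  next
    case 3
    then show ?thesis using plane_inj[of i s u] p r assms(4,5) by simp
  qed
qed

lemma regular_crossing:
  assumes "(i, s, j, t) \<in> crossings L"
  shows "s \<noteq> 0 \<and> t \<noteq> 0 \<and> (plane \<circ> L ! i) differentiable (at s) \<and>
      (plane \<circ> L ! j) differentiable (at t) \<and> side (over_tangent L (i, s, j, t)) (under_tangent L (i, s, j, t)) \<noteq> 0"
proof -
  have ij: "i < length L" "j < length L" using assms by (simp_all add: crossings_def)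
  obtain cx rx ry k where "L ! i = rect cx rx ry k"
    using rects[OF ij(1)] by auto
  moreover obtain cx rx ry k where "L ! j = rect cx rx ry k"
    using rects[OF ij(2)] by auto
  ultimately show ?thesis
    using regular_times[OF assms] transverse[OF assms] by (auto intro: differentiable_plane_rect)
qed

lemma regular_projection: "regular_projection L"
  unfolding regular_projection_def
proof (intro conjI ballI impI; (elim conjE)?)
  show "p $ 4 \<noteq> 1" if p: "p \<in> link_support L" for p
  proof -
    obtain i t where "i < length L" "t \<in> {0..1}" "p = (L ! i) t"
      using p by (rule link_support_cases)
    then show ?thesis using rects[of i] rect_neq_pole by auto
  qed
  show "piecewise_smooth (plane \<circ> g)" if g: "g \<in> set L" for g
    using g by (rule rect_cases) (simp add: piecewise_smooth_plane_rect)
  show "p = q \<or> q = r \<or> p = r"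
    if "p \<in> link_support L" "q \<in> link_support L" "r \<in> link_support L" "plane p = plane q" "plane q = plane r"
    for p q r
    using that by (rule double_points)
  show "case c of (i, s, j, t) \<Rightarrow> s \<noteq> 0 \<and> t \<noteq> 0 \<and>
        (plane \<circ> L ! i) differentiable (at s) \<and> (plane \<circ> L ! j) differentiable (at t) \<and>
        side (over_tangent L (i, s, j, t)) (under_tangent L (i, s, j, t)) \<noteq> 0"
    if "c \<in> crossings L" for c
    using that regular_crossing by (cases c) auto
qed (rule finite)

end

subsection \<open>Cutting loops into arcs\<close>

text \<open>The pieces are closed only relative to the complement of the cut points, so each is
  written as a closed subset of the component minus these points. In this form closedness survives
  the passage to the whole link.\<close>

definition cut_into :: "'a::topological_space set \<Rightarrow> 'a set \<Rightarrow> 'a set set \<Rightarrow> bool" where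
  "cut_into M U P \<longleftrightarrow> finite P \<and> U \<subseteq> M \<and> \<Union>P = M - U \<and>
     (\<forall>C\<in>P. connected C \<and> C \<noteq> {} \<and> (\<exists>K. closed K \<and> K \<subseteq> M \<and> C = K - U)) \<and>
     (\<forall>C\<in>P. \<forall>D\<in>P. C \<noteq> D \<longrightarrow> C \<inter> D = {})"

text \<open>Different components are disjoint, so the cut points of one never lie on another and the
  local partitions add up to one of the whole complement.\<close>

lemma arcs_cut_into:
  assumes "is_link L"
    and cut: "\<And>i. i < length L \<Longrightarrow> cut_into (path_image (L ! i)) (U i) (P i)"
    and under: "under_point L ` crossings L = (\<Union>i<length L. U i)"
  shows "arcs L = (\<Union>i<length L. P i)"
  unfolding arcs_def
proof (rule components_eqI)
  let ?M = "\<lambda>i. path_image (L ! i)"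
  have support: "link_support L = (\<Union>i<length L. ?M i)"
    unfolding link_support_def set_conv_nth by auto
  have disj: "?M i \<inter> ?M j = {}" if "i < length L" "j < length L" "i \<noteq> j" for i j
    using assms(1) that unfolding is_link_def by auto
  have UM: "U i \<subseteq> ?M i" and PM: "\<Union>(P i) = ?M i - U i" if "i < length L" for i
    using cut[OF that] by (simp_all add: cut_into_def)
  have other: "x \<notin> U j" if "i < length L" "j < length L" "x \<in> ?M i" "x \<notin> U i" for i j x
    using that UM[of j] disj[of i j] by (cases "i = j") auto
  show "finite (\<Union>i<length L. P i)"
    using cut by (auto simp: cut_into_def)
  have "(\<Union>i<length L. ?M i - U i) = (\<Union>i<length L. ?M i) - (\<Union>i<length L. U i)"
    using other by auto
  moreover have "\<Union>(\<Union>i<length L. P i) = (\<Union>i<length L. \<Union>(P i))"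
    by auto
  then have "\<Union>(\<Union>i<length L. P i) = (\<Union>i<length L. ?M i - U i)"
    using PM by simp
  ultimately show "\<Union>(\<Union>i<length L. P i) = link_support L - under_point L ` crossings L"
    unfolding support under by simp
  fix C assume "C \<in> (\<Union>i<length L. P i)"
  then obtain i where i: "i < length L" "C \<in> P i" by auto
  then show "connected C \<and> C \<noteq> {}"
    using cut[OF i(1)] by (simp add: cut_into_def)
  have "\<exists>K. closed K \<and> K \<subseteq> ?M i \<and> C = K - U i"
    using cut[OF i(1)] i(2) unfolding cut_into_def by simp
  then obtain K where K: "closed K" "K \<subseteq> ?M i" "C = K - U i"
    by (elim exE conjE)
  moreover have "K - U i = (link_support L - under_point L ` crossings L) \<inter> K"
    unfolding support under using K(2) i(1) other[OF i(1)] by auto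
  ultimately show "\<exists>K. closed K \<and> C = (link_support L - under_point L ` crossings L) \<inter> K"
    by (intro exI[of _ K]) simp
  fix D assume "D \<in> (\<Union>i<length L. P i)" "C \<noteq> D"
  then obtain j where j: "j < length L" "D \<in> P j" by auto
  show "C \<inter> D = {}"
  proof (cases "i = j")
    case True
    then show ?thesis using cut[OF i(1)] i(2) j(2) \<open>C \<noteq> D\<close> by (simp add: cut_into_def)
  next
    case False
    have "C \<subseteq> ?M i" "D \<subseteq> ?M j" using PM[OF i(1)] PM[OF j(1)] i(2) j(2) by auto
    then show ?thesis using disj[OF i(1) j(1) False] by auto
  qed
qed

text \<open>The two parameter intervals left by one cut are joined at the base point: a component
  with a single underpass is a single arc.\<close>

lemma cut_into_punctured:
  assumes "rx \<noteq> 0" "ry \<noteq> 0" "t \<in> {0<..<1}"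
  shows "cut_into (path_image (rect cx rx ry k)) {rect cx rx ry k t}
    {path_image (rect cx rx ry k) - {rect cx rx ry k t}}"
proof -
  let ?g = "rect cx rx ry k"
  have "?g s = ?g t \<longleftrightarrow> s = t" if "s \<in> {0..1}" for s
  proof
    assume "?g s = ?g t"
    then have "s = t \<or> s = 0 \<and> t = 1 \<or> s = 1 \<and> t = 0"
      using assms that by (intro plane_rect_inj[of cx rx ry k]) simp_all
    then show "s = t" using assms(3) by auto
  qed simp
  then have "path_image ?g - {?g t} = ?g ` ({0..1} - {t})"
    unfolding path_image_def by auto
  also have "{0..1} - {t} = {0..<t} \<union> {t<..1}"
    using assms(3) by auto
  finally have eq: "path_image ?g - {?g t} = ?g ` ({0..<t} \<union> {t<..1})" .
  then have "connected (path_image ?g - {?g t})"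
    using connected_loop_complement[OF path_rect pathstart_rect, of t t] assms(3) by simp
  moreover have "0 \<in> {0..<t} \<union> {t<..1}" using assms(3) by simp
  then have "path_image ?g - {?g t} \<noteq> {}" unfolding eq by blast
  moreover have "closed (path_image ?g)"
    using path_rect by (rule closed_path_image)
  moreover have "?g t \<in> path_image ?g"
    using assms(3) by (simp add: path_image_def)
  ultimately show ?thesis
    by (auto simp: cut_into_def)
qed

text \<open>The linear form vanishes exactly at the two cut times. It is positive on the segment
  between them and negative on the rest, which is connected through the base point.\<close>

lemma cut_into_halves:
  assumes pos: "\<And>t. t \<in> {0..1} \<Longrightarrow> 0 < \<alpha> * (cx + rx * square_x t) + \<beta> * (ry * square_y t) \<longleftrightarrow> t1 < t \<and> t < t2"
    and neg: "\<And>t. t \<in> {0..1} \<Longrightarrow> \<alpha> * (cx + rx * square_x t) + \<beta> * (ry * square_y t) < 0 \<longleftrightarrow> t < t1 \<or> t2 < t"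
    and t: "0 < t1" "t1 < t2" "t2 < 1"
  shows "cut_into (path_image (rect cx rx ry k)) {rect cx rx ry k t1, rect cx rx ry k t2}
    {half_part \<alpha> \<beta> (rect cx rx ry k), half_part (- \<alpha>) (- \<beta>) (rect cx rx ry k)}"
proof -
  let ?g = "rect cx rx ry k"
  let ?f = "\<lambda>t. \<alpha> * (cx + rx * square_x t) + \<beta> * (ry * square_y t)"
  let ?h = "\<lambda>p. \<alpha> * Re (plane p) + \<beta> * Im (plane p)"
  let ?U = "{?g t1, ?g t2}"
  have h: "?h (?g t) = ?f t" for t
    by (simp add: plane_rect)
  have zero: "?f t = 0 \<longleftrightarrow> t = t1 \<or> t = t2" if "t \<in> {0..1}" for t
    using pos[OF that] neg[OF that] t by linarith
  have U: "p \<in> ?U \<longleftrightarrow> ?h p = 0" if p: "p \<in> path_image ?g" for p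
  proof -
    obtain t where t': "t \<in> {0..1}" "p = ?g t"
      using p unfolding path_image_def by auto
    have "?h (?g t1) = 0" "?h (?g t2) = 0"
      unfolding h using zero[of t1] zero[of t2] t by simp_all
    moreover have "?h p = 0 \<Longrightarrow> p \<in> ?U"
      using zero[OF t'(1)] unfolding t'(2) h by auto
    ultimately show ?thesis by auto
  qed
  have UM: "?U \<subseteq> path_image ?g"
    unfolding path_image_def using t by auto
  let ?A = "half_part \<alpha> \<beta> ?g" and ?B = "half_part (- \<alpha>) (- \<beta>) ?g"
  have A: "?A = {p \<in> path_image ?g. 0 \<le> ?h p} - ?U"
  proof (rule set_eqI)
    show "p \<in> ?A \<longleftrightarrow> p \<in> {p \<in> path_image ?g. 0 \<le> ?h p} - ?U" for p
    proof (cases "p \<in> path_image ?g")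
      case True
      show ?thesis
        unfolding half_part_def Diff_iff U[OF True]  mem_Collect_eq by auto
    qed (use UM in \<open>auto simp: half_part_def\<close>)
  qed
  have B: "?B = {p \<in> path_image ?g. 0 \<le> (- \<alpha>) * Re (plane p) + (- \<beta>) * Im (plane p)} - ?U"
  proof (rule set_eqI)
    show "p \<in> ?B \<longleftrightarrow> p \<in> {p \<in> path_image ?g. 0 \<le> (- \<alpha>) * Re (plane p) + (- \<beta>) * Im (plane p)} - ?U" for p
    proof (cases "p \<in> path_image ?g")
      case True
      show ?thesis
        unfolding half_part_def Diff_iff U[OF True]  mem_Collect_eq by auto
    qed (use UM in \<open>auto simp: half_part_def\<close>)
  qed
  have "{t \<in> {0..1}. 0 < ?f t} = {t1<..<t2}"
    using pos t by auto
  then have At: "?A = ?g ` {t1<..<t2}"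
    unfolding half_part_rect by simp
  have "{t \<in> {0..1}. 0 < (- \<alpha>) * (cx + rx * square_x t) + (- \<beta>) * (ry * square_y t)} = {t \<in> {0..1}. ?f t < 0}"
    by (rule Collect_cong) auto
  also have "\<dots> = {0..<t1} \<union> {t2<..1}"
    using neg t by auto
  finally have Bt: "?B = ?g ` ({0..<t1} \<union> {t2<..1})"
    unfolding half_part_rect by simp
  have "connected ?A" "connected ?B"
    unfolding At Bt using t connected_path_segment[OF path_rect]
      connected_loop_complement[OF path_rect pathstart_rect, of t1 t2] by simp_all
  moreover have "?A \<noteq> {}" "?B \<noteq> {}"
    unfolding At Bt using t by simp_all
  moreover have "?A \<union> ?B = path_image ?g - ?U"
  proof (rule set_eqI)
    show "p \<in> ?A \<union> ?B \<longleftrightarrow> p \<in> path_image ?g - ?U" for p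
    proof (cases "p \<in> path_image ?g")
      case True
      show ?thesis
        unfolding half_part_def Diff_iff U[OF True] Un_iff mem_Collect_eq by auto
    qed (use UM in \<open>auto simp: half_part_def\<close>)
  qed
  moreover have "?A \<inter> ?B = {}"
    unfolding half_part_def by auto
  moreover have "\<exists>K. closed K \<and> K \<subseteq> path_image ?g \<and> ?A = K - ?U"
    using compact_imp_closed[OF compact_closed_half[of cx rx ry k \<alpha> \<beta>]]
    by (intro exI[of _ "{p \<in> path_image ?g. 0 \<le> ?h p}"] conjI A Collect_restrict)
  moreover have "\<exists>K. closed K \<and> K \<subseteq> path_image ?g \<and> ?B = K - ?U"
    using compact_imp_closed[OF compact_closed_half[of cx rx ry k "- \<alpha>" "- \<beta>"]]
    by (intro exI[of _ "{p \<in> path_image ?g. 0 \<le> (- \<alpha>) * Re (plane p) + (- \<beta>) * Im (plane p)}"]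
        conjI B Collect_restrict)
  moreover have "{?A, ?B} = insert ?A {?B}" ..
  ultimately show ?thesis
    unfolding cut_into_def using UM by (simp add: Int_commute)
qed

section \<open>The torus link\<close>

text \<open>A wide and a tall rectangle, which cross at the four points with both coordinates 1 or
  -1. \<open>R2\<close> is flat, and the height of \<open>R1\<close> over (x, y) at these points is
  xy / 2, so the sign alternates.\<close>

abbreviation R1 where "R1 \<equiv> rect 0 2 1 1"
abbreviation R2 where "R2 \<equiv> rect 0 1 2 0"

text \<open>The crossings lie at one or three quarters of an edge, hence the odd sixteenths.\<close>

lemma torus_meet:
  assumes "s \<in> {0..1}" "t \<in> {0..1}" "\<epsilon> = 1 \<or> \<epsilon> = -1"
  shows "2 * square_x s = \<epsilon> * square_x t \<and> square_y s = 2 * square_y t \<longleftrightarrow>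
    (s, t) \<in> (if \<epsilon> = 1 then {(1/16, 15/16), (3/16, 5/16), (9/16, 7/16), (11/16, 13/16)}
      else {(1/16, 5/16), (3/16, 15/16), (9/16, 13/16), (11/16, 7/16)})"
  using assms(3)
proof
  assume "\<epsilon> = 1"
  then show ?thesis
    using assms(1,2) unfolding square_x_def square_y_def by (auto split: if_splits)
next
  assume "\<epsilon> = -1"
  then show ?thesis
    using assms(1,2) unfolding square_x_def square_y_def by (auto split: if_splits)
qed


text \<open>The time at which the rectangle with orientation \<open>\<epsilon>\<close> is where the one with orientation 1 is at
  time \<open>t\<close>.\<close>

definition oriented_time :: "real \<Rightarrow> real \<Rightarrow> real" where
  "oriented_time \<epsilon> t = (if \<epsilon> = 1 then t else reflect_time t)"

text \<open>Along \<^term>\<open>R1\<close> the over- and underpasses alternate, which makes the link \<open>T(2, 4)\<close>. Its components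
  may come in either order, so that the results also apply to reindexed links; the orientation of the second
  rectangle is \<open>\<epsilon>\<close>.\<close>

locale torus_link =
  fixes L :: link and i1 i2 :: nat and \<epsilon> :: real
  assumes len: "length L = 2"
    and idx: "i1 < 2" "i2 < 2" "i1 \<noteq> i2"
    and comp1: "L ! i1 = R1"
    and comp2: "L ! i2 = rect 0 \<epsilon> 2 0"
    and orient: "\<epsilon> = 1 \<or> \<epsilon> = -1"
begin

abbreviation \<tau> where "\<tau> \<equiv> oriented_time \<epsilon>"

lemma index_cases: "i < 2 \<Longrightarrow> i = i1 \<or> i = i2"
  using idx by linarith

lemma comp2_reversed: "path_image (rect 0 \<epsilon> 2 0) = path_image R2"
  "half_part \<alpha> \<beta> (rect 0 \<epsilon> 2 0) = half_part \<alpha> \<beta> R2"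
  using orient path_image_rect_reversed[of 0 1 2 0] half_part_reversed[of \<alpha> \<beta> 0 1 2 0] by auto

lemma comp2_at_times:
  "(L ! i2) (\<tau> (15/16)) = R2 (15/16)" "(L ! i2) (\<tau> (5/16)) = R2 (5/16)"
  "(L ! i2) (\<tau> (7/16)) = R2 (7/16)" "(L ! i2) (\<tau> (13/16)) = R2 (13/16)"
  using orient rect_reversed[of _ 0 1 2 0]
  by (auto simp: comp2 oriented_time_def reflect_time_def)

lemma no_self_crossing: "(i, s, i, t) \<notin> crossings L"
proof
  assume c: "(i, s, i, t) \<in> crossings L"
  then have i: "i = i1 \<or> i = i2" and st: "s \<in> {0..<1}" "t \<in> {0..<1}"
    and eq: "plane ((L ! i) s) = plane ((L ! i) t)" "height ((L ! i) t) \<noteq> height ((L ! i) s)"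
    using index_cases by (auto simp: crossings_def len)
  have "s = t \<or> s = 0 \<and> t = 1 \<or> s = 1 \<and> t = 0"
    using i
  proof
    assume "i = i1"
    then show ?thesis
      using eq(1) st by (intro plane_rect_inj[of 0 2 1 1]) (simp_all add: comp1)
  next
    assume "i = i2"
    then show ?thesis
      using eq(1) st orient by (intro plane_rect_inj[of 0 \<epsilon> 2 0]) (auto simp add: comp2)
  qed
  then show False using st eq(2) by auto
qed

lemma plane_eq_iff: "plane ((L ! i1) s) = plane ((L ! i2) t) \<longleftrightarrow>
    2 * square_x s = \<epsilon> * square_x t \<and> square_y s = 2 * square_y t"
  by (simp add: comp1 comp2 plane_rect)

lemma meet:
  assumes "s \<in> {0..1}" "t \<in> {0..1}"
  shows "plane ((L ! i1) s) = plane ((L ! i2) t) \<longleftrightarrow>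
    (s, t) \<in> {(1/16, \<tau> (15/16)), (3/16, \<tau> (5/16)), (9/16, \<tau> (7/16)), (11/16, \<tau> (13/16))}"
  unfolding plane_eq_iff torus_meet[OF assms orient] using orient
  by (auto simp: oriented_time_def reflect_time_def)

text \<open>The second rectangle lies at height 0, so the first one is on top exactly where its own
  height is positive.\<close>

lemma crossing12: "(i1, s, i2, t) \<in> crossings L \<longleftrightarrow> (s, t) \<in> {(1/16, \<tau> (15/16)), (9/16, \<tau> (7/16))}"
proof -
  have "(i1, s, i2, t) \<in> crossings L \<longleftrightarrow> s \<in> {0..<1} \<and> t \<in> {0..<1} \<and>
      plane ((L ! i1) s) = plane ((L ! i2) t) \<and> 0 < square_x s * square_y s"
    using idx by (auto simp: crossings_def len height_rect comp1 comp2)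
  also have "\<dots> \<longleftrightarrow> s \<in> {0..<1} \<and> t \<in> {0..<1} \<and>
      (s, t) \<in> {(1/16, \<tau> (15/16)), (3/16, \<tau> (5/16)), (9/16, \<tau> (7/16)), (11/16, \<tau> (13/16))} \<and>
      0 < square_x s * square_y s"
    using meet[of s t] by (cases "s \<in> {0..<1} \<and> t \<in> {0..<1}") auto
  also have "\<dots> \<longleftrightarrow> (s, t) \<in> {(1/16, \<tau> (15/16)), (9/16, \<tau> (7/16))}"
    by (auto simp: oriented_time_def reflect_time_def square_x_def square_y_def)
  finally show ?thesis .
qed

lemma crossing21: "(i2, s, i1, t) \<in> crossings L \<longleftrightarrow> (s, t) \<in> {(\<tau> (5/16), 3/16), (\<tau> (13/16), 11/16)}"
proof -
  have "(i2, s, i1, t) \<in> crossings L \<longleftrightarrow> s \<in> {0..<1} \<and> t \<in> {0..<1} \<and>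
      plane ((L ! i1) t) = plane ((L ! i2) s) \<and> square_x t * square_y t < 0"
    using idx by (auto simp: crossings_def len height_rect comp1 comp2)
  also have "\<dots> \<longleftrightarrow> s \<in> {0..<1} \<and> t \<in> {0..<1} \<and>
      (t, s) \<in> {(1/16, \<tau> (15/16)), (3/16, \<tau> (5/16)), (9/16, \<tau> (7/16)), (11/16, \<tau> (13/16))} \<and>
      square_x t * square_y t < 0"
    using meet[of t s] by (cases "s \<in> {0..<1} \<and> t \<in> {0..<1}") auto
  also have "\<dots> \<longleftrightarrow> (s, t) \<in> {(\<tau> (5/16), 3/16), (\<tau> (13/16), 11/16)}"
    by (auto simp: oriented_time_def reflect_time_def square_x_def square_y_def)
  finally show ?thesis .
qed

lemma crossings_eq: "crossings L = {(i1, 1/16, i2, \<tau> (15/16)), (i2, \<tau> (5/16), i1, 3/16),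
    (i1, 9/16, i2, \<tau> (7/16)), (i2, \<tau> (13/16), i1, 11/16)}"
proof (rule set_eqI)
  fix c :: crossing
  obtain i s j t where c: "c = (i, s, j, t)" by (cases c)
  show "c \<in> crossings L \<longleftrightarrow> c \<in> {(i1, 1/16, i2, \<tau> (15/16)), (i2, \<tau> (5/16), i1, 3/16),
    (i1, 9/16, i2, \<tau> (7/16)), (i2, \<tau> (13/16), i1, 11/16)}"
  proof (cases "i < 2 \<and> j < 2")
    case True
    then consider "i = j" | "i = i1" "j = i2" | "i = i2" "j = i1"
      using index_cases by blast
    then show ?thesis
    proof cases
      case 1
      then show ?thesis using no_self_crossing idx by (auto simp: c)
    next
      case 2
      then show ?thesis using crossing12[of s t] idx by (auto simp: c)
    next
      case 3
      then show ?thesis using crossing21[of s t] idx by (auto simp: c)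
    qed
  next
    case False
    then show ?thesis using idx by (auto simp: c crossings_def len)
  qed
qed

lemma times_regular: "\<tau> (15/16) \<in> {0<..<1} - {1/4, 1/2, 3/4}" "\<tau> (5/16) \<in> {0<..<1} - {1/4, 1/2, 3/4}"
  "\<tau> (7/16) \<in> {0<..<1} - {1/4, 1/2, 3/4}" "\<tau> (13/16) \<in> {0<..<1} - {1/4, 1/2, 3/4}"
  by (auto simp: oriented_time_def reflect_time_def)

lemma tangents:
  "vector_derivative (plane \<circ> L ! i1) (at (1/16)) = Complex 16 0"
  "vector_derivative (plane \<circ> L ! i1) (at (3/16)) = Complex 16 0"
  "vector_derivative (plane \<circ> L ! i1) (at (9/16)) = Complex (-16) 0"
  "vector_derivative (plane \<circ> L ! i1) (at (11/16)) = Complex (-16) 0"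
  "vector_derivative (plane \<circ> L ! i2) (at (\<tau> (15/16))) = Complex 0 (-16 * \<epsilon>)"
  "vector_derivative (plane \<circ> L ! i2) (at (\<tau> (5/16))) = Complex 0 (16 * \<epsilon>)"
  "vector_derivative (plane \<circ> L ! i2) (at (\<tau> (7/16))) = Complex 0 (16 * \<epsilon>)"
  "vector_derivative (plane \<circ> L ! i2) (at (\<tau> (13/16))) = Complex 0 (-16 * \<epsilon>)"
  unfolding comp1 comp2 using orient
  by (auto simp: vector_derivative_plane_rect edge_velocity_def oriented_time_def reflect_time_def)

lemma orient_nonzero: "\<epsilon> \<noteq> 0"
  using orient by auto

sublocale rect_link L
proof
  show "L \<noteq> []" using len by auto
  show "\<exists>cx rx ry k. rx \<noteq> 0 \<and> ry \<noteq> 0 \<and> L ! i = rect cx rx ry k" if "i < length L" for i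
  proof -
    have "i = i1 \<or> i = i2" using that index_cases len by simp
    then show ?thesis
    proof
      assume "i = i1"
      then show ?thesis using comp1 by (intro exI[of _ 0] exI[of _ 2] exI[of _ 1]) simp
    next
      assume "i = i2"
      then show ?thesis using comp2 orient by (intro exI[of _ 0] exI[of _ \<epsilon>] exI[of _ 2]) auto
    qed
  qed
  have height12: "height ((L ! i1) s) \<noteq> height ((L ! i2) t)"
    if "s \<in> {0..1}" "t \<in> {0..1}" "plane ((L ! i1) s) = plane ((L ! i2) t)" for s t
  proof -
    have "s \<in> {1/16, 3/16, 9/16, 11/16}"
      using that(3) unfolding meet[OF that(1,2)] by auto
    then show ?thesis
      by (auto simp: comp1 comp2 height_rect square_x_def square_y_def)
  qed
  show "height ((L ! i) s) \<noteq> height ((L ! j) t)"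
    if ij: "i < length L" "j < length L" "i \<noteq> j" and st: "s \<in> {0..1}" "t \<in> {0..1}"
      and eq: "plane ((L ! i) s) = plane ((L ! j) t)" for i j s t
  proof -
    consider "i = i1" "j = i2" | "i = i2" "j = i1"
      using ij index_cases len by auto
    then show ?thesis
    proof cases
      case 1
      then show ?thesis using height12[OF st] eq by simp
    next
      case 2
      then show ?thesis using height12[OF st(2,1)] eq by (simp add: eq_commute)
    qed
  qed
  show "plane ((L ! j) t) \<noteq> plane ((L ! l) u)"
    if "i < length L" "j < length L" "l < length L" "distinct [i, j, l]" for i j l t u
    using that len by auto
  show "finite (crossings L)" by (simp add: crossings_eq)
  show "s \<in> {0<..<1} - {1/4, 1/2, 3/4} \<and> t \<in> {0<..<1} - {1/4, 1/2, 3/4}"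
    if "(i, s, j, t) \<in> crossings L" for i s j t
    using that times_regular unfolding crossings_eq by auto
  show "side (over_tangent L c) (under_tangent L c) \<noteq> 0" if "c \<in> crossings L" for c
    using that orient_nonzero unfolding crossings_eq by (auto simp: tangents side_def)
qed


section \<open>Arcs of the torus link and their roles at the crossings\<close>

abbreviation "P \<equiv> half_part 1 1 R1"
abbreviation "Q \<equiv> half_part (- 1) (- 1) R1"
abbreviation "R \<equiv> half_part (- 1) 1 R2"
abbreviation "S \<equiv> half_part 1 (- 1) R2"

text \<open>The underpassing points of \<open>R1\<close> are (1, -1) and (-1, 1), on the line x + y
  = 0; those of \<open>R2\<close> are (1, 1) and (-1, -1), on the line x = y.\<close>

lemma cut_R1: "cut_into (path_image R1) {R1 (3/16), R1 (11/16)} {P, Q}"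
  by (rule cut_into_halves) (auto simp: square_x_def square_y_def)

lemma cut_R2: "cut_into (path_image R2) {R2 (7/16), R2 (15/16)} {R, S}"
proof -
  have "cut_into (path_image R2) {R2 (7/16), R2 (15/16)} {R, half_part (- (- 1)) (- 1) R2}"
    by (rule cut_into_halves) (auto simp: square_x_def square_y_def)
  then show ?thesis by simp
qed

lemma arcs_eq: "arcs L = {P, Q, R, S}"
proof -
  define U where "U i = (if i = i1 then {R1 (3/16), R1 (11/16)} else {R2 (7/16), R2 (15/16)})" for i
  define A where "A i = (if i = i1 then {P, Q} else {R, S})" for i
  have two: "{..<length L} = {i1, i2}"
    using idx index_cases by (auto simp: len)
  have "arcs L = (\<Union>i<length L. A i)"
  proof (rule arcs_cut_into[OF is_link])
    show "cut_into (path_image (L ! i)) (U i) (A i)" if "i < length L" for i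
    proof -
      have "i = i1 \<or> i = i2" using that two by auto
      then show ?thesis
        using idx(3) cut_R1 cut_R2 by (auto simp: U_def A_def comp1 comp2 comp2_reversed)
    qed
    show "under_point L ` crossings L = (\<Union>i<length L. U i)"
      unfolding two crossings_eq using idx(3)
      by (simp add: U_def comp2_at_times, simp add: comp1 insert_commute)
  qed
  then show ?thesis
    unfolding two using idx(3) by (auto simp: A_def)
qed

lemma arc_in: "P \<in> arcs L" "Q \<in> arcs L" "R \<in> arcs L" "S \<in> arcs L"
  by (simp_all add: arcs_eq)

lemma arc_nonempty: "a \<in> arcs L \<Longrightarrow> a \<noteq> {}"
  unfolding arcs_def by (rule in_components_nonempty)

lemma arc_index: "arc_index L P = i1" "arc_index L Q = i1" "arc_index L R = i2" "arc_index L S = i2"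
  using idx arc_nonempty[OF arc_in(1)] arc_nonempty[OF arc_in(2)] arc_nonempty[OF arc_in(3)]
    arc_nonempty[OF arc_in(4)]
  by (auto intro!: arc_index_eqI[OF is_link] simp: len comp1 comp2 comp2_reversed)
     (auto simp: half_part_def)

lemma over_arcs:
  "over_arc L (i1, 1/16, i2, \<tau> (15/16)) = Q"
  "over_arc L (i2, \<tau> (5/16), i1, 3/16) = S"
  "over_arc L (i1, 9/16, i2, \<tau> (7/16)) = P"
  "over_arc L (i2, \<tau> (13/16), i1, 11/16) = R"
proof -
  note simps = half_part_def path_image_def plane_rect square_x_def square_y_def
  show "over_arc L (i1, 1/16, i2, \<tau> (15/16)) = Q"
    by (rule over_arc_eqI[OF arc_in(2)]) (simp add: comp1 simps)
  show "over_arc L (i2, \<tau> (5/16), i1, 3/16) = S"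
    by (rule over_arc_eqI[OF arc_in(4)]) (simp add: comp2_at_times, simp add: simps)
  show "over_arc L (i1, 9/16, i2, \<tau> (7/16)) = P"
    by (rule over_arc_eqI[OF arc_in(1)]) (simp add: comp1 simps)
  show "over_arc L (i2, \<tau> (13/16), i1, 11/16) = R"
    by (rule over_arc_eqI[OF arc_in(3)]) (simp add: comp2_at_times, simp add: simps)
qed

lemma eventually_comp2:
  assumes "t \<in> {0<..<1} - {1/4, 1/2, 3/4}"
    and "\<alpha> * Re (plane ((L ! i2) t)) + \<beta> * Im (plane ((L ! i2) t)) = 0"
  shows "\<alpha> * Re (edge_velocity \<epsilon> 2 t) + \<beta> * Im (edge_velocity \<epsilon> 2 t) < 0 \<Longrightarrow>
        \<forall>\<^sub>F x in at_left t. (L ! i2) x \<in> half_part \<alpha> \<beta> R2"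
    and "\<alpha> * Re (edge_velocity \<epsilon> 2 t) + \<beta> * Im (edge_velocity \<epsilon> 2 t) > 0 \<Longrightarrow>
        \<forall>\<^sub>F x in at_right t. (L ! i2) x \<in> half_part \<alpha> \<beta> R2"
  using eventually_half_part[OF assms(1), of \<alpha> 0 \<epsilon> 2 0 \<beta>] assms(2)
  unfolding comp2 comp2_reversed by simp_all


lemma velocities:
  "edge_velocity 2 1 (3/16) = Complex 16 0"
  "edge_velocity 2 1 (11/16) = Complex (- 16) 0"
  "edge_velocity \<epsilon> 2 (\<tau> (15/16)) = Complex 0 (- 16 * \<epsilon>)"
  "edge_velocity \<epsilon> 2 (\<tau> (7/16)) = Complex 0 (16 * \<epsilon>)"
  using orient by (auto simp: edge_velocity_def oriented_time_def reflect_time_def)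

lemma positions:
  "plane ((L ! i1) (3/16)) = Complex 1 (- 1)" "plane ((L ! i1) (11/16)) = Complex (- 1) 1"
  "plane ((L ! i2) (\<tau> (15/16))) = Complex (- 1) (- 1)" "plane ((L ! i2) (\<tau> (7/16))) = Complex 1 1"
  unfolding comp2_at_times unfolding comp1
  by (simp_all add: plane_rect square_x_def square_y_def)

lemma eventually_comp1:
  assumes "t \<in> {0<..<1} - {1/4, 1/2, 3/4}"
    and "\<alpha> * Re (plane ((L ! i1) t)) + \<beta> * Im (plane ((L ! i1) t)) = 0"
  shows "\<alpha> * Re (edge_velocity 2 1 t) + \<beta> * Im (edge_velocity 2 1 t) < 0 \<Longrightarrow>
        \<forall>\<^sub>F x in at_left t. (L ! i1) x \<in> half_part \<alpha> \<beta> R1"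
    and "\<alpha> * Re (edge_velocity 2 1 t) + \<beta> * Im (edge_velocity 2 1 t) > 0 \<Longrightarrow>
        \<forall>\<^sub>F x in at_right t. (L ! i1) x \<in> half_part \<alpha> \<beta> R1"
  using eventually_half_part[OF assms(1), of \<alpha> 0 2 1 1 \<beta>] assms(2)
  unfolding comp1 by simp_all

text \<open>Reversing the underpass exchanges before and after as well as the side it comes from, so
  the arcs to the right and left of the overpass remain the same.\<close>

lemma under_arcs1:
  assumes c: "c = (i1, 1/16, i2, \<tau> (15/16))"
  shows "right_arc L c = S \<and> left_arc L c = R"
proof (cases "0 < \<epsilon>")
  case pos: True
  have ev: "\<forall>\<^sub>F x in at_left (\<tau> (15/16)). (L ! i2) x \<in> R" "\<forall>\<^sub>F x in at_right (\<tau> (15/16)). (L ! i2) x \<in> S"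
    by (rule eventually_comp2[OF times_regular(1)]; simp add: positions velocities pos)+
  show ?thesis
    unfolding c using under_arcs_rightwards[OF comp2 times_regular(1) arc_in(3) ev(1) arc_in(4) ev(2), of i1 "1/16"]
    by (simp add: tangents velocities side_def pos)
next
  case False
  then have neg: "\<epsilon> < 0" using orient_nonzero by simp
  have ev: "\<forall>\<^sub>F x in at_left (\<tau> (15/16)). (L ! i2) x \<in> S" "\<forall>\<^sub>F x in at_right (\<tau> (15/16)). (L ! i2) x \<in> R"
    by (rule eventually_comp2[OF times_regular(1)]; simp add: positions velocities neg)+
  show ?thesis
    unfolding c using under_arcs_leftwards[OF comp2 times_regular(1) arc_in(4) ev(1) arc_in(3) ev(2), of i1 "1/16"]
    by (simp add: tangents velocities side_def neg)
qed

lemma under_arcs3: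
  assumes c: "c = (i1, 9/16, i2, \<tau> (7/16))"
  shows "right_arc L c = R \<and> left_arc L c = S"
proof (cases "0 < \<epsilon>")
  case pos: True
  have ev: "\<forall>\<^sub>F x in at_left (\<tau> (7/16)). (L ! i2) x \<in> S" "\<forall>\<^sub>F x in at_right (\<tau> (7/16)). (L ! i2) x \<in> R"
    by (rule eventually_comp2[OF times_regular(3)]; simp add: positions velocities pos)+
  show ?thesis
    unfolding c using under_arcs_rightwards[OF comp2 times_regular(3) arc_in(4) ev(1) arc_in(3) ev(2), of i1 "9/16"]
    by (simp add: tangents velocities side_def pos)
next
  case False
  then have neg: "\<epsilon> < 0" using orient_nonzero by simp
  have ev: "\<forall>\<^sub>F x in at_left (\<tau> (7/16)). (L ! i2) x \<in> R" "\<forall>\<^sub>F x in at_right (\<tau> (7/16)). (L ! i2) x \<in> S"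
    by (rule eventually_comp2[OF times_regular(3)]; simp add: positions velocities neg)+
  show ?thesis
    unfolding c using under_arcs_leftwards[OF comp2 times_regular(3) arc_in(3) ev(1) arc_in(4) ev(2), of i1 "9/16"]
    by (simp add: tangents velocities side_def neg)
qed

text \<open>Here the component of variable orientation passes over, so right and left are swapped
  with \<epsilon>.\<close>

lemma under_arcs2:
  assumes c: "c = (i2, \<tau> (5/16), i1, 3/16)"
  shows "right_arc L c = (if \<epsilon> = 1 then P else Q) \<and> left_arc L c = (if \<epsilon> = 1 then Q else P)"
proof -
  have t: "3/16 \<in> {0<..<1::real} - {1/4, 1/2, 3/4}" by simp
  have ev: "\<forall>\<^sub>F x in at_left (3/16). (L ! i1) x \<in> Q" "\<forall>\<^sub>F x in at_right (3/16). (L ! i1) x \<in> P"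
    by (rule eventually_comp1[OF t]; simp add: positions velocities)+
  show ?thesis
    unfolding c using orient under_arcs_rightwards[OF comp1 t arc_in(2) ev(1) arc_in(1) ev(2), of i2 "\<tau> (5/16)"]
      under_arcs_leftwards[OF comp1 t arc_in(2) ev(1) arc_in(1) ev(2), of i2 "\<tau> (5/16)"]
    by (auto simp: tangents velocities side_def)
qed

lemma under_arcs4:
  assumes c: "c = (i2, \<tau> (13/16), i1, 11/16)"
  shows "right_arc L c = (if \<epsilon> = 1 then Q else P) \<and> left_arc L c = (if \<epsilon> = 1 then P else Q)"
proof -
  have t: "11/16 \<in> {0<..<1::real} - {1/4, 1/2, 3/4}" by simp
  have ev: "\<forall>\<^sub>F x in at_left (11/16). (L ! i1) x \<in> P" "\<forall>\<^sub>F x in at_right (11/16). (L ! i1) x \<in> Q"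
    by (rule eventually_comp1[OF t]; simp add: positions velocities)+
  show ?thesis
    unfolding c using orient under_arcs_rightwards[OF comp1 t arc_in(1) ev(1) arc_in(2) ev(2), of i2 "\<tau> (13/16)"]
      under_arcs_leftwards[OF comp1 t arc_in(1) ev(1) arc_in(2) ev(2), of i2 "\<tau> (13/16)"]
    by (auto simp: tangents velocities side_def)
qed


text \<open>From here on the link is just this table of four crossings.\<close>

lemma crossing_cases:
  assumes "c \<in> crossings L"
  obtains "over_arc L c = Q" "right_arc L c = S" "left_arc L c = R"
  | "over_arc L c = S" "right_arc L c = (if \<epsilon> = 1 then P else Q)" "left_arc L c = (if \<epsilon> = 1 then Q else P)"
  | "over_arc L c = P" "right_arc L c = R" "left_arc L c = S"
  | "over_arc L c = R" "right_arc L c = (if \<epsilon> = 1 then Q else P)" "left_arc L c = (if \<epsilon> = 1 then P else Q)"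
proof -
  consider "c = (i1, 1/16, i2, \<tau> (15/16))" | "c = (i2, \<tau> (5/16), i1, 3/16)"
    | "c = (i1, 9/16, i2, \<tau> (7/16))" | "c = (i2, \<tau> (13/16), i1, 11/16)"
    using assms unfolding crossings_eq by auto
  then show ?thesis
  proof cases
    case 1
    show ?thesis using that(1) under_arcs1[OF 1] over_arcs(1)[folded 1] by simp
  next
    case 2
    show ?thesis using that(2) under_arcs2[OF 2] over_arcs(2)[folded 2] by simp
  next
    case 3
    show ?thesis using that(3) under_arcs3[OF 3] over_arcs(3)[folded 3] by simp
  next
    case 4
    show ?thesis using that(4) under_arcs4[OF 4] over_arcs(4)[folded 4] by simp
  qed
qed

lemma crossing_exists:
  "\<exists>c\<in>crossings L. over_arc L c = Q \<and> right_arc L c = S \<and> left_arc L c = R"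
  "\<exists>c\<in>crossings L. over_arc L c = S \<and> right_arc L c = (if \<epsilon> = 1 then P else Q) \<and>
    left_arc L c = (if \<epsilon> = 1 then Q else P)"
  "\<exists>c\<in>crossings L. over_arc L c = P \<and> right_arc L c = R \<and> left_arc L c = S"
  "\<exists>c\<in>crossings L. over_arc L c = R \<and> right_arc L c = (if \<epsilon> = 1 then Q else P) \<and>
    left_arc L c = (if \<epsilon> = 1 then P else Q)"
  unfolding crossings_eq
  using under_arcs1[OF HOL.refl] under_arcs2[OF HOL.refl] under_arcs3[OF HOL.refl] under_arcs4[OF HOL.refl] over_arcs
  by simp_all

lemma distinct_arcs: "distinct [P, Q, R, S]"
proof -
  have "arc_index L P \<noteq> arc_index L R" "arc_index L P \<noteq> arc_index L S"
    "arc_index L Q \<noteq> arc_index L R" "arc_index L Q \<noteq> arc_index L S"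
    using idx by (simp_all add: arc_index)
  moreover have "P \<inter> Q = {}" "R \<inter> S = {}"
    by (auto simp: half_part_def)
  moreover have "P \<noteq> {}" "R \<noteq> {}" using arc_nonempty arc_in by blast+
  ultimately show ?thesis by auto
qed

sublocale link_diagram L
proof
  show "finite (crossings L)" by (rule finite)
  show "finite (arcs L)" by (simp add: arcs_eq)
  fix c assume c: "c \<in> crossings L"
  show "over_arc L c \<in> arcs L" "right_arc L c \<in> arcs L" "left_arc L c \<in> arcs L"
    using c by (rule crossing_cases; simp add: arc_in)+
  show "arc_index L (right_arc L c) = arc_index L (left_arc L c)"
    using c by (rule crossing_cases) (simp_all add: arc_index)
next
  fix a assume "a \<in> arcs L"
  then show "arc_index L a < length L"
    using idx by (auto simp: arcs_eq arc_index len)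
qed

end

section \<open>Reversal on the relations of the torus link\<close>

lemma reversal_map_rho_crossing:
  "reversal_map L j (rho_crossing L c) b =
    (let u = (\<lambda>a. if arc_index L a = j then - tinv j else 1) in
     invert_var j (1 - tvar (arc_index L (right_arc L c))) * u (over_arc L c) * basis_vec (over_arc L c) b +
     invert_var j (tvar (arc_index L (over_arc L c))) * u (right_arc L c) * basis_vec (right_arc L c) b -
     u (left_arc L c) * basis_vec (left_arc L c) b)"
proof -
  define u where "u a = (if arc_index L a = j then - tinv j else 1)" for a
  have "invert_var j (basis_vec a b) = basis_vec a b" "basis_vec a b * u b = u a * basis_vec a b" for a
    by (simp_all add: basis_vec_def)
  then have "reversal_map L j (rho_crossing L c) b =
     invert_var j (1 - tvar (arc_index L (right_arc L c))) * u (over_arc L c) * basis_vec (over_arc L c) b +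
     invert_var j (tvar (arc_index L (over_arc L c))) * u (right_arc L c) * basis_vec (right_arc L c) b -
     u (left_arc L c) * basis_vec (left_arc L c) b"
    unfolding reversal_map_def rho_crossing_def u_def[symmetric]
    by (simp only: invert_var_simps distrib_right left_diff_distrib mult.assoc)
  then show ?thesis
    unfolding Let_def u_def .
qed

context torus_link
begin

text \<open>Every relation goes to \<open>- tinv i2\<close> times the relation of the corresponding
  crossing. Where the reversed component passes over, this unit moves the coefficient
  \<open>tvar i2\<close> from one underpassing arc to the other, which matches the exchange of right
  and left.\<close>

lemma reversed_crossing:
  assumes "torus_link L' i1 i2 (- \<epsilon>)" "c \<in> crossings L" and index: "arc_index L = arc_index L'"
  shows "reversal_map L i2 (rho_crossing L c) \<in> rho_image L'"
proof -
  interpret L': torus_link L' i1 i2 "- \<epsilon>" by fact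
  have "\<exists>c'\<in>crossings L'. \<forall>b. reversal_map L i2 (rho_crossing L c) b = - tinv i2 * rho_crossing L' c' b"
    using assms(2)
  proof (cases rule: crossing_cases)
    case 1
    obtain c' where "c' \<in> crossings L'" "over_arc L' c' = Q" "right_arc L' c' = S" "left_arc L' c' = R"
      using L'.crossing_exists(1) by auto
    then show ?thesis
      using 1 idx(3) by (intro bexI[of _ c'] allI, unfold reversal_map_rho_crossing)
        (simp_all add: Let_def rho_crossing_def arc_index L'.arc_index algebra_simps)
  next
    case 2
    obtain c' where "c' \<in> crossings L'" "over_arc L' c' = S" "right_arc L' c' = left_arc L c" "left_arc L' c' = right_arc L c"
      using L'.crossing_exists(2) orient 2 by auto
    then show ?thesis
      using 2 idx(3) orient by (intro bexI[of _ c'] allI, unfold reversal_map_rho_crossing)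
        (auto simp: Let_def rho_crossing_def arc_index L'.arc_index algebra_simps)
  next
    case 3
    obtain c' where "c' \<in> crossings L'" "over_arc L' c' = P" "right_arc L' c' = R" "left_arc L' c' = S"
      using L'.crossing_exists(3) by auto
    then show ?thesis
      using 3 idx(3) by (intro bexI[of _ c'] allI, unfold reversal_map_rho_crossing)
        (simp_all add: Let_def rho_crossing_def arc_index L'.arc_index algebra_simps)
  next
    case 4
    obtain c' where "c' \<in> crossings L'" "over_arc L' c' = R" "right_arc L' c' = left_arc L c" "left_arc L' c' = right_arc L c"
      using L'.crossing_exists(4) orient 4 by auto
    then show ?thesis
      using 4 idx(3) orient by (intro bexI[of _ c'] allI, unfold reversal_map_rho_crossing)
        (auto simp: Let_def rho_crossing_def arc_index L'.arc_index algebra_simps)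
  qed
  then obtain c' where c': "c' \<in> crossings L'"
    and eq: "reversal_map L i2 (rho_crossing L c) = (\<lambda>b. - tinv i2 * rho_crossing L' c' b)"
    by (auto simp: fun_eq_iff)
  show ?thesis
    unfolding eq using L'.rho_crossing_in_rho_image[OF c'] idx
    by (intro L'.rho_image_smult) (simp_all add: L'.len)
qed

lemma path_images: "i < 2 \<Longrightarrow> path_image (L ! i) = (if i = i1 then path_image R1 else path_image R2)"
  using index_cases[of i] idx(3) by (auto simp: comp1 comp2 comp2_reversed)

end

lemma torus_reversed_pair:
  assumes L: "torus_link L i1 i2 \<epsilon>" and L': "torus_link L' i1 i2 (- \<epsilon>)"
  shows "reversed_pair L L' i2"
proof -
  interpret L: torus_link L i1 i2 \<epsilon> by fact
  interpret L': torus_link L' i1 i2 "- \<epsilon>" by fact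
  \<comment> \<open>The index of an arc depends on the images of the components only, and reversal
    keeps these.\<close>
  have index: "arc_index L = arc_index L'"
    unfolding arc_index_def L.len L'.len using L.path_images L'.path_images
    by (intro ext arg_cong[where f = The]) auto
  then have map: "reversal_map L i2 = reversal_map L' i2"
    by (simp add: reversal_map_def fun_eq_iff)
  show ?thesis
  proof
    show "length L = length L'" "i2 < length L" using L.len L'.len L.idx by simp_all
    show "arcs L = arcs L'" by (simp add: L.arcs_eq L'.arcs_eq)
    show "arc_index L = arc_index L'" by fact
    show "reversal_map L i2 (rho_crossing L c) \<in> rho_image L'" if "c \<in> crossings L" for c
      using L.reversed_crossing[OF L' that index] .
    show "reversal_map L i2 (rho_crossing L' c) \<in> rho_image L" if "c \<in> crossings L'" for c
      unfolding map using L'.reversed_crossing[OF _ that index[symmetric]] L by simp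
  qed
qed

section \<open>Functionals on the two torus modules\<close>

context torus_link
begin

text \<open>The relations have rank 3 in four unknowns, since t_1 + t_2 becomes 2i, which is
  nonzero. Real and imaginary parts turn them into linear equations over the reals.\<close>

lemma arc_weights_constant:
  assumes "\<epsilon> = -1" "arc_weights L w"
  shows "\<exists>A. \<forall>a\<in>arcs L. w a = A"
proof -
  have relation: "w l = (1 - \<i>) * w v + \<i> * w r"
    if "\<exists>c\<in>crossings L. over_arc L c = v \<and> right_arc L c = r \<and> left_arc L c = l" for v r l
    using assms(2) that by (auto simp: arc_weights_def)
  have eqs: "w R = (1 - \<i>) * w Q + \<i> * w S" "w P = (1 - \<i>) * w S + \<i> * w Q"
    "w S = (1 - \<i>) * w P + \<i> * w R" "w Q = (1 - \<i>) * w R + \<i> * w P"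
    using relation[OF crossing_exists(1)] relation[OF crossing_exists(2)]
      relation[OF crossing_exists(3)] relation[OF crossing_exists(4)] assms(1) by simp_all
  note re_im = eqs[unfolded complex_eq_iff, simplified]
  have "Re (w P) = Re (w Q)" "Im (w P) = Im (w Q)" "Re (w R) = Re (w Q)" "Im (w R) = Im (w Q)"
    "Re (w S) = Re (w Q)" "Im (w S) = Im (w Q)"
    using re_im by linarith+
  then have "w P = w Q" "w R = w Q" "w S = w Q"
    by (simp_all add: complex_eq_iff)
  then show ?thesis
    by (intro exI[of _ "w Q"]) (simp add: arcs_eq)
qed

text \<open>Two relations determine the weights of \<open>Q\<close> and \<open>R\<close> from those
  of \<open>P\<close> and \<open>S\<close>; the other two then hold because 1 + t_1 t_2 becomes
  0.\<close>

lemma arc_weights_exist: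
  assumes "\<epsilon> = 1"
  shows "\<exists>w. arc_weights L w \<and> w P = \<alpha> \<and> w S = \<beta>"
proof -
  \<comment> \<open>The value at \<open>Q\<close> is the relation with overpass \<open>S\<close>;
    the value at \<open>R\<close> is the relation with overpass \<open>P\<close>, solved for its
    right arc.\<close>
  define w where "w a = (if a = P then \<alpha> else if a = S then \<beta>
    else if a = Q then (1 - \<i>) * \<beta> + \<i> * \<alpha> else (1 + \<i>) * \<alpha> - \<i> * \<beta>)" for a
  have w: "w P = \<alpha>" "w S = \<beta>" "w Q = (1 - \<i>) * \<beta> + \<i> * \<alpha>" "w R = (1 + \<i>) * \<alpha> - \<i> * \<beta>"
    using distinct_arcs by (simp_all add: w_def eq_commute)
  have "arc_weights L w"
    unfolding arc_weights_def
  proof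
    fix c assume "c \<in> crossings L"
    then show "w (left_arc L c) = (1 - \<i>) * w (over_arc L c) + \<i> * w (right_arc L c)"
      by (cases rule: crossing_cases) (simp_all add: assms w algebra_simps)
  qed
  then show ?thesis using w(1,2) by (intro exI[of _ w]) simp
qed

text \<open>The indices in \<open>K\<close> and in \<open>L\<close> are arbitrary and unrelated, so
  a single statement covers all reindexings of both links.\<close>

lemma not_equivalent_to_reversed:
  assumes "\<epsilon> = 1" "torus_link K j1 j2 (- 1)"
  shows "\<not> link_sequences_equivalent K L"
proof -
  interpret K: torus_link K j1 j2 "- 1" by fact
  obtain w1 where w1: "arc_weights L w1" "w1 P = 1" "w1 S = 0"
    using arc_weights_exist[OF assms(1), of 1 0] by auto
  obtain w2 where w2: "arc_weights L w2" "w2 P = 0" "w2 S = 1"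
    using arc_weights_exist[OF assms(1), of 0 1] by auto
  show ?thesis
    by (rule not_link_sequences_equivalent[OF K.link_diagram_axioms link_diagram_axioms
          K.arc_weights_constant[OF HOL.refl] w1(1) w2(1) arc_in(1,4) w1(2,3) w2(2,3)])
qed

end

lemma torus_link_reindexing:
  assumes "\<epsilon> = 1 \<or> \<epsilon> = -1" "reindexing K [R1, rect 0 \<epsilon> 2 0]"
  shows "\<exists>i1 i2. torus_link K i1 i2 \<epsilon>"
proof -
  have K: "mset K = mset [R1, rect 0 \<epsilon> 2 0]"
    using assms(2) by (simp add: reindexing_def)
  then have "length K = 2"
    using mset_eq_length[OF K] by simp
  then obtain g h where gh: "K = [g, h]"
    by (auto simp: length_Suc_conv numeral_2_eq_2)
  then have "{g, h} = {R1, rect 0 \<epsilon> 2 0}"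
    using mset_eq_setD[OF K] by simp
  then consider "g = R1" "h = rect 0 \<epsilon> 2 0" | "g = rect 0 \<epsilon> 2 0" "h = R1"
    unfolding doubleton_eq_iff by auto
  then show ?thesis
  proof cases
    case 1
    then have "torus_link K 0 1 \<epsilon>"
      using assms(1) by (simp add: torus_link_def gh)
    then show ?thesis by (intro exI)
  next
    case 2
    then have "torus_link K 1 0 \<epsilon>"
      using assms(1) by (simp add: torus_link_def gh)
    then show ?thesis by (intro exI)
  qed
qed

lemma total_quandles_do_not_determine_sequences:
  "\<exists>L L'. is_link L \<and> regular_projection L \<and> is_link L' \<and> regular_projection L' \<and>
     length L = length L' \<and>
     quandle_isomorphic (total_alexander_quandle L) (total_alexander_quandle L') \<and>
     (\<forall>K K'. reindexing K L \<longrightarrow> reindexing K' L' \<longrightarrow> \<not> link_sequences_equivalent K K')"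
proof -
  let ?L = "[R1, rect 0 (- 1) 2 0]" and ?L' = "[R1, rect 0 1 2 0]"
  have L: "torus_link ?L 0 1 (- 1)" and L': "torus_link ?L' 0 1 1"
    by unfold_locales simp_all
  interpret L: torus_link ?L 0 1 "- 1" by (rule L)
  interpret L': torus_link ?L' 0 1 1 by (rule L')
  interpret pair: reversed_pair ?L ?L' 1
    by (rule torus_reversed_pair[OF L]) (simp only: minus_minus L')
  show ?thesis
  proof (rule exI[of _ ?L], rule exI[of _ ?L'], intro conjI allI impI)
    fix K K' assume K: "reindexing K ?L" and K': "reindexing K' ?L'"
    obtain i1 i2 where i: "torus_link K i1 i2 (- 1)"
      using torus_link_reindexing[OF _ K] by auto
    obtain j1 j2 where j: "torus_link K' j1 j2 1"
      using torus_link_reindexing[OF _ K'] by auto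
    show "\<not> link_sequences_equivalent K K'"
      by (rule torus_link.not_equivalent_to_reversed[OF j HOL.refl i])
  qed (rule L.is_link L.regular_projection L'.is_link L'.regular_projection
      pair.same_length pair.total_alexander_quandle_isomorphic)+
qed

section \<open>The chain\<close>

text \<open>The outer rings meet the sides x = -3 and x = 3 of the flat ring \<open>B0\<close> at y
  = -1/2 and y = 1/2 and are too far apart to meet each other. Each passes once over and once under
  \<open>B0\<close>, which hooks it in.\<close>

abbreviation A0 where "A0 \<equiv> rect (- (5/2)) 1 (1/2) 1"
abbreviation B0 where "B0 \<equiv> rect 0 3 1 0"
abbreviation C0 where "C0 \<equiv> rect (5/2) 1 (1/2) 1"

lemma chain_meet_left:
  assumes "s \<in> {0..1}" "t \<in> {0..1}"
  shows "plane (A0 s) = plane (B0 t) \<longleftrightarrow> (s, t) \<in> {(1/16, 15/16), (11/16, 13/16)}"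
  using assms unfolding plane_rect complex.inject square_x_def square_y_def by (auto split: if_splits)

lemma chain_meet_right:
  assumes "s \<in> {0..1}" "t \<in> {0..1}" "\<epsilon> = 1 \<or> \<epsilon> = -1"
  shows "plane (rect (5/2) \<epsilon> (1/2) \<epsilon> s) = plane (B0 t) \<longleftrightarrow>
    (s, t) \<in> {(oriented_time \<epsilon> (3/16), 5/16), (oriented_time \<epsilon> (9/16), 7/16)}"
  using assms(3)
proof
  assume "\<epsilon> = 1"
  then show ?thesis
    using assms(1,2) unfolding plane_rect complex.inject square_x_def square_y_def oriented_time_def
    by (auto split: if_splits)
next
  assume "\<epsilon> = -1"
  then show ?thesis
    using assms(1,2) unfolding plane_rect complex.inject square_x_def square_y_def oriented_time_def reflect_time_def
    by (auto split: if_splits)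
qed

lemma square_x_bound: "t \<in> {0..1} \<Longrightarrow> \<bar>square_x t\<bar> \<le> 1"
  by (auto simp: square_x_def)

text \<open>In the third component \<open>rx\<close> and \<open>k\<close> change sign together, so
  by \<open>rect_reversed\<close> the value \<epsilon> = -1 gives \<open>C0\<close> run
  backwards.\<close>

locale chain_link =
  fixes L :: link and \<epsilon> :: real
  assumes L_eq: "L = [A0, B0, rect (5/2) \<epsilon> (1/2) \<epsilon>]"
    and orient: "\<epsilon> = 1 \<or> \<epsilon> = -1"
begin

abbreviation \<tau> where "\<tau> \<equiv> oriented_time \<epsilon>"

lemma orient_nonzero: "\<epsilon> \<noteq> 0"
  using orient by auto

lemma components:
  "length L = 3" "L ! 0 = A0" "L ! Suc 0 = B0" "L ! 2 = rect (5/2) \<epsilon> (1/2) \<epsilon>"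
  by (simp_all add: L_eq)

lemma index_cases: "i < length L \<Longrightarrow> i = 0 \<or> i = 1 \<or> i = 2"
  by (auto simp: L_eq)

lemma rect_form: "i < length L \<Longrightarrow> \<exists>cx rx ry k. rx \<noteq> 0 \<and> ry \<noteq> 0 \<and> L ! i = rect cx rx ry k"
proof -
  assume "i < length L"
  then consider "i = 0" | "i = 1" | "i = 2" using index_cases by blast
  then show ?thesis
  proof cases
    case 1
    show ?thesis
      by (rule exI[of _ "- (5/2)"], rule exI[of _ 1], rule exI[of _ "1/2"], rule exI[of _ 1]) (simp add: 1 components)
  next
    case 2
    show ?thesis
      by (rule exI[of _ 0], rule exI[of _ 3], rule exI[of _ 1], rule exI[of _ 0]) (simp add: 2 components)
  next
    case 3
    show ?thesis
      by (rule exI[of _ "5/2"], rule exI[of _ \<epsilon>], rule exI[of _ "1/2"], rule exI[of _ \<epsilon>])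
         (simp add: 3 components orient_nonzero)
  qed
qed

lemma comp2_reversed: "path_image (rect (5/2) \<epsilon> (1/2) \<epsilon>) = path_image C0"
  using orient path_image_rect_reversed[of "5/2" 1 "1/2" 1] by auto

lemma comp2_at_times:
  "(L ! 2) (\<tau> (3/16)) = C0 (3/16)" "(L ! 2) (\<tau> (9/16)) = C0 (9/16)"
  using orient rect_reversed[of _ "5/2" 1 "1/2" 1]
  by (auto simp: components oriented_time_def reflect_time_def)

lemma times_regular: "\<tau> (3/16) \<in> {0<..<1} - {1/4, 1/2, 3/4}" "\<tau> (9/16) \<in> {0<..<1} - {1/4, 1/2, 3/4}"
  by (auto simp: oriented_time_def reflect_time_def)

lemma outer_disjoint:
  assumes "s \<in> {0..1}" "t \<in> {0..1}"
  shows "plane ((L ! 0) s) \<noteq> plane ((L ! 2) t)"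
  using square_x_bound[OF assms(1)] square_x_bound[OF assms(2)] orient
  by (auto simp: components plane_rect)

lemma height2: "height ((L ! 2) (\<tau> (3/16))) = - 1/2" "height ((L ! 2) (\<tau> (9/16))) = 1/2"
  unfolding comp2_at_times by (simp_all add: height_rect square_x_def square_y_def)

lemma no_self_crossing: "(i, s, i, t) \<notin> crossings L"
proof
  assume c: "(i, s, i, t) \<in> crossings L"
  then have i: "i < length L" and st: "s \<in> {0..<1}" "t \<in> {0..<1}"
    and eq: "plane ((L ! i) s) = plane ((L ! i) t)" "height ((L ! i) t) \<noteq> height ((L ! i) s)"
    by (auto simp: crossings_def)
  obtain cx rx ry k where *: "rx \<noteq> 0" "ry \<noteq> 0" "L ! i = rect cx rx ry k"
    using rect_form[OF i] by auto
  have "s = t \<or> s = 0 \<and> t = 1 \<or> s = 1 \<and> t = 0"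
    using eq(1) st * by (intro plane_rect_inj[of cx rx ry k]) simp_all
  then show False using st eq(2) by auto
qed

lemma crossing_iff:
  "(i, s, j, t) \<in> crossings L \<longleftrightarrow> i < 3 \<and> j < 3 \<and> s \<in> {0..<1} \<and> t \<in> {0..<1} \<and>
     plane ((L ! i) s) = plane ((L ! j) t) \<and> height ((L ! j) t) < height ((L ! i) s)"
  by (simp add: crossings_def components)

lemma meet_left: "s \<in> {0..1} \<Longrightarrow> t \<in> {0..1} \<Longrightarrow>
    plane ((L ! 0) s) = plane ((L ! Suc 0) t) \<longleftrightarrow> (s, t) \<in> {(1/16, 15/16), (11/16, 13/16)}"
  unfolding components by (rule chain_meet_left)

lemma meet_right: "s \<in> {0..1} \<Longrightarrow> t \<in> {0..1} \<Longrightarrow>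
    plane ((L ! 2) s) = plane ((L ! Suc 0) t) \<longleftrightarrow> (s, t) \<in> {(\<tau> (3/16), 5/16), (\<tau> (9/16), 7/16)}"
  unfolding components using orient by (intro chain_meet_right)

lemma crossing01: "(0, s, 1, t) \<in> crossings L \<longleftrightarrow> (s, t) = (1/16, 15/16)"
proof -
  have "(0, s, 1, t) \<in> crossings L \<longleftrightarrow> s \<in> {0..<1} \<and> t \<in> {0..<1} \<and> plane ((L ! 0) s) = plane ((L ! Suc 0) t) \<and> 0 < height ((L ! 0) s)"
    by (auto simp: crossing_iff components(1,3) height_rect)
  also have "\<dots> \<longleftrightarrow> s \<in> {0..<1} \<and> t \<in> {0..<1} \<and> (s, t) \<in> {(1/16, 15/16), (11/16, 13/16)} \<and> 0 < height ((L ! 0) s)"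
    by (intro conj_cong HOL.refl meet_left[of s t]) simp_all
  also have "\<dots> \<longleftrightarrow> (s, t) = (1/16, 15/16)"
    by (auto simp: components(2) height_rect square_x_def square_y_def)
  finally show ?thesis .
qed

lemma crossing10: "(1, s, 0, t) \<in> crossings L \<longleftrightarrow> (s, t) = (13/16, 11/16)"
proof -
  have "(1, s, 0, t) \<in> crossings L \<longleftrightarrow> s \<in> {0..<1} \<and> t \<in> {0..<1} \<and> plane ((L ! 0) t) = plane ((L ! Suc 0) s) \<and> height ((L ! 0) t) < 0"
    by (auto simp: crossing_iff components(1,3) height_rect)
  also have "\<dots> \<longleftrightarrow> s \<in> {0..<1} \<and> t \<in> {0..<1} \<and> (t, s) \<in> {(1/16, 15/16), (11/16, 13/16)} \<and> height ((L ! 0) t) < 0"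
    by (intro conj_cong HOL.refl meet_left[of t s]) simp_all
  also have "\<dots> \<longleftrightarrow> (s, t) = (13/16, 11/16)"
    by (auto simp: components(2) height_rect square_x_def square_y_def)
  finally show ?thesis .
qed

lemma crossing21: "(2, s, 1, t) \<in> crossings L \<longleftrightarrow> (s, t) = (\<tau> (9/16), 7/16)"
proof -
  have "(2, s, 1, t) \<in> crossings L \<longleftrightarrow> s \<in> {0..<1} \<and> t \<in> {0..<1} \<and> plane ((L ! 2) s) = plane ((L ! Suc 0) t) \<and> 0 < height ((L ! 2) s)"
    by (auto simp: crossing_iff components(1,3) height_rect)
  also have "\<dots> \<longleftrightarrow> s \<in> {0..<1} \<and> t \<in> {0..<1} \<and> (s, t) \<in> {(\<tau> (3/16), 5/16), (\<tau> (9/16), 7/16)} \<and> 0 < height ((L ! 2) s)"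
    by (intro conj_cong HOL.refl meet_right[of s t]) simp_all
  also have "\<dots> \<longleftrightarrow> (s, t) = (\<tau> (9/16), 7/16)"
    using times_regular height2 by auto
  finally show ?thesis .
qed

lemma crossing12: "(1, s, 2, t) \<in> crossings L \<longleftrightarrow> (s, t) = (5/16, \<tau> (3/16))"
proof -
  have "(1, s, 2, t) \<in> crossings L \<longleftrightarrow> s \<in> {0..<1} \<and> t \<in> {0..<1} \<and> plane ((L ! 2) t) = plane ((L ! Suc 0) s) \<and> height ((L ! 2) t) < 0"
    by (auto simp: crossing_iff components(1,3) height_rect)
  also have "\<dots> \<longleftrightarrow> s \<in> {0..<1} \<and> t \<in> {0..<1} \<and> (t, s) \<in> {(\<tau> (3/16), 5/16), (\<tau> (9/16), 7/16)} \<and> height ((L ! 2) t) < 0"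
    by (intro conj_cong HOL.refl meet_right[of t s]) simp_all
  also have "\<dots> \<longleftrightarrow> (s, t) = (5/16, \<tau> (3/16))"
    using times_regular height2 by auto
  finally show ?thesis .
qed

lemma crossing_outer: "(0, s, 2, t) \<notin> crossings L" "(2, s, 0, t) \<notin> crossings L"
  using outer_disjoint[of s t] outer_disjoint[of t s] by (auto simp: crossing_iff)

lemma crossings_eq: "crossings L = {(0, 1/16, 1, 15/16), (1, 13/16, 0, 11/16),
    (2, \<tau> (9/16), 1, 7/16), (1, 5/16, 2, \<tau> (3/16))}"
proof (rule set_eqI)
  fix c :: crossing
  obtain i s j t where c: "c = (i, s, j, t)" by (cases c)
  show "c \<in> crossings L \<longleftrightarrow> c \<in> {(0, 1/16, 1, 15/16), (1, 13/16, 0, 11/16),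
    (2, \<tau> (9/16), 1, 7/16), (1, 5/16, 2, \<tau> (3/16))}"
  proof (cases "i < length L \<and> j < length L")
    case True
    then have "i = 0 \<or> i = 1 \<or> i = 2" "j = 0 \<or> j = 1 \<or> j = 2"
      using index_cases by blast+
    then consider "i = j" | "i = 0" "j = 1" | "i = 1" "j = 0" | "i = 2" "j = 1" | "i = 1" "j = 2"
      | "i = 0" "j = 2" | "i = 2" "j = 0"
      by auto
    then show ?thesis
    proof cases
      case 1
      then show ?thesis using no_self_crossing by (auto simp: c)
    next
      case 2
      then show ?thesis using crossing01[of s t] by (auto simp: c)
    next
      case 3
      then show ?thesis using crossing10[of s t] by (auto simp: c)
    next
      case 4
      then show ?thesis using crossing21[of s t] by (auto simp: c)
    next
      case 5
      then show ?thesis using crossing12[of s t] by (auto simp: c)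
    next
      case 6
      then show ?thesis using crossing_outer(1)[of s t] by (auto simp: c)
    next
      case 7
      then show ?thesis using crossing_outer(2)[of s t] by (auto simp: c)
    qed
  next
    case False
    then show ?thesis by (auto simp: c crossings_def components)
  qed
qed

lemma tangents:
  "vector_derivative (plane \<circ> L ! 0) (at (1/16)) = Complex 8 0"
  "vector_derivative (plane \<circ> L ! 0) (at (11/16)) = Complex (- 8) 0"
  "vector_derivative (plane \<circ> L ! Suc 0) (at (15/16)) = Complex 0 (- 8)"
  "vector_derivative (plane \<circ> L ! Suc 0) (at (13/16)) = Complex 0 (- 8)"
  "vector_derivative (plane \<circ> L ! Suc 0) (at (7/16)) = Complex 0 8"
  "vector_derivative (plane \<circ> L ! Suc 0) (at (5/16)) = Complex 0 8"
  "vector_derivative (plane \<circ> L ! 2) (at (\<tau> (9/16))) = Complex (- 8 * \<epsilon>) 0"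
  "vector_derivative (plane \<circ> L ! 2) (at (\<tau> (3/16))) = Complex (8 * \<epsilon>) 0"
  unfolding components using orient
  by (auto simp: vector_derivative_plane_rect edge_velocity_def oriented_time_def reflect_time_def)

sublocale rect_link L
proof
  show "L \<noteq> []" by (simp add: L_eq)
  show "\<exists>cx rx ry k. rx \<noteq> 0 \<and> ry \<noteq> 0 \<and> L ! i = rect cx rx ry k" if "i < length L" for i
    using that by (rule rect_form)
  have height01: "height ((L ! 0) s) \<noteq> height ((L ! Suc 0) t)"
    if "s \<in> {0..1}" "t \<in> {0..1}" "plane ((L ! 0) s) = plane ((L ! Suc 0) t)" for s t
  proof -
    have "s = 1/16 \<or> s = 11/16"
      using that meet_left[of s t] by auto
    then have "height ((L ! 0) s) \<noteq> 0"
      by (auto simp: components(2) height_rect square_x_def square_y_def)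
    then show ?thesis by (simp add: components(3) height_rect)
  qed
  have height21: "height ((L ! 2) s) \<noteq> height ((L ! Suc 0) t)"
    if "s \<in> {0..1}" "t \<in> {0..1}" "plane ((L ! 2) s) = plane ((L ! Suc 0) t)" for s t
  proof -
    have "s = \<tau> (3/16) \<or> s = \<tau> (9/16)"
      using that meet_right[of s t] by auto
    then have "height ((L ! 2) s) \<noteq> 0" using height2 by auto
    then show ?thesis by (simp add: components(3) height_rect)
  qed
  show "height ((L ! i) s) \<noteq> height ((L ! j) t)"
    if ij: "i < length L" "j < length L" "i \<noteq> j" and st: "s \<in> {0..1}" "t \<in> {0..1}"
      and eq: "plane ((L ! i) s) = plane ((L ! j) t)" for i j s t
  proof -
    have "i = 0 \<or> i = 1 \<or> i = 2" "j = 0 \<or> j = 1 \<or> j = 2"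
      using ij index_cases by blast+
    then consider "i = 0" "j = 1" | "i = 1" "j = 0" | "i = 2" "j = 1" | "i = 1" "j = 2"
      | "i = 0" "j = 2" | "i = 2" "j = 0"
      using ij(3) by auto
    then show ?thesis
    proof cases
      case 1
      then show ?thesis using height01[OF st] eq by simp
    next
      case 2
      then have "plane ((L ! 0) t) = plane ((L ! Suc 0) s)" using eq by simp
      from height01[OF st(2,1) this, symmetric] 2 show ?thesis by simp
    next
      case 3
      then show ?thesis using height21[OF st] eq by simp
    next
      case 4
      then have "plane ((L ! 2) t) = plane ((L ! Suc 0) s)" using eq by simp
      from height21[OF st(2,1) this, symmetric] 4 show ?thesis by simp
    next
      case 5
      then show ?thesis using outer_disjoint[OF st] eq by simp
    next
      case 6
      then show ?thesis using outer_disjoint[OF st(2,1)] eq by simp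
    qed
  qed
  show "plane ((L ! j) t) \<noteq> plane ((L ! l) u)"
    if ijl: "i < length L" "j < length L" "l < length L" "distinct [i, j, l]"
      and stu: "s \<in> {0..1}" "t \<in> {0..1}" "u \<in> {0..1}" and eq: "plane ((L ! i) s) = plane ((L ! j) t)"
    for i j l s t u
  proof
    assume eq': "plane ((L ! j) t) = plane ((L ! l) u)"
    have "i = 0 \<or> i = 1 \<or> i = 2" "j = 0 \<or> j = 1 \<or> j = 2" "l = 0 \<or> l = 1 \<or> l = 2"
      using ijl index_cases by blast+
    then consider "i = 0" "j = 2" | "i = 2" "j = 0" | "j = 0" "l = 2" | "j = 2" "l = 0" | "i = 0" "l = 2" | "i = 2" "l = 0"
      using ijl(4) by auto
    then show False
    proof cases
      case 1
      then show ?thesis using outer_disjoint[OF stu(1,2)] eq by simp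
    next
      case 2
      then show ?thesis using outer_disjoint[OF stu(2,1)] eq by simp
    next
      case 3
      then show ?thesis using outer_disjoint[OF stu(2,3)] eq' by simp
    next
      case 4
      then show ?thesis using outer_disjoint[OF stu(3,2)] eq' by simp
    next
      case 5
      then show ?thesis using outer_disjoint[OF stu(1,3)] eq eq' by simp
    next
      case 6
      then show ?thesis using outer_disjoint[OF stu(3,1)] eq eq' by simp
    qed
  qed
  show "finite (crossings L)" unfolding crossings_eq by (intro finite.intros)
  show "s \<in> {0<..<1} - {1/4, 1/2, 3/4} \<and> t \<in> {0<..<1} - {1/4, 1/2, 3/4}"
    if c: "(i, s, j, t) \<in> crossings L" for i s j t
  proof -
    consider "s = 1/16" "t = 15/16" | "s = 13/16" "t = 11/16" | "s = \<tau> (9/16)" "t = 7/16" | "s = 5/16" "t = \<tau> (3/16)"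
      using c unfolding crossings_eq by blast
    then show ?thesis by cases (use times_regular in simp_all)
  qed
  show "side (over_tangent L c) (under_tangent L c) \<noteq> 0" if c: "c \<in> crossings L" for c
  proof -
    consider "c = (0, 1/16, 1, 15/16)" | "c = (1, 13/16, 0, 11/16)"
      | "c = (2, \<tau> (9/16), 1, 7/16)" | "c = (1, 5/16, 2, \<tau> (3/16))"
      using c unfolding crossings_eq by blast
    then show ?thesis by cases (simp_all add: tangents side_def orient_nonzero)
  qed
qed

end

section \<open>Arcs of the chain and their roles at the crossings\<close>

context chain_link
begin

abbreviation "Arc_A \<equiv> path_image A0 - {A0 (11/16)}"
abbreviation "Arc_C \<equiv> path_image C0 - {C0 (3/16)}"
abbreviation "Upper \<equiv> half_part (- 1) 6 B0"
abbreviation "Lower \<equiv> half_part 1 (- 6) B0"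

text \<open>The underpassing points of \<open>B0\<close> are (-3, -1/2) and (3, 1/2), on the line x
  = 6y; hence the coefficients -1 and 6.\<close>

lemma cut_B0: "cut_into (path_image B0) {B0 (7/16), B0 (15/16)} {Upper, Lower}"
proof -
  have "cut_into (path_image B0) {B0 (7/16), B0 (15/16)} {Upper, half_part (- (- 1)) (- 6) B0}"
    by (rule cut_into_halves) (auto simp: square_x_def square_y_def)
  then show ?thesis by simp
qed

lemma arcs_eq: "arcs L = {Arc_A, Upper, Lower, Arc_C}"
proof -
  define U where "U i = (if i = 0 then {A0 (11/16)} else if i = 1 then {B0 (7/16), B0 (15/16)} else {C0 (3/16)})" for i :: nat
  define P where "P i = (if i = 0 then {Arc_A} else if i = 1 then {Upper, Lower} else {Arc_C})" for i :: nat
  have three: "{..<length L} = {0, 1, 2}"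
    by (auto simp: components)
  have "arcs L = (\<Union>i<length L. P i)"
  proof (rule arcs_cut_into[OF is_link])
    show "cut_into (path_image (L ! i)) (U i) (P i)" if i: "i < length L" for i
    proof -
      consider "i = 0" | "i = 1" | "i = 2" using index_cases[OF i] by auto
      then show ?thesis
      proof cases
        case 1
        then show ?thesis
          using cut_into_punctured[of 1 "1/2" "11/16" "- (5/2)" 1] by (simp add: U_def P_def components)
      next
        case 2
        then show ?thesis using cut_B0 by (simp add: U_def P_def components)
      next
        case 3
        then show ?thesis
          using cut_into_punctured[of 1 "1/2" "3/16" "5/2" 1] by (simp add: U_def P_def components comp2_reversed)
      qed
    qed
    show "under_point L ` crossings L = (\<Union>i<length L. U i)"
    proof -
      have "under_point L ` crossings L = {B0 (15/16), A0 (11/16), B0 (7/16), C0 (3/16)}"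
        unfolding crossings_eq image_insert image_empty under_point.simps comp2_at_times
        unfolding One_nat_def components ..
      then show ?thesis
        unfolding three U_def by auto
    qed
  qed
  then show ?thesis
    unfolding three P_def by simp
qed

lemma arc_in: "Arc_A \<in> arcs L" "Upper \<in> arcs L" "Lower \<in> arcs L" "Arc_C \<in> arcs L"
  by (simp_all add: arcs_eq)

lemma arc_nonempty: "a \<in> arcs L \<Longrightarrow> a \<noteq> {}"
  unfolding arcs_def by (rule in_components_nonempty)

lemma arc_index: "arc_index L Arc_A = 0" "arc_index L Upper = 1" "arc_index L Lower = 1" "arc_index L Arc_C = 2"
proof -
  note eqI = arc_index_eqI[OF is_link _ _ arc_nonempty]
  show "arc_index L Arc_A = 0"
    by (rule eqI[OF _ _ arc_in(1)]) (simp_all add: components)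
  show "arc_index L Upper = 1"
    by (rule eqI[OF _ _ arc_in(2)]) (simp_all add: components half_part_def)
  show "arc_index L Lower = 1"
    by (rule eqI[OF _ _ arc_in(3)]) (simp_all add: components half_part_def)
  show "arc_index L Arc_C = 2"
    by (rule eqI[OF _ _ arc_in(4)]) (simp_all add: components comp2_reversed)
qed

lemma over_arcs:
  "over_arc L (0, 1/16, 1, 15/16) = Arc_A"
  "over_arc L (1, 13/16, 0, 11/16) = Upper"
  "over_arc L (2, \<tau> (9/16), 1, 7/16) = Arc_C"
  "over_arc L (1, 5/16, 2, \<tau> (3/16)) = Lower"
proof -
  have "plane (A0 (1/16)) \<noteq> plane (A0 (11/16))" "plane (C0 (9/16)) \<noteq> plane (C0 (3/16))"
    by (simp_all add: plane_rect square_x_def square_y_def)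
  then have neq: "A0 (1/16) \<noteq> A0 (11/16)" "C0 (9/16) \<noteq> C0 (3/16)" by auto
  show "over_arc L (0, 1/16, 1, 15/16) = Arc_A"
    by (rule over_arc_eqI[OF arc_in(1)]) (use neq(1) in \<open>simp add: components path_image_def\<close>)
  show "over_arc L (2, \<tau> (9/16), 1, 7/16) = Arc_C"
    by (rule over_arc_eqI[OF arc_in(4)]) (use neq(2) in \<open>simp add: comp2_at_times path_image_def\<close>)
  note simps = half_part_def path_image_def plane_rect square_x_def square_y_def
  show "over_arc L (1, 13/16, 0, 11/16) = Upper"
    by (rule over_arc_eqI[OF arc_in(2)]) (simp add: components, simp add: simps)
  show "over_arc L (1, 5/16, 2, \<tau> (3/16)) = Lower"
    by (rule over_arc_eqI[OF arc_in(3)]) (simp add: components, simp add: simps)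
qed

lemma velocities:
  "edge_velocity 1 (1/2) (11/16) = Complex (- 8) 0"
  "edge_velocity 3 1 (15/16) = Complex 0 (- 8)"
  "edge_velocity 3 1 (7/16) = Complex 0 8"
  "edge_velocity \<epsilon> (1/2) (\<tau> (3/16)) = Complex (8 * \<epsilon>) 0"
  using orient by (auto simp: edge_velocity_def oriented_time_def reflect_time_def)

lemma eventually_B0:
  "\<forall>\<^sub>F x in at_left (15/16). (L ! 1) x \<in> Upper" "\<forall>\<^sub>F x in at_right (15/16). (L ! 1) x \<in> Lower"
  "\<forall>\<^sub>F x in at_left (7/16). (L ! 1) x \<in> Lower" "\<forall>\<^sub>F x in at_right (7/16). (L ! 1) x \<in> Upper"
proof -
  have "plane (B0 (15/16)) = Complex (- 3) (- 1/2)" "plane (B0 (7/16)) = Complex 3 (1/2)"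
    by (simp_all add: plane_rect square_x_def square_y_def)
  note simps = this velocities
  have B: "L ! 1 = B0" by (simp add: components)
  show "\<forall>\<^sub>F x in at_left (15/16). (L ! 1) x \<in> Upper"
    unfolding B by (rule eventually_half_part_left; simp add: simps)
  show "\<forall>\<^sub>F x in at_right (15/16). (L ! 1) x \<in> Lower"
    unfolding B by (rule eventually_half_part_right; simp add: simps)
  show "\<forall>\<^sub>F x in at_left (7/16). (L ! 1) x \<in> Lower"
    unfolding B by (rule eventually_half_part_left; simp add: simps)
  show "\<forall>\<^sub>F x in at_right (7/16). (L ! 1) x \<in> Upper"
    unfolding B by (rule eventually_half_part_right; simp add: simps)
qed

lemma under_arcs1:
  assumes c: "c = (0, 1/16, 1, 15/16)"
  shows "right_arc L c = Lower \<and> left_arc L c = Upper"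
proof -
  have B: "L ! 1 = B0" by (simp add: components)
  have t: "15/16 \<in> {0<..<1::real} - {1/4, 1/2, 3/4}" by simp
  show ?thesis
    unfolding c using under_arcs_rightwards[OF B t arc_in(2) eventually_B0(1) arc_in(3) eventually_B0(2), of 0 "1/16"]
    by (simp add: tangents velocities side_def)
qed

lemma under_arcs3:
  assumes c: "c = (2, \<tau> (9/16), 1, 7/16)"
  shows "right_arc L c = (if \<epsilon> = 1 then Upper else Lower) \<and> left_arc L c = (if \<epsilon> = 1 then Lower else Upper)"
proof -
  have B: "L ! 1 = B0" by (simp add: components)
  have t: "7/16 \<in> {0<..<1::real} - {1/4, 1/2, 3/4}" by simp
  show ?thesis
    unfolding c using orient under_arcs_rightwards[OF B t arc_in(3) eventually_B0(3) arc_in(2) eventually_B0(4), of 2 "\<tau> (9/16)"]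
      under_arcs_leftwards[OF B t arc_in(3) eventually_B0(3) arc_in(2) eventually_B0(4), of 2 "\<tau> (9/16)"]
    by (auto simp: tangents velocities side_def)
qed

text \<open>A single underpass does not separate the outer ring, so the same arc lies on both sides
  of the overpass.\<close>

lemma under_arcs2:
  assumes c: "c = (1, 13/16, 0, 11/16)"
  shows "right_arc L c = Arc_A \<and> left_arc L c = Arc_A"
proof -
  have A: "L ! 0 = A0" by (simp add: components)
  have t: "11/16 \<in> {0<..<1::real} - {1/4, 1/2, 3/4}" by simp
  have "\<forall>\<^sub>F x in at (11/16). (L ! 0) x \<in> Arc_A"
    unfolding A by (rule eventually_punctured[OF t]) simp_all
  then have ev: "\<forall>\<^sub>F x in at_left (11/16). (L ! 0) x \<in> Arc_A" "\<forall>\<^sub>F x in at_right (11/16). (L ! 0) x \<in> Arc_A"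
    by (simp_all only: eventually_at_split)
  show ?thesis
    unfolding c using under_arcs_rightwards[OF A t arc_in(1) ev(1) arc_in(1) ev(2), of 1 "13/16"]
    by (simp add: tangents velocities side_def)
qed

lemma under_arcs4:
  assumes c: "c = (1, 5/16, 2, \<tau> (3/16))"
  shows "right_arc L c = Arc_C \<and> left_arc L c = Arc_C"
proof -
  have eq: "path_image (L ! 2) - {(L ! 2) (\<tau> (3/16))} = Arc_C"
    unfolding comp2_at_times(1) by (simp add: components comp2_reversed)
  have "\<forall>\<^sub>F x in at (\<tau> (3/16)). (L ! 2) x \<in> Arc_C"
    unfolding eq[symmetric] unfolding components(4)
    by (rule eventually_punctured[OF times_regular(1)]) (simp_all add: orient_nonzero)
  then have ev: "\<forall>\<^sub>F x in at_left (\<tau> (3/16)). (L ! 2) x \<in> Arc_C" "\<forall>\<^sub>F x in at_right (\<tau> (3/16)). (L ! 2) x \<in> Arc_C"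
    by (simp_all only: eventually_at_split)
  show ?thesis
    unfolding c using orient
      under_arcs_rightwards[OF components(4) times_regular(1) arc_in(4) ev(1) arc_in(4) ev(2), of 1 "5/16"]
      under_arcs_leftwards[OF components(4) times_regular(1) arc_in(4) ev(1) arc_in(4) ev(2), of 1 "5/16"]
    by (auto simp: tangents velocities side_def)
qed

lemma crossing_cases:
  assumes "c \<in> crossings L"
  obtains "over_arc L c = Arc_A" "right_arc L c = Lower" "left_arc L c = Upper"
  | "over_arc L c = Upper" "right_arc L c = Arc_A" "left_arc L c = Arc_A"
  | "over_arc L c = Arc_C" "right_arc L c = (if \<epsilon> = 1 then Upper else Lower)"
      "left_arc L c = (if \<epsilon> = 1 then Lower else Upper)"
  | "over_arc L c = Lower" "right_arc L c = Arc_C" "left_arc L c = Arc_C"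
proof -
  consider "c = (0, 1/16, 1, 15/16)" | "c = (1, 13/16, 0, 11/16)"
    | "c = (2, \<tau> (9/16), 1, 7/16)" | "c = (1, 5/16, 2, \<tau> (3/16))"
    using assms unfolding crossings_eq by blast
  then show ?thesis
  proof cases
    case 1
    show ?thesis using that(1) under_arcs1[OF 1] over_arcs(1)[folded 1] by simp
  next
    case 2
    show ?thesis using that(2) under_arcs2[OF 2] over_arcs(2)[folded 2] by simp
  next
    case 3
    show ?thesis using that(3) under_arcs3[OF 3] over_arcs(3)[folded 3] by simp
  next
    case 4
    show ?thesis using that(4) under_arcs4[OF 4] over_arcs(4)[folded 4] by simp
  qed
qed

lemma crossing_exists:
  "\<exists>c\<in>crossings L. over_arc L c = Arc_A \<and> right_arc L c = Lower \<and> left_arc L c = Upper"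
  "\<exists>c\<in>crossings L. over_arc L c = Upper \<and> right_arc L c = Arc_A \<and> left_arc L c = Arc_A"
  "\<exists>c\<in>crossings L. over_arc L c = Arc_C \<and> right_arc L c = (if \<epsilon> = 1 then Upper else Lower) \<and>
    left_arc L c = (if \<epsilon> = 1 then Lower else Upper)"
  "\<exists>c\<in>crossings L. over_arc L c = Lower \<and> right_arc L c = Arc_C \<and> left_arc L c = Arc_C"
  unfolding crossings_eq bex_simps
  using under_arcs1[OF HOL.refl] under_arcs2[OF HOL.refl] under_arcs3[OF HOL.refl] under_arcs4[OF HOL.refl] over_arcs
  by blast+

sublocale link_diagram L
proof
  show "finite (crossings L)" by (rule finite)
  show "finite (arcs L)" by (simp add: arcs_eq)
  fix c assume c: "c \<in> crossings L"
  show "over_arc L c \<in> arcs L" "right_arc L c \<in> arcs L" "left_arc L c \<in> arcs L"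
    using c by (rule crossing_cases; simp add: arc_in)+
  show "arc_index L (right_arc L c) = arc_index L (left_arc L c)"
    using c by (rule crossing_cases) (simp_all add: arc_index)
next
  fix a assume "a \<in> arcs L"
  then consider "a = Arc_A" | "a = Upper" | "a = Lower" | "a = Arc_C"
    unfolding arcs_eq by blast
  then show "arc_index L a < length L"
    by cases (simp_all add: arc_index components(1))
qed

lemma path_images: "i < 3 \<Longrightarrow>
    path_image (L ! i) = (if i = 0 then path_image A0 else if i = 1 then path_image B0 else path_image C0)"
proof -
  assume "i < 3"
  then consider "i = 0" | "i = 1" | "i = 2" by linarith
  then show ?thesis by cases (simp_all add: components comp2_reversed)
qed

end

section \<open>Equality of the Alexander quandles of the two chains\<close>

lemma chain_rho_crossing_in:
  assumes L: "chain_link L \<epsilon>" and L': "chain_link L' (- \<epsilon>)" and c: "c \<in> crossings L"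
  shows "rho_crossing L c \<in> rho_image L'"
proof -
  interpret L: chain_link L \<epsilon> by (rule L)
  interpret L': chain_link L' "- \<epsilon>" by (rule L')
  \<comment> \<open>Three crossings have the same relation in both chains; only at the one under C
    are the underpassing arcs swapped.\<close>
  have same: "rho_crossing L c = rho_crossing L' c'"
    if "over_arc L' c' = over_arc L c" "right_arc L' c' = right_arc L c" "left_arc L' c' = left_arc L c"
      "arc_index L' (right_arc L c) = arc_index L (right_arc L c)"
      "arc_index L' (over_arc L c) = arc_index L (over_arc L c)" for c'
    unfolding rho_crossing_def using that by simp
  show ?thesis
    using c
  proof (cases rule: L.crossing_cases)
    case 1
    obtain c' where c': "c' \<in> crossings L'" "over_arc L' c' = L.Arc_A" "right_arc L' c' = L.Lower" "left_arc L' c' = L.Upper"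
      using L'.crossing_exists(1) by blast
    have "rho_crossing L c = rho_crossing L' c'"
      by (rule same) (simp_all only: c' 1 L.arc_index L'.arc_index)
    then show ?thesis using L'.rho_crossing_in_rho_image[OF c'(1)] by simp
  next
    case 2
    obtain c' where c': "c' \<in> crossings L'" "over_arc L' c' = L.Upper" "right_arc L' c' = L.Arc_A" "left_arc L' c' = L.Arc_A"
      using L'.crossing_exists(2) by blast
    have "rho_crossing L c = rho_crossing L' c'"
      by (rule same) (simp_all only: c' 2 L.arc_index L'.arc_index)
    then show ?thesis using L'.rho_crossing_in_rho_image[OF c'(1)] by simp
  next
    case 4
    obtain c' where c': "c' \<in> crossings L'" "over_arc L' c' = L.Lower" "right_arc L' c' = L.Arc_C" "left_arc L' c' = L.Arc_C"
      using L'.crossing_exists(4) by blast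
    have "rho_crossing L c = rho_crossing L' c'"
      by (rule same) (simp_all only: c' 4 L.arc_index L'.arc_index)
    then show ?thesis using L'.rho_crossing_in_rho_image[OF c'(1)] by simp
  next
    case 3
    obtain c' where c': "c' \<in> crossings L'" "over_arc L' c' = L.Arc_C" "right_arc L' c' = left_arc L c" "left_arc L' c' = right_arc L c"
      using L'.crossing_exists(3) L.orient 3 by auto
    obtain d where d: "d \<in> crossings L'" "over_arc L' d = L.Lower" "right_arc L' d = L.Arc_C" "left_arc L' d = L.Arc_C"
      using L'.crossing_exists(4) by blast
    \<comment> \<open>The relations at \<open>c'\<close> and \<open>d\<close> add up to
      \<open>Lower - Upper\<close> if \<epsilon> = 1 and to \<open>tvar 2\<close> times
      \<open>Upper - Lower\<close> otherwise. The unit \<open>s\<close> gives this difference the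
      coefficient with which it enters the relation at \<open>c\<close>.\<close>
    define s where "s = (if \<epsilon> = 1 then tvar 2 else tinv 2)"
    \<comment> \<open>modulo the relation at \<open>d\<close>, both relations at the reversed crossing say that \<open>Upper = Lower\<close>\<close>
    have "rho_crossing L c = (\<lambda>b. - rho_crossing L' d b - s * (rho_crossing L' c' b + rho_crossing L' d b))"
      unfolding rho_crossing_def fun_eq_iff c' d 3 s_def L.arc_index L'.arc_index
      using L.orient by (auto simp: L.arc_index L'.arc_index algebra_simps)
    moreover have "s \<in> Lambda (length L')"
      unfolding s_def by (simp add: L'.components)
    ultimately show ?thesis
      using L'.rho_crossing_in_rho_image[OF c'(1)] L'.rho_crossing_in_rho_image[OF d(1)]
      by (simp add: L'.rho_image_diff L'.rho_image_uminus L'.rho_image_smult L'.rho_image_add)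
  qed
qed

lemma chain_fundamental_alexander_quandles_eq:
  assumes L: "chain_link L \<epsilon>" and L': "chain_link L' (- \<epsilon>)"
  shows "fundamental_alexander_quandle L = fundamental_alexander_quandle L'"
proof (rule fundamental_alexander_quandle_cong)
  interpret L: chain_link L \<epsilon> by (rule L)
  interpret L': chain_link L' "- \<epsilon>" by (rule L')
  show len: "length L = length L'" by (simp add: L.components L'.components)
  show "arcs L = arcs L'" by (simp only: L.arcs_eq L'.arcs_eq)
  have "path_image (L ! i) = path_image (L' ! i)" if "i < 3" for i
    using L.path_images[OF that] L'.path_images[OF that] by simp
  then show "arc_index L = arc_index L'"
    unfolding arc_index_def L.components L'.components by (intro ext arg_cong[where f = The]) auto
  have "chain_link L (- (- \<epsilon>))" using L by simp
  then show "rho_image L = rho_image L'"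
    using chain_rho_crossing_in[OF L L'] chain_rho_crossing_in[OF L'] len
    by (intro equalityI rho_image_subset L.link_diagram_axioms L'.link_diagram_axioms) simp_all
qed

section \<open>Distinguishing the quandles of the chains\<close>

text \<open>The quandle on pairs \<open>(k, n)\<close>, in which an element of colour \<open>l\<close> translates the elements of
  colour \<open>k\<close> by \<open>W k l\<close>.\<close>

primrec translate_eval :: "(nat \<Rightarrow> nat \<Rightarrow> int) \<Rightarrow> ('a \<Rightarrow> nat \<times> int) \<Rightarrow> 'a qterm \<Rightarrow> nat \<times> int" where
  "translate_eval W w (Gen a) = w a"
| "translate_eval W w (Op s t) =
     (fst (translate_eval W w s), snd (translate_eval W w s) + W (fst (translate_eval W w s)) (fst (translate_eval W w t)))"
| "translate_eval W w (Inv s t) =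
     (fst (translate_eval W w s), snd (translate_eval W w s) - W (fst (translate_eval W w s)) (fst (translate_eval W w t)))"

text \<open>Colours never change and translations commute, which gives self-distributivity;
  idempotence is the vanishing of \<open>W k k\<close>.\<close>

lemma translate_eval_qcong:
  assumes "qcong A R s t" "\<And>k. W k k = 0"
    and "\<And>s t. (s, t) \<in> R \<Longrightarrow> translate_eval W w s = translate_eval W w t"
  shows "translate_eval W w s = translate_eval W w t"
  using assms(1) by (induction rule: qcong.induct) (simp_all add: assms(2,3))

definition class_eval :: "(nat \<Rightarrow> nat \<Rightarrow> int) \<Rightarrow> ('a \<Rightarrow> nat \<times> int) \<Rightarrow> 'a qterm set \<Rightarrow> nat \<times> int" where
  "class_eval W w X = translate_eval W w (SOME s. s \<in> X)"

lemma class_eval_qclass: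
  assumes "\<And>k. W k k = 0"
    and "\<And>s t. (s, t) \<in> R \<Longrightarrow> translate_eval W w s = translate_eval W w t"
    and "s \<in> qterms A"
  shows "class_eval W w (qclass A R s) = translate_eval W w s"
proof -
  have "(SOME t. t \<in> qclass A R s) \<in> qclass A R s"
    by (rule someI[of _ s]) (rule qclass_self[OF assms(3)])
  then have "qcong A R s (SOME t. t \<in> qclass A R s)"
    by (simp add: qclass_def)
  from translate_eval_qcong[of A R s _ W w, OF this assms(1,2)] show ?thesis
    by (simp add: class_eval_def)
qed

text \<open>The colours 0, 1, 2 stand for the rings A, C, B, in this order. In the row of B, the
  entries 1 and -1 say that A and C move its arcs in opposite directions; A and C are fixed by B. As
  A and C do not cross, no relation constrains their weights on each other; with the value 1, the
  two off-diagonal entries differ in every row.\<close>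

definition chain_weights :: "nat \<Rightarrow> nat \<Rightarrow> int" where
  "chain_weights k l = (if (k, l) \<in> {(0, 1), (1, 0), (2, 0)} then 1 else if (k, l) = (2, 1) then - 1 else 0)"

text \<open>All permutations are needed, because an isomorphism of quandles need not respect the
  order of the rings.\<close>

lemma chain_weights_separate:
  assumes "{k, l, m} = {0, 1, 2}" shows "chain_weights k l \<noteq> chain_weights k m"
proof -
  have mem: "0 \<in> {k, l, m}" "1 \<in> {k, l, m}" "2 \<in> {k, l, m}"
    using assms by blast+
  have "k \<in> {0, 1, 2}" "l \<in> {0, 1, 2}" "m \<in> {0, 1, 2}"
    using assms by blast+
  then have "k = 0 \<or> k = 1 \<or> k = 2" "l = 0 \<or> l = 1 \<or> l = 2" "m = 0 \<or> m = 1 \<or> m = 2"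
    by simp_all
  then show ?thesis
    by (elim disjE) (use mem in \<open>simp_all add: chain_weights_def\<close>)
qed

abbreviation crossing_relators :: "link \<Rightarrow> ((real ^ 4) set qterm \<times> (real ^ 4) set qterm) set" where
  "crossing_relators L \<equiv> (\<Union>c\<in>crossings L.
        {(Op (Gen (right_arc L c)) (Gen (over_arc L c)), Gen (left_arc L c)),
         (Inv (Gen (left_arc L c)) (Gen (over_arc L c)), Gen (right_arc L c))})"

context chain_link
begin

abbreviation cls where "cls \<equiv> qclass (arcs L) (crossing_relators L)"

lemma relation:
  assumes "\<exists>c\<in>crossings L. over_arc L c = u \<and> right_arc L c = r \<and> left_arc L c = l"
  shows "qop (fundamental_quandle L) (cls (Gen r)) (cls (Gen u)) = cls (Gen l)"
proof -
  obtain c where c: "c \<in> crossings L" "over_arc L c = u" "right_arc L c = r" "left_arc L c = l"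
    using assms by blast
  then have "(Op (Gen r) (Gen u), Gen l) \<in> crossing_relators L" by blast
  moreover have in_arcs: "u \<in> arcs L" "r \<in> arcs L" "l \<in> arcs L"
    using over_arc_in[OF c(1)] right_arc_in[OF c(1)] left_arc_in[OF c(1)] c by simp_all
  ultimately have "cls (Op (Gen r) (Gen u)) = cls (Gen l)"
    by (intro qclass_eqI qcong.rel) simp_all
  then show ?thesis
    unfolding fundamental_quandle_def using in_arcs by (simp add: qop_presented_quandle)
qed

lemma arc_colors_distinct: "Arc_A \<noteq> Arc_C" "Arc_A \<noteq> Upper" "Arc_A \<noteq> Lower" "Arc_C \<noteq> Upper" "Arc_C \<noteq> Lower"
  "Upper \<noteq> Lower"
proof -
  have "arc_index L Arc_A \<noteq> arc_index L Arc_C" "arc_index L Arc_A \<noteq> arc_index L Upper"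
    "arc_index L Arc_A \<noteq> arc_index L Lower" "arc_index L Arc_C \<noteq> arc_index L Upper"
    "arc_index L Arc_C \<noteq> arc_index L Lower"
    unfolding arc_index by simp_all
  then show "Arc_A \<noteq> Arc_C" "Arc_A \<noteq> Upper" "Arc_A \<noteq> Lower" "Arc_C \<noteq> Upper" "Arc_C \<noteq> Lower"
    by metis+
  have "Upper \<inter> Lower = {}" "Upper \<noteq> {}"
    using arc_nonempty[OF arc_in(2)] by (auto simp: half_part_def)
  then show "Upper \<noteq> Lower" by auto
qed

text \<open>The arcs of B get consecutive positions, since one step by A takes \<open>Lower\<close>
  to \<open>Upper\<close>.\<close>

definition arc_value :: "(real ^ 4) set \<Rightarrow> nat \<times> int" where
  "arc_value a = (if a = Arc_A then (0, 0) else if a = Arc_C then (1, 0) else if a = Lower then (2, 0) else (2, 1))"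

lemma arc_value: "arc_value Arc_A = (0, 0)" "arc_value Arc_C = (1, 0)" "arc_value Lower = (2, 0)" "arc_value Upper = (2, 1)"
  unfolding arc_value_def using arc_colors_distinct by (simp_all only: if_True if_False simp_thms not_sym)

lemma arc_value_relators:
  assumes "\<epsilon> = 1" "(s, t) \<in> crossing_relators L"
  shows "translate_eval chain_weights arc_value s = translate_eval chain_weights arc_value t"
proof -
  obtain c where c: "c \<in> crossings L"
    and st: "(s, t) = (Op (Gen (right_arc L c)) (Gen (over_arc L c)), Gen (left_arc L c)) \<or>
      (s, t) = (Inv (Gen (left_arc L c)) (Gen (over_arc L c)), Gen (right_arc L c))"
    using assms(2) by blast
  have "snd (arc_value (left_arc L c)) = snd (arc_value (right_arc L c)) +
      chain_weights (fst (arc_value (right_arc L c))) (fst (arc_value (over_arc L c))) \<and>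
      fst (arc_value (left_arc L c)) = fst (arc_value (right_arc L c))"
    using c by (cases rule: crossing_cases) (simp_all add: assms(1) arc_value chain_weights_def)
  then show ?thesis
    using st by (auto simp: prod_eq_iff)
qed

end

text \<open>For \<epsilon> = -1 both outer arcs take \<open>Lower\<close> to \<open>Upper\<close>.
  Carried along \<open>f\<close> into the translation quandle of the other chain, this makes two
  off-diagonal weights in one row equal.\<close>

lemma chain_quandles_not_isomorphic:
  assumes L: "chain_link L (- 1)" and L': "chain_link L' 1"
  shows "\<not> quandle_isomorphic (fundamental_quandle L) (fundamental_quandle L')"
proof
  interpret L: chain_link L "- 1" by (rule L)
  interpret L': chain_link L' 1 by (rule L')
  let ?Q = "fundamental_quandle L" and ?Q' = "fundamental_quandle L'"
  assume "quandle_isomorphic ?Q ?Q'"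
  then obtain f where f: "bij_betw f (elems ?Q) (elems ?Q')"
    and f_op: "\<forall>x\<in>elems ?Q. \<forall>y\<in>elems ?Q. f (qop ?Q x y) = qop ?Q' (f x) (f y) \<and> f (qinv ?Q x y) = qinv ?Q' (f x) (f y)"
    unfolding quandle_isomorphic_def by (elim exE conjE)
  define h where "h = class_eval chain_weights L'.arc_value"
  define g where "g x = h (f x)" for x
  have elems: "elems ?Q = L.cls ` qterms (arcs L)" "elems ?Q' = L'.cls ` qterms (arcs L')"
    by (simp_all add: fundamental_quandle_def elems_presented_quandle)
  have h: "h (L'.cls t) = translate_eval chain_weights L'.arc_value t" if "t \<in> qterms (arcs L')" for t
    unfolding h_def
  proof (rule class_eval_qclass[OF _ _ that])
    show "chain_weights k k = 0" for k by (auto simp: chain_weights_def)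
  qed (rule L'.arc_value_relators[OF HOL.refl])
  have h_op: "h (qop ?Q' x y) = (fst (h x), snd (h x) + chain_weights (fst (h x)) (fst (h y)))"
    and h_inv: "fst (h (qinv ?Q' x y)) = fst (h x)"
    if x: "x \<in> elems ?Q'" and y: "y \<in> elems ?Q'" for x y
  proof -
    obtain s t where st: "s \<in> qterms (arcs L')" "x = L'.cls s" "t \<in> qterms (arcs L')" "y = L'.cls t"
      using x y unfolding elems by auto
    show "h (qop ?Q' x y) = (fst (h x), snd (h x) + chain_weights (fst (h x)) (fst (h y)))"
      "fst (h (qinv ?Q' x y)) = fst (h x)"
      using st by (simp_all add: fundamental_quandle_def qop_presented_quandle qinv_presented_quandle h)
  qed
  have f_in: "f x \<in> elems ?Q'" if "x \<in> elems ?Q" for x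
    using bij_betw_apply[OF f that] .
  have g_op: "g (qop ?Q x y) = (fst (g x), snd (g x) + chain_weights (fst (g x)) (fst (g y)))"
    and g_inv: "fst (g (qinv ?Q x y)) = fst (g x)"
    if x: "x \<in> elems ?Q" and y: "y \<in> elems ?Q" for x y
    using f_op[THEN bspec, OF x, THEN bspec, OF y] h_op[OF f_in[OF x] f_in[OF y]] h_inv[OF f_in[OF x] f_in[OF y]]
    by (simp_all add: g_def)
  define a b c where "a = L.cls (Gen L.Arc_A)" and "b = L.cls (Gen L.Lower)" and "c = L.cls (Gen L.Arc_C)"
  have abc: "a \<in> elems ?Q" "b \<in> elems ?Q" "c \<in> elems ?Q"
    unfolding elems a_def b_def c_def using L.arc_in by (auto intro!: imageI)
  have upper: "qop ?Q b a = L.cls (Gen L.Upper)" "qop ?Q b c = L.cls (Gen L.Upper)"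
    unfolding a_def b_def c_def using L.relation[OF L.crossing_exists(1)] L.relation[OF L.crossing_exists(3)]
    by simp_all
  \<comment> \<open>The operations keep the colour of their left argument, so only colours of
    generators occur, and \<open>Upper\<close> inherits that of \<open>Lower\<close>.\<close>
  have color: "fst (g (L.cls t)) \<in> {fst (g a), fst (g b), fst (g c)}" if "t \<in> qterms (arcs L)" for t
    using that
  proof (induction t)
    case (Gen x)
    then consider "x = L.Arc_A" | "x = L.Upper" | "x = L.Lower" | "x = L.Arc_C"
      unfolding Gen_in_qterms L.arcs_eq by blast
    then show ?case
    proof cases
      case 2
      then show ?thesis using g_op[OF abc(2,1)] upper(1) by simp
    qed (simp_all add: a_def b_def c_def)
  next
    case (Op s t)
    then have st: "s \<in> qterms (arcs L)" "t \<in> qterms (arcs L)" by simp_all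
    then have "L.cls s \<in> elems ?Q" "L.cls t \<in> elems ?Q" unfolding elems by simp_all
    then have "fst (g (qop ?Q (L.cls s) (L.cls t))) = fst (g (L.cls s))" using g_op by simp
    then show ?case
      using Op.IH(1)[OF st(1)] st by (simp add: fundamental_quandle_def qop_presented_quandle)
  next
    case (Inv s t)
    then have st: "s \<in> qterms (arcs L)" "t \<in> qterms (arcs L)" by simp_all
    then have "L.cls s \<in> elems ?Q" "L.cls t \<in> elems ?Q" unfolding elems by simp_all
    then have "fst (g (qinv ?Q (L.cls s) (L.cls t))) = fst (g (L.cls s))" using g_inv by simp
    then show ?case
      using Inv.IH(1)[OF st(1)] st by (simp add: fundamental_quandle_def qinv_presented_quandle)
  qed
  \<comment> \<open>As \<open>f\<close> is onto, each colour used in the other chain is the colour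
    of some image, hence that of \<open>a\<close>, \<open>b\<close> or \<open>c\<close>.\<close>
  have hit: "fst (L'.arc_value x) \<in> {fst (g a), fst (g b), fst (g c)}" if x: "x \<in> arcs L'" for x
  proof -
    have "L'.cls (Gen x) \<in> f ` elems ?Q"
      using x f unfolding bij_betw_def elems(2) by simp
    then obtain t where "t \<in> qterms (arcs L)" "L'.cls (Gen x) = f (L.cls t)"
      unfolding elems by auto
    then show ?thesis
      using color[of t] h[of "Gen x"] x by (simp add: g_def)
  qed
  have "{0, 1, 2} \<subseteq> {fst (g b), fst (g a), fst (g c)}"
    using hit[OF L'.arc_in(1)] hit[OF L'.arc_in(3)] hit[OF L'.arc_in(4)] by (auto simp: L'.arc_value)
  \<comment> \<open>A set of at most three colours that contains 0, 1 and 2 equals {0, 1, 2}; the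
    three generators thus have distinct colours, in some order.\<close>
  moreover have "card {fst (g b), fst (g a), fst (g c)} \<le> card {0, 1, 2::nat}"
    by (simp add: card_insert_if)
  ultimately have "{fst (g b), fst (g a), fst (g c)} = {0, 1, 2}"
    by (metis card_seteq finite.emptyI finite.insertI)
  then have "chain_weights (fst (g b)) (fst (g a)) \<noteq> chain_weights (fst (g b)) (fst (g c))"
    by (rule chain_weights_separate)
  moreover have "g (qop ?Q b a) = g (qop ?Q b c)"
    using upper by simp
  ultimately show False
    using g_op[OF abc(2,1)] g_op[OF abc(2,3)] by simp
qed

lemma alexander_quandles_do_not_determine_quandles:
  "\<exists>L L'. is_link L \<and> regular_projection L \<and> is_link L' \<and> regular_projection L' \<and>
     quandle_isomorphic (fundamental_alexander_quandle L) (fundamental_alexander_quandle L') \<and>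
     \<not> quandle_isomorphic (fundamental_quandle L) (fundamental_quandle L')"
proof -
  let ?L = "[A0, B0, rect (5/2) (- 1) (1/2) (- 1)]" and ?L' = "[A0, B0, rect (5/2) 1 (1/2) 1]"
  have L: "chain_link ?L (- 1)" and L': "chain_link ?L' 1"
    by (rule chain_link.intro; simp)+
  have L'': "chain_link ?L' (- (- 1))"
    using L' by (simp only: minus_minus)
  have iso: "quandle_isomorphic Q Q" for Q :: "'b quandle_struct"
    unfolding quandle_isomorphic_def by (intro exI[of _ id]) simp
  interpret L: chain_link ?L "- 1" by (rule L)
  interpret L': chain_link ?L' 1 by (rule L')
  show ?thesis
  proof (rule exI[of _ ?L], rule exI[of _ ?L'], intro conjI)
    show "quandle_isomorphic (fundamental_alexander_quandle ?L) (fundamental_alexander_quandle ?L')"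
      unfolding chain_fundamental_alexander_quandles_eq[OF L L''] by (rule iso)
  qed (rule L.is_link L.regular_projection L'.is_link L'.regular_projection chain_quandles_not_isomorphic[OF L L'])+
qed

theorem mainTheorem2:
  shows "(\<exists>L L'. is_link L \<and> regular_projection L \<and> is_link L' \<and> regular_projection L' \<and>
            quandle_isomorphic (fundamental_alexander_quandle L) (fundamental_alexander_quandle L') \<and>
            \<not> quandle_isomorphic (fundamental_quandle L) (fundamental_quandle L')) \<and>
         (\<exists>L L'. is_link L \<and> regular_projection L \<and> is_link L' \<and> regular_projection L' \<and>
            length L = length L' \<and>
            quandle_isomorphic (total_alexander_quandle L) (total_alexander_quandle L') \<and>
            (\<forall>K K'. reindexing K L \<longrightarrow> reindexing K' L' \<longrightarrow> \<not> link_sequences_equivalent K K'))"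
  by (rule conjI[OF alexander_quandles_do_not_determine_quandles total_quandles_do_not_determine_sequences])

end
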